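(* Let $A$ be a $C^*$-algebra. The semiprime ideals of $A$ form a complete sublattice of the ideal lattice of $A$ (that is, arbitrary intersections and arbitrary sums of semiprime ideals are semiprime ideals). Thus, given a (two-sided, not necessarily norm-closed) ideal $I \subseteq A$, there exists a largest semiprime ideal $I^\infty$ contained in $I$, namely \[ I^\infty := \bigvee \{ J \subseteq A : J \text{ semiprime ideal}, J \subseteq I \}. \] Moreover, \[ I^\infty = \bigcap_{n=1}^\infty I^n = \{ x \in A : (x^*x)^{\frac{1}{n}} \in I_+ \text{ for every } n \geq 1 \} = \{ x \in A : (xx^* )^{\frac{1}{n}} \in I_+ \text{ for every } n \geq 1 \}. \]
   Context: $C^*$-algebras are not assumed unital, and $A_+$ denotes the set of positive elements of $A$. An ideal in a $C^*$-algebra $A$ is an additive subgroup $I \subseteq A$ with $aI \cup Ia \subseteq I$ for all $a \in A$; it is not assumed norm-closed, self-adjoint, or closed under complex scalars. Put $I_+ := I \cap A_+$. $I^n$ denotes the additive subgroup generated by $\{x_1\cdots x_n : x_1,\ldots,x_n \in I\}$, with $I^1 = I$. An ideal $I$ is semiprime if for all ideals $J \subseteq A$, $J^2 \subseteq I$ implies $J \subseteq I$. The ideals of $A$, ordered by inclusion, form a complete lattice in which the infimum of a family is its intersection and the supremum $\bigvee_\lambda I_\lambda$ is the sum $\sum_\lambda I_\lambda$, the set of finite sums of elements of $\bigcup_\lambda I_\lambda$. *)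

theory Defs
  imports Complex_Main
begin

section \<open>C*-algebras, not necessarily unital\<close>

class cstar_algebra = real_normed_algebra + banach +
  fixes scaleC :: "complex \<Rightarrow> 'a \<Rightarrow> 'a"
    and cstar :: "'a \<Rightarrow> 'a"
  assumes scaleC_add_right: "scaleC c (x + y) = scaleC c x + scaleC c y"
    and scaleC_add_left: "scaleC (c + d) x = scaleC c x + scaleC d x"
    and scaleC_scaleC: "scaleC c (scaleC d x) = scaleC (c * d) x"
    and scaleC_of_real: "scaleC (complex_of_real r) x = scaleR r x"
    and mult_scaleC_left: "scaleC c x * y = scaleC c (x * y)"
    and mult_scaleC_right: "x * scaleC c y = scaleC c (x * y)"
    and norm_scaleC: "norm (scaleC c x) = cmod c * norm x"
    and cstar_add: "cstar (x + y) = cstar x + cstar y"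
    and cstar_scaleC: "cstar (scaleC c x) = scaleC (cnj c) (cstar x)"
    and cstar_mult: "cstar (x * y) = cstar y * cstar x"
    and cstar_cstar: "cstar (cstar x) = x"
    and cstar_identity: "norm (cstar x * x) = (norm x)\<^sup>2"

text \<open>
  The unitization of the algebra has underlying set \<open>'a \<times> complex\<close>, the pair
  \<open>(x, s)\<close> standing for \<open>x + s 1\<close>, and unit \<open>(0, 1)\<close>.
\<close>

definition unitization_mult ::
    "'a::cstar_algebra \<times> complex \<Rightarrow> 'a \<times> complex \<Rightarrow> 'a \<times> complex" where
  "unitization_mult u v =
     (fst u * fst v + scaleC (snd u) (fst v) + scaleC (snd v) (fst u), snd u * snd v)"

text \<open>
  The spectrum is taken in the unitization, by inverting \<open>l 1 - a\<close> there. A unit is adjoined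
  even if the algebra already has one; this can only add the point \<open>0\<close> to the spectrum and
  so does not affect positivity.
\<close>

definition cstar_spectrum :: "'a::cstar_algebra \<Rightarrow> complex set" where
  "cstar_spectrum a =
     {l. \<not> (\<exists>u. unitization_mult u (- a, l) = (0, 1) \<and> unitization_mult (- a, l) u = (0, 1))}"

definition cstar_positives :: "'a::cstar_algebra set" where
  "cstar_positives =
     {a. cstar a = a \<and> (\<forall>l\<in>cstar_spectrum a. l \<in> \<real> \<and> 0 \<le> Re l)}"

text \<open>
  Without a unit only products of nonempty lists make sense; the value at \<open>[]\<close> is a dummy
  that is never used below.
\<close>

fun list_product :: "'a::cstar_algebra list \<Rightarrow> 'a" where
  "list_product [] = 0"
| "list_product [x] = x"
| "list_product (x # y # xs) = x * list_product (y # xs)"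

text \<open>
  For positive \<open>a\<close> and \<open>n \<ge> 1\<close>, \<open>a\<close> to the power \<open>1/n\<close> is the unique positive \<open>n\<close>-th root
  of \<open>a\<close>.
\<close>

definition cstar_nth_root :: "nat \<Rightarrow> 'a::cstar_algebra \<Rightarrow> 'a" where
  "cstar_nth_root n a =
     (THE b. b \<in> cstar_positives \<and> list_product (replicate n b) = a)"


section \<open>Algebraic ideals\<close>

definition additive_subgroup_set :: "'a::cstar_algebra set \<Rightarrow> bool" where
  "additive_subgroup_set S \<longleftrightarrow>
     0 \<in> S \<and> (\<forall>x\<in>S. \<forall>y\<in>S. x + y \<in> S) \<and> (\<forall>x\<in>S. - x \<in> S)"

definition cstar_ideal :: "'a::cstar_algebra set \<Rightarrow> bool" where
  "cstar_ideal I \<longleftrightarrow>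
     additive_subgroup_set I \<and> (\<forall>a. \<forall>x\<in>I. a * x \<in> I \<and> x * a \<in> I)"

definition ideal_positives :: "'a::cstar_algebra set \<Rightarrow> 'a set" where
  "ideal_positives I = I \<inter> cstar_positives"

text \<open>Only exponents \<open>n \<ge> 1\<close> are meaningful.\<close>

definition ideal_power :: "'a::cstar_algebra set \<Rightarrow> nat \<Rightarrow> 'a set" where
  "ideal_power I n =
     additive_subgroup_set hull {list_product xs |xs. length xs = n \<and> set xs \<subseteq> I}"

definition semiprime_ideal :: "'a::cstar_algebra set \<Rightarrow> bool" where
  "semiprime_ideal I \<longleftrightarrow>
     cstar_ideal I \<and> (\<forall>J. cstar_ideal J \<and> ideal_power J 2 \<subseteq> I \<longrightarrow> J \<subseteq> I)"

definition ideal_Sum :: "'a::cstar_algebra set set \<Rightarrow> 'a set" where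
  "ideal_Sum F = {sum_list xs |xs. set xs \<subseteq> \<Union> F}"

text \<open>
  The supremum of a family of ideals in the ideal lattice is its sum, and the infimum is its
  intersection; for the empty family these are \<open>{0}\<close> and the whole algebra.
\<close>

lemma cstar_ideal_Sum:
  assumes "\<And>I. I \<in> F \<Longrightarrow> cstar_ideal I"
  shows "cstar_ideal (ideal_Sum F)"
proof -
  have sub: "additive_subgroup_set I" "\<And>a x. x \<in> I \<Longrightarrow> a * x \<in> I \<and> x * a \<in> I" if "I \<in> F" for I
    using assms[OF that] by (auto simp: cstar_ideal_def)
  have neg: "- sum_list xs = sum_list (map uminus xs)" for xs :: "'a list"
    by (induction xs) auto
  have 0: "0 \<in> ideal_Sum F"
    unfolding ideal_Sum_def by (rule CollectI, rule exI[of _ "[]"]) auto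
  have plus: "x + y \<in> ideal_Sum F" if x: "x \<in> ideal_Sum F" and y: "y \<in> ideal_Sum F" for x y
  proof -
    obtain xs where "x = sum_list xs" "set xs \<subseteq> \<Union> F"
      using x by (auto simp: ideal_Sum_def)
    moreover obtain ys where "y = sum_list ys" "set ys \<subseteq> \<Union> F"
      using y by (auto simp: ideal_Sum_def)
    ultimately show ?thesis
      unfolding ideal_Sum_def by (intro CollectI exI[of _ "xs @ ys"]) auto
  qed
  have map: "sum_list (map f xs) \<in> ideal_Sum F"
    if xs: "set xs \<subseteq> \<Union> F" and f: "\<And>I x. I \<in> F \<Longrightarrow> x \<in> I \<Longrightarrow> f x \<in> I" for f xs
  proof -
    have "set (map f xs) \<subseteq> \<Union> F"
      using xs f by (simp add: image_subset_iff subset_iff) blast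
    then show ?thesis
      unfolding ideal_Sum_def by blast
  qed
  have uminus: "- x \<in> ideal_Sum F" if x: "x \<in> ideal_Sum F" for x
  proof -
    obtain xs where xs: "x = sum_list xs" "set xs \<subseteq> \<Union> F"
      using x by (auto simp: ideal_Sum_def)
    have "sum_list (map uminus xs) \<in> ideal_Sum F"
      by (rule map[OF xs(2)]) (use sub(1) in \<open>simp add: additive_subgroup_set_def\<close>)
    then show ?thesis
      by (simp add: xs(1) neg)
  qed
  have mult: "a * x \<in> ideal_Sum F \<and> x * a \<in> ideal_Sum F" if x: "x \<in> ideal_Sum F" for a x
  proof -
    obtain xs where xs: "x = sum_list xs" "set xs \<subseteq> \<Union> F"
      using x by (auto simp: ideal_Sum_def)
    have "sum_list (map (\<lambda>y. a * y) xs) \<in> ideal_Sum F"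
      by (rule map[OF xs(2)]) (use sub(2) in simp)
    moreover have "sum_list (map (\<lambda>y. y * a) xs) \<in> ideal_Sum F"
      by (rule map[OF xs(2)]) (use sub(2) in simp)
    ultimately show ?thesis
      by (simp add: xs(1) sum_list_const_mult sum_list_mult_const)
  qed
  show ?thesis
    using 0 plus uminus mult by (simp add: cstar_ideal_def additive_subgroup_set_def)
qed

lemma ideal_Sum_upper:
  assumes "I \<in> F" shows "I \<subseteq> ideal_Sum F"
proof
  fix x assume "x \<in> I"
  then show "x \<in> ideal_Sum F"
    using assms unfolding ideal_Sum_def by (intro CollectI exI[of _ "[x]"]) auto
qed

lemma ideal_Sum_least:
  assumes "cstar_ideal K" "\<And>I. I \<in> F \<Longrightarrow> I \<subseteq> K"
  shows "ideal_Sum F \<subseteq> K"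
proof -
  have "sum_list xs \<in> K" if "set xs \<subseteq> \<Union> F" for xs
    using that
  proof (induction xs)
    case Nil
    then show ?case
      using assms(1) by (simp add: cstar_ideal_def additive_subgroup_set_def)
  next
    case (Cons a xs)
    then have "a \<in> K" "sum_list xs \<in> K"
      using assms(2) by auto
    then show ?case
      using assms(1) by (simp add: cstar_ideal_def additive_subgroup_set_def)
  qed
  then show ?thesis by (auto simp: ideal_Sum_def)
qed

lemma cstar_ideal_Inter:
  assumes "\<And>I. I \<in> F \<Longrightarrow> cstar_ideal I"
  shows "cstar_ideal (\<Inter> F)"
  using assms by (fastforce simp: cstar_ideal_def additive_subgroup_set_def)

definition ideal_infinity :: "'a::cstar_algebra set \<Rightarrow> 'a set" where
  "ideal_infinity I = ideal_Sum {J. semiprime_ideal J \<and> J \<subseteq> I}"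

end

theory Submission
  imports Defs "HOL-Analysis.Analysis" "HOL-Computational_Algebra.Fundamental_Theorem_Algebra"
begin

text \<open>
  For a positive element \<open>e\<close> of a unital C*-algebra \<open>B\<close> let \<open>M\<^sub>r\<close> be the additive span of
  \<open>B e\<^sup>r B\<close>. Up to an arbitrarily small loss in the exponent, \<open>M\<^sub>r\<close> behaves like the \<open>r\<close>-th power of
  an ideal: if \<open>b \<in> M\<^sub>r\<close> is positive and \<open>0 < s < 1\<close>, then \<open>b\<^sup>s \<in> M\<^sub>q\<close> for all \<open>q < s r\<close>, and
  \<open>M\<^sub>r M\<^sub>r \<subseteq> M\<^sub>q\<close> for all \<open>q < 2 r\<close>. Both rest on the Loewner--Heinz inequality and on the
  factorization \<open>x = u b\<^sup>g\<close>, \<open>g < 1/2\<close>, of an element with \<open>x\<^sup>* x \<le> b\<close>.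

  Apply this in the unitization of \<open>A\<close>. If \<open>e\<close> lies in an ideal \<open>I\<close> of \<open>A\<close> and \<open>r > 1\<close>, then
  \<open>A \<inter> M\<^sub>r \<subseteq> I\<close>. An element \<open>x \<in> I\<^sup>n\<close> with \<open>n\<close> large is a sum of products of \<open>n\<close> factors from a
  finite set \<open>Z \<subseteq> I\<close>, which lie in \<open>M\<^bsub>1/8\<^esub>\<close> for the sum \<open>e \<in> I\<close> of the \<open>z\<^sup>* z\<close>, \<open>z \<in> Z\<close>, so \<open>x \<in> M\<^sub>r\<close> with
  \<open>r\<close> large and small roots of \<open>x\<^sup>* x\<close> and \<open>x x\<^sup>*\<close> lie in \<open>I\<close>. Conversely \<open>x = u (x\<^sup>* x)\<^bsup>1/4\<^esup>\<close> is in
  \<open>I\<^sup>n\<close> if the roots of \<open>x\<^sup>* x\<close> are in \<open>I\<close>. If \<open>J\<close> is semiprime and \<open>x \<in> J\<close>, take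
  \<open>e = x\<^sup>* x\<close>; the ideals \<open>A \<inter> M\<^sub>r\<close> lie in \<open>J\<close> for \<open>r > 1\<close>, and by semiprimeness
  and the product rule for ever smaller \<open>r\<close>, so that \<open>J\<close> contains all roots of \<open>e\<close>. Hence an ideal
  \<open>J\<close> is semiprime if and only if it equals the intersection of its powers, a property preserved by sums.
\<close>

section \<open>Spectra in unital C*-algebras\<close>

lemma scaleC_zero_right [simp]: "scaleC c (0::'a::cstar_algebra) = 0"
  using scaleC_add_right[of c "0::'a" 0] by simp

lemma scaleC_zero_left [simp]:
  fixes x :: "'a::cstar_algebra"
  shows "scaleC 0 x = 0"
  using scaleC_add_left[of 0 0 x] by simp

lemma scaleC_one [simp]:
  fixes x :: "'a::cstar_algebra"
  shows "scaleC 1 x = x"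
  using scaleC_of_real[of 1 x] by simp

lemma scaleC_minus_right [simp]:
  fixes x :: "'a::cstar_algebra"
  shows "scaleC c (- x) = - scaleC c x"
  using scaleC_add_right[of c x "- x"] by (simp add: eq_neg_iff_add_eq_0 add.commute)

lemma scaleC_minus_left [simp]:
  fixes x :: "'a::cstar_algebra"
  shows "scaleC (- c) x = - scaleC c x"
  using scaleC_add_left[of c "- c" x] by (simp add: eq_neg_iff_add_eq_0 add.commute)

lemma scaleC_diff_right:
  fixes x :: "'a::cstar_algebra"
  shows "scaleC c (x - y) = scaleC c x - scaleC c y"
  using scaleC_add_right[of c x "- y"] by simp

lemma scaleC_scaleR:
  fixes x :: "'a::cstar_algebra"
  shows "scaleC c (r *\<^sub>R x) = r *\<^sub>R scaleC c x"
  by (simp add: scaleC_of_real[symmetric] scaleC_scaleC mult.commute)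

lemma cstar_zero [simp]: "cstar (0::'a::cstar_algebra) = 0"
  using cstar_add[of "0::'a" 0] by simp

lemma cstar_minus [simp]:
  fixes x :: "'a::cstar_algebra"
  shows "cstar (- x) = - cstar x"
  using cstar_add[of x "- x"] by (simp add: eq_neg_iff_add_eq_0 add.commute)

lemma cstar_diff:
  fixes x :: "'a::cstar_algebra"
  shows "cstar (x - y) = cstar x - cstar y"
  using cstar_add[of x "- y"] by simp

lemma cstar_scaleR:
  fixes x :: "'a::cstar_algebra"
  shows "cstar (r *\<^sub>R x) = r *\<^sub>R cstar x"
  by (simp add: scaleC_of_real[symmetric] cstar_scaleC)

text \<open>The C*-identity and submultiplicativity bound the square of \<open>norm y\<close> by
  \<open>norm (cstar y) * norm y\<close>; the reverse inequality is the same bound for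
  \<open>cstar x\<close>.\<close>

lemma norm_cstar [simp]:
  fixes x :: "'a::cstar_algebra"
  shows "norm (cstar x) = norm x"
proof -
  have le: "norm y \<le> norm (cstar y)" for y :: 'a
  proof (cases "y = 0")
    case False
    have "norm y * norm y \<le> norm (cstar y) * norm y"
      using norm_mult_ineq[of "cstar y" y] by (simp add: cstar_identity power2_eq_square)
    then show ?thesis using False by simp
  qed simp
  show ?thesis using le[of x] le[of "cstar x"] by (simp add: cstar_cstar)
qed

lemma bounded_linear_cstar: "bounded_linear (cstar :: 'a::cstar_algebra \<Rightarrow> 'a)"
  by (rule bounded_linear_intro[of _ 1]) (auto simp: cstar_add cstar_scaleR)

lemmas tendsto_cstar = bounded_linear.tendsto[OF bounded_linear_cstar]

lemma bounded_linear_scaleC: "bounded_linear (scaleC c :: 'a::cstar_algebra \<Rightarrow> 'a)"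
  by (rule bounded_linear_intro[of _ "cmod c"])
    (auto simp: scaleC_add_right scaleC_scaleR norm_scaleC mult.commute)

definition self_adjoint :: "'a::cstar_algebra \<Rightarrow> bool" where
  "self_adjoint a \<longleftrightarrow> cstar a = a"

lemma norm_square_self_adjoint:
  "self_adjoint h \<Longrightarrow> norm (h * h) = (norm h)\<^sup>2"
  by (metis cstar_identity self_adjoint_def)

text \<open>The analysis takes place in this class, where \<open>norm 1 = 1\<close>. A general
  algebra enters through its unitization, which is made an instance further down.\<close>

class cstar_algebra_1 = cstar_algebra + real_normed_algebra_1

lemma cstar_one [simp]: "cstar (1::'a::cstar_algebra_1) = 1"
  by (metis cstar_cstar cstar_mult mult_1_left mult_1_right)

section \<open>Invertible elements\<close>

definition unit_elem :: "'a::cstar_algebra_1 \<Rightarrow> bool" where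
  "unit_elem x \<longleftrightarrow> (\<exists>y. x * y = 1 \<and> y * x = 1)"

lemma unit_elem_scaleC:
  assumes "c \<noteq> 0" "unit_elem x" shows "unit_elem (scaleC c x)"
proof -
  obtain y where "x * y = 1" "y * x = 1" using assms(2) by (auto simp: unit_elem_def)
  then show ?thesis unfolding unit_elem_def using assms(1)
    by (intro exI[of _ "scaleC (1 / c) y"])
      (simp add: mult_scaleC_left mult_scaleC_right scaleC_scaleC)
qed

lemma unit_elem_scaleR:
  "c \<noteq> 0 \<Longrightarrow> unit_elem x \<Longrightarrow> unit_elem (c *\<^sub>R x)"
  using unit_elem_scaleC[of "complex_of_real c" x] by (simp add: scaleC_of_real)

lemma unit_elem_mult:
  assumes "unit_elem x" "unit_elem y" shows "unit_elem (x * y)"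
proof -
  obtain x' y' where "x * x' = 1" "x' * x = 1" "y * y' = 1" "y' * y = 1"
    using assms by (auto simp: unit_elem_def)
  then show ?thesis unfolding unit_elem_def
    by (intro exI[of _ "y' * x'"]) (metis mult.assoc mult_1_left)
qed

text \<open>Neumann series: the powers of \<open>x\<close> are summable by completeness, and
  multiplication by \<open>1 - x\<close> makes the series telescope.\<close>

lemma unit_elem_one_minus:
  fixes x :: "'a::cstar_algebra_1"
  assumes "norm x < 1" shows "unit_elem (1 - x)"
proof -
  have "summable (\<lambda>n. norm x ^ n)" using assms by (intro summable_geometric) auto
  then have s: "summable (\<lambda>n. x ^ n)"
    by (rule summable_comparison_test'[where N = 0]) (simp add: norm_power_ineq)
  define y where "y = (\<Sum>n. x ^ n)"
  have y: "(\<lambda>n. x ^ n) sums y" using s by (simp add: y_def summable_sums)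
  have t: "(\<lambda>n. x ^ n - x ^ Suc n) sums (x ^ 0 - 0)"
    by (rule telescope_sums'[OF summable_LIMSEQ_zero[OF s]])
  have "(1 - x) * x ^ n = x ^ n - x ^ Suc n" "x ^ n * (1 - x) = x ^ n - x ^ Suc n" for n
    by (simp_all add: left_diff_distrib right_diff_distrib power_commutes)
  then have "(\<lambda>n. x ^ n - x ^ Suc n) sums ((1 - x) * y)" "(\<lambda>n. x ^ n - x ^ Suc n) sums (y * (1 - x))"
    using sums_mult[OF y, of "1 - x"] sums_mult2[OF y, of "1 - x"] by simp_all
  then have 1: "(1 - x) * y = 1" and 2: "y * (1 - x) = 1"
    using t by (auto dest: sums_unique2)
  show ?thesis using 1 2 by (auto simp: unit_elem_def)
qed

lemma unit_elem_scaleC_minus: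
  fixes x :: "'a::cstar_algebra_1"
  assumes "norm x < cmod l" shows "unit_elem (scaleC l 1 - x)"
proof -
  have l: "l \<noteq> 0" using assms by auto
  have "norm (scaleC (1 / l) x) < 1"
    using assms l by (simp add: norm_scaleC norm_divide divide_simps)
  then have "unit_elem (scaleC l (1 - scaleC (1 / l) x))"
    by (intro unit_elem_scaleC unit_elem_one_minus l)
  then show ?thesis using l by (simp add: scaleC_diff_right scaleC_scaleC)
qed

text \<open>The argument of Arens: after translation by a suitable imaginary multiple of
  \<open>1\<close>, the point lies outside the disc whose radius is the norm, and the Neumann series
  applies.\<close>

lemma unit_elem_nonreal:
  fixes a :: "'a::cstar_algebra_1"
  assumes a: "self_adjoint a" and l: "Im l \<noteq> 0"
  shows "unit_elem (scaleC l 1 - a)"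
proof -
  define h where "h = Re l *\<^sub>R 1 - a"
  \<comment> \<open>With this \<open>t\<close> the mixed term of the square of
    \<open>t + Im l\<close> is exactly the square of \<open>norm h\<close>, so the bound for
    \<open>norm y\<close> is beaten by the square of \<open>Im l\<close>.\<close>
  define t where "t = (norm h)\<^sup>2 / (2 * Im l)"
  define y where "y = scaleC (\<i> * t) 1 - h"
  have hs: "cstar h = h" using a by (simp add: h_def self_adjoint_def cstar_diff cstar_scaleR)
  have "cstar y * y = scaleC (- (\<i> * t) * (\<i> * t)) 1 + h * h"
    by (simp add: y_def cstar_diff cstar_scaleC hs left_diff_distrib right_diff_distrib
        mult_scaleC_left mult_scaleC_right scaleC_diff_right scaleC_scaleC)
  also have "- (\<i> * t) * (\<i> * t) = complex_of_real (t\<^sup>2)"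
    by (simp add: power2_eq_square complex_eq_iff)
  also have "scaleC (complex_of_real (t\<^sup>2)) (1::'a) = (t\<^sup>2) *\<^sub>R 1" by (rule scaleC_of_real)
  finally have "norm (cstar y * y) \<le> t\<^sup>2 + (norm h)\<^sup>2"
    using norm_triangle_ineq[of "(t\<^sup>2) *\<^sub>R 1" "h * h"] norm_mult_ineq[of h h]
    by (simp add: power2_eq_square)
  then have "(norm y)\<^sup>2 \<le> t\<^sup>2 + (norm h)\<^sup>2" by (simp add: cstar_identity)
  also have "\<dots> < (t + Im l)\<^sup>2"
    using l by (simp add: t_def power2_sum)
  finally have "norm y < \<bar>t + Im l\<bar>"
    by (metis abs_ge_zero power2_abs power2_less_imp_less)
  also have "\<dots> = cmod (\<i> * (t + Im l))" by (simp add: norm_mult del: of_real_add)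
  finally have "unit_elem (scaleC (\<i> * (t + Im l)) 1 - y)" by (rule unit_elem_scaleC_minus)
  also have "scaleC (\<i> * (t + Im l)) 1 - y = scaleC l 1 - a"
  proof -
    have "scaleC l (1::'a) = scaleC (of_real (Re l)) 1 + scaleC (\<i> * Im l) 1"
      by (metis complex_eq scaleC_add_left)
    then show ?thesis
      by (simp add: y_def h_def scaleC_of_real distrib_left scaleC_add_left)
  qed
  finally show ?thesis .
qed

text \<open>Writing the root as \<open>1 - z\<close> turns the equation into the fixed point problem
  \<open>z = (x + z * z) / 2\<close>, a contraction on the ball of radius \<open>norm x\<close>.
  Self-adjointness and commutation are closed conditions preserved by the iteration, so they are
  built into the set \<open>S\<close> and inherited by the fixed point.\<close>

lemma sqrt_one_minus:
  fixes x :: "'a::cstar_algebra_1"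
  assumes x: "norm x < 1" and sa: "self_adjoint x"
  obtains y where "self_adjoint y" "y * y = 1 - x" "\<And>c. c * x = x * c \<Longrightarrow> c * y = y * c"
proof -
  define q where "q = norm x"
  have q: "0 \<le> q" "q < 1" using x by (auto simp: q_def)
  define S where "S = cball 0 q \<inter> {z. cstar z = z} \<inter> (\<Inter>c\<in>{c. c * x = x * c}. {z. c * z = z * c})"
  define f where "f z = (1/2) *\<^sub>R (x + z * z)" for z
  have "closed {z::'a. cstar z = z}"
    by (intro closed_Collect_eq continuous_intros bounded_linear.continuous_on[OF bounded_linear_cstar])
  moreover have "closed {z::'a. c * z = z * c}" for c
    by (intro closed_Collect_eq continuous_intros)
  ultimately have "complete S"
    unfolding complete_eq_closed S_def by (intro closed_Int closed_INT) auto
  moreover have "S \<noteq> {}"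
  proof -
    have "0 \<in> S" using q by (auto simp: S_def)
    then show ?thesis by auto
  qed
  moreover have "f ` S \<subseteq> S"
  proof safe
    fix z assume z: "z \<in> S"
    then have nz: "norm z \<le> q" by (simp add: S_def)
    have "norm (f z) \<le> (1/2) * (q + norm z * norm z)"
      unfolding f_def using norm_triangle_ineq[of x "z * z"] norm_mult_ineq[of z z]
      by (simp add: q_def)
    also have "norm z * norm z \<le> q * 1" using nz q by (intro mult_mono) auto
    finally have "norm (f z) \<le> q" by simp
    moreover have "cstar z = z" using z unfolding S_def by blast
    then have "cstar (f z) = f z"
      using sa by (simp add: f_def cstar_scaleR cstar_add cstar_mult self_adjoint_def)
    moreover have "c * f z = f z * c" if c: "c * x = x * c" for c
    proof -
      have cz: "c * z = z * c" using z c unfolding S_def by blast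
      have "c * (z * z) = z * z * c" by (metis cz mult.assoc)
      then show ?thesis using c by (simp add: f_def distrib_left distrib_right)
    qed
    ultimately show "f z \<in> S" unfolding S_def by (intro IntI INT_I CollectI) auto
  qed
  moreover have "dist (f z) (f w) \<le> q * dist z w" if zw: "z \<in> S" "w \<in> S" for z w
  proof -
    have "f z - f w = (1/2) *\<^sub>R (z * (z - w) + (z - w) * w)"
      by (simp add: f_def algebra_simps flip: scaleR_diff_right)
    also have "norm \<dots> \<le> (1/2) * (norm z * norm (z - w) + norm (z - w) * norm w)"
      using norm_triangle_ineq[of "z * (z - w)" "(z - w) * w"]
        norm_mult_ineq[of z "z - w"] norm_mult_ineq[of "z - w" w] by simp
    also have "\<dots> \<le> (1/2) * (q * norm (z - w) + norm (z - w) * q)"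
      using zw by (intro mult_left_mono add_mono mult_right_mono mult_left_mono) (auto simp: S_def)
    finally show ?thesis by (simp add: dist_norm mult.commute)
  qed
  ultimately obtain z where z: "z \<in> S" "f z = z"
    using Banach_fix[of S q f] q by blast
  have "x + z * z = 2 *\<^sub>R f z" by (simp add: f_def)
  then have "x + z * z = 2 *\<^sub>R z" using z(2) by simp
  then have e: "(1 - z) * (1 - z) = 1 - x" by (simp add: algebra_simps scaleR_2)
  show ?thesis
  proof (rule that[of "1 - z"])
    have "cstar z = z" using z(1) unfolding S_def by blast
    then show "self_adjoint (1 - z)" by (simp add: self_adjoint_def cstar_diff)
    show "c * (1 - z) = (1 - z) * c" if "c * x = x * c" for c
    proof -
      have "c * z = z * c" using z(1) that unfolding S_def by blast
      then show ?thesis by (simp add: left_diff_distrib right_diff_distrib)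
    qed
  qed (rule e)
qed

lemma inverse_commute:
  assumes "x * y = 1" "y * x = 1" "c * x = x * c"
  shows "c * y = y * (c::'a::cstar_algebra_1)"
  by (metis assms mult.assoc mult_1_left mult_1_right)

text \<open>
  If \<open>1 - h\<^sup>2\<close> is invertible, then it is bounded below by some \<open>\<delta> > 0\<close>, whence \<open>\<parallel>h\<parallel>\<^sup>2 \<le> 1 - \<delta>\<close>:
  write \<open>1 - h\<^sup>2 - \<delta>\<close> approximately as the square \<open>(k l)\<^sup>2\<close> and
  look at \<open>w = h + i k l\<close>.
\<close>
lemma norm_1_in_spectrum:
  fixes h :: "'a::cstar_algebra_1"
  assumes h: "self_adjoint h" "norm h = 1" and inv: "unit_elem (1 - h * h)"
  shows False
proof -
  obtain g where g: "(1 - h * h) * g = 1" "g * (1 - h * h) = 1"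
    using inv by (auto simp: unit_elem_def)
  have hs: "cstar h = h" using h by (simp add: self_adjoint_def)
  have gs: "cstar g = g"
  proof -
    have "cstar ((1 - h * h) * g) = 1" using g by simp
    then have "cstar g * (1 - h * h) = 1" by (simp add: cstar_mult cstar_diff hs)
    then show ?thesis by (metis g(1) mult.assoc mult_1_left mult_1_right)
  qed
  have gh: "h * g = g * h"
    by (rule inverse_commute[OF g]) (simp add: algebra_simps)
  define M where "M = norm g + 1"
  \<comment> \<open>This is the \<open>\<delta>\<close> announced above. Since \<open>g\<close>
    inverts \<open>1 - h * h\<close>, the product of \<open>1 - h * h\<close> and
    \<open>1 - d *\<^sub>R g\<close> is \<open>1 - h * h - d *\<^sub>R 1\<close>; the second factor
    has a root because \<open>norm (d *\<^sub>R g) < 1\<close>.\<close>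
  define d where "d = 1 / M"
  have M: "M \<ge> 1" by (simp add: M_def)
  have d: "0 < d" "d \<le> 1" using M by (auto simp: d_def)
  have ndg: "norm (d *\<^sub>R g) < 1"
    using M by (simp add: d_def) (simp add: M_def divide_less_eq add_pos_pos)
  have "self_adjoint (d *\<^sub>R g)" by (simp add: gs self_adjoint_def cstar_scaleR)
  with ndg obtain l where l: "self_adjoint l" "l * l = 1 - d *\<^sub>R g"
    "\<And>c. c * (d *\<^sub>R g) = (d *\<^sub>R g) * c \<Longrightarrow> c * l = l * c"
    using sqrt_one_minus by blast
  \<comment> \<open>As \<open>h * h\<close> has norm exactly 1, it is shrunk slightly so that
    \<open>1 - x\<close> has a root. The resulting error, at most \<open>d/2\<close> in norm, is
    smaller than the gain \<open>d\<close>.\<close>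
  define x where "x = (1 - d/4) *\<^sub>R (h * h)"
  have nh: "norm (h * h) = 1" using norm_square_self_adjoint[OF h(1)] h(2) by simp
  have "norm x < 1" using d nh by (simp add: x_def)
  moreover have "self_adjoint x" using hs by (simp add: x_def self_adjoint_def cstar_scaleR cstar_mult)
  ultimately obtain k where k: "self_adjoint k" "k * k = 1 - x" "\<And>c. c * x = x * c \<Longrightarrow> c * k = k * c"
    using sqrt_one_minus by blast
  have hk: "h * k = k * h" by (rule k(3)) (simp add: x_def mult.assoc)
  have gk: "g * k = k * g"
  proof (rule k(3))
    show "g * x = x * g" by (simp add: x_def) (metis gh mult.assoc)
  qed
  have kl: "k * l = l * k" by (rule l(3)) (simp add: gk)
  have hl: "h * l = l * h" by (rule l(3)) (simp add: gh)
  define m where "m = k * l"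
  have ms: "cstar m = m" using k(1) l(1) kl by (simp add: m_def self_adjoint_def cstar_mult)
  have hm: "h * m = m * h" by (metis hk hl m_def mult.assoc)
  have mm: "m * m = (1 - x) * (1 - d *\<^sub>R g)"
    by (metis k(2) kl l(2) m_def mult.assoc)
  define w where "w = h + scaleC \<i> m"
  have "cstar w * w = h * h + m * m"
    by (simp add: w_def cstar_add cstar_scaleC hs ms algebra_simps mult_scaleC_left mult_scaleC_right hm scaleC_scaleC
        scaleC_add_right scaleC_diff_right)
  also have "\<dots> = (1 - d) *\<^sub>R 1 + (d/4) *\<^sub>R (h * h * (l * l))"
  proof -
    have x: "1 - x = (1 - h * h) + (d/4) *\<^sub>R (h * h)"
      by (simp add: x_def algebra_simps)
    have "(1 - h * h) * (1 - d *\<^sub>R g) = 1 - h * h - d *\<^sub>R 1"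
      using g(1) by (metis mult_1_right mult_scaleR_right right_diff_distrib)
    then show ?thesis unfolding mm x distrib_right l(2) by (simp add: algebra_simps)
  qed
  also have "norm \<dots> \<le> (1 - d) + (d/4) * (norm (h * h) * norm (l * l))"
  proof -
    have "norm ((1 - d) *\<^sub>R 1 + (d/4) *\<^sub>R (h * h * (l * l))) \<le> (1 - d) + (d/4) * norm (h * h * (l * l))"
      using norm_triangle_ineq[of "(1 - d) *\<^sub>R 1" "(d/4) *\<^sub>R (h * h * (l * l))"] d by simp
    moreover have "(d/4) * norm (h * h * (l * l)) \<le> (d/4) * (norm (h * h) * norm (l * l))"
      using d by (intro mult_left_mono norm_mult_ineq) auto
    ultimately show "norm ((1 - d) *\<^sub>R 1 + (d/4) *\<^sub>R (h * h * (l * l)))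
        \<le> (1 - d) + (d/4) * (norm (h * h) * norm (l * l))" by linarith
  qed
  finally have "norm (cstar w * w) \<le> (1 - d) + (d/4) * (norm (h * h) * norm (l * l))" .
  moreover have "norm (l * l) \<le> 2"
    unfolding l(2) using norm_triangle_ineq4[of 1 "d *\<^sub>R g"] ndg by simp
  then have "(d/4) * (norm (h * h) * norm (l * l)) \<le> (d/4) * 2"
    using d nh by (intro mult_left_mono) auto
  ultimately have "norm (cstar w * w) \<le> (1 - d) + (d/4) * 2" by linarith
  then have w1: "(norm w)\<^sup>2 < 1" using d by (simp add: cstar_identity)
  \<comment> \<open>\<open>h\<close> is the real part of \<open>w\<close>, so
    \<open>norm h \<le> norm w < 1\<close>, contrary to \<open>norm h = 1\<close>.\<close>
  have "2 *\<^sub>R h = w + cstar w"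
    by (simp add: w_def cstar_add cstar_scaleC hs ms scaleR_2)
  then have "2 * norm h \<le> norm w + norm (cstar w)" by (metis norm_scaleR norm_triangle_ineq abs_numeral)
  then have "1 \<le> norm w" using h by simp
  then show False using w1 by (metis not_less one_le_power)
qed

text \<open>Only the real points of the spectrum are recorded. For self-adjoint elements there are
  no others, by \<open>unit_elem_nonreal\<close>.\<close>

definition rspec :: "'a::cstar_algebra_1 \<Rightarrow> real set" where
  "rspec a = {t. \<not> unit_elem (t *\<^sub>R 1 - a)}"

text \<open>If \<open>r - h\<close> and \<open>- r - h\<close> were both invertible for
  \<open>r = norm h\<close>, then so would be \<open>1 - k * k\<close> for the normalized element
  \<open>k = h / r\<close>, against \<open>norm_1_in_spectrum\<close>. This replaces the spectral
  radius formula.\<close>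

lemma norm_in_rspec:
  fixes h :: "'a::cstar_algebra_1"
  assumes h: "self_adjoint h"
  shows "norm h \<in> rspec h \<or> - norm h \<in> rspec h"
proof (cases "h = 0")
  case True
  then show ?thesis by (simp add: rspec_def unit_elem_def)
next
  case False
  define r where "r = norm h"
  have r: "r > 0" using False by (simp add: r_def)
  show ?thesis
  proof (rule ccontr)
    assume "\<not> ?thesis"
    then have "unit_elem (r *\<^sub>R 1 - h)" "unit_elem (- r *\<^sub>R 1 - h)" by (auto simp: rspec_def r_def)
    then have "unit_elem ((-1/r\<^sup>2) *\<^sub>R ((r *\<^sub>R 1 - h) * (- r *\<^sub>R 1 - h)))"
      using r by (intro unit_elem_scaleR unit_elem_mult) auto
    also have "(-1/r\<^sup>2) *\<^sub>R ((r *\<^sub>R 1 - h) * (- r *\<^sub>R 1 - h)) = 1 - ((1/r) *\<^sub>R h) * ((1/r) *\<^sub>R h)"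
      using r by (simp add: algebra_simps power2_eq_square scaleR_diff_right)
    finally show False
      using norm_1_in_spectrum[of "(1/r) *\<^sub>R h"] h r
      by (simp add: self_adjoint_def cstar_scaleR r_def)
  qed
qed

lemma rspec_bound: "t \<in> rspec a \<Longrightarrow> \<bar>t\<bar> \<le> norm a"
  using unit_elem_scaleC_minus[of a "complex_of_real t"]
  by (auto simp: rspec_def scaleC_of_real not_less[symmetric])

text \<open>The complement is open because an inverse survives small perturbations, again by the
  Neumann series.\<close>

lemma compact_rspec: "compact (rspec (a::'a::cstar_algebra_1))"
proof -
  have "open (- rspec a)"
    unfolding open_dist
  proof (intro ballI)
    fix t assume "t \<in> - rspec a"
    then obtain g where g: "(t *\<^sub>R 1 - a) * g = 1" "g * (t *\<^sub>R 1 - a) = 1"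
      by (auto simp: rspec_def unit_elem_def)
    define e where "e = 1 / (norm g + 1)"
    have ng: "norm g + 1 > 0" by (smt (verit) norm_ge_zero)
    have "s \<in> - rspec a" if s: "dist s t < e" for s
    proof -
      have "norm ((t - s) *\<^sub>R g) \<le> \<bar>t - s\<bar> * (norm g + 1)" by (simp add: mult_left_mono)
      also have "\<dots> < e * (norm g + 1)" using s ng by (intro mult_strict_right_mono) (auto simp: dist_real_def)
      also have "\<dots> = 1" using ng by (simp add: e_def)
      finally have "unit_elem (1 - (t - s) *\<^sub>R g)" by (rule unit_elem_one_minus)
      moreover have "unit_elem (t *\<^sub>R 1 - a)" using g by (auto simp: unit_elem_def)
      ultimately have "unit_elem ((t *\<^sub>R 1 - a) * (1 - (t - s) *\<^sub>R g))" by (rule unit_elem_mult[rotated])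
      also have "(t *\<^sub>R 1 - a) * (1 - (t - s) *\<^sub>R g) = s *\<^sub>R 1 - a"
        by (subst right_diff_distrib) (simp only: mult_scaleR_right g(1) mult_1_right, simp add: scaleR_diff_left)
      finally show ?thesis by (simp add: rspec_def)
    qed
    moreover have "e > 0" using ng by (simp add: e_def)
    ultimately show "\<exists>e>0. \<forall>s. dist s t < e \<longrightarrow> s \<in> - rspec a" by blast
  qed
  moreover have "bounded (rspec a)"
    using rspec_bound by (auto simp: bounded_iff)
  ultimately show ?thesis by (simp add: compact_eq_bounded_closed closed_def)
qed

lemma rspec_nonempty: "self_adjoint a \<Longrightarrow> rspec a \<noteq> {}"
  using norm_in_rspec by blast

section \<open>Continuous functional calculus\<close>

text \<open>Complex coefficients serve only to split polynomials into linear factors in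
  \<open>non_unit_cpoly_root\<close>; the calculus is built on \<open>rpoly\<close>.\<close>

definition cpoly :: "complex poly \<Rightarrow> 'a::cstar_algebra_1 \<Rightarrow> 'a" where
  "cpoly p a = fold_coeffs (\<lambda>c r. scaleC c 1 + a * r) p 0"

definition rpoly :: "real poly \<Rightarrow> 'a::cstar_algebra_1 \<Rightarrow> 'a" where
  "rpoly p a = fold_coeffs (\<lambda>c r. c *\<^sub>R 1 + a * r) p 0"

lemma cpoly_0 [simp]: "cpoly 0 a = 0"
  by (simp add: cpoly_def)

lemma cpoly_pCons [simp]: "cpoly (pCons c p) a = scaleC c 1 + a * cpoly p a"
  by (cases "p = 0 \<and> c = 0") (auto simp: cpoly_def)

lemma rpoly_0 [simp]: "rpoly 0 a = 0"
  by (simp add: rpoly_def)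

lemma rpoly_pCons [simp]: "rpoly (pCons c p) a = c *\<^sub>R 1 + a * rpoly p a"
  by (cases "p = 0 \<and> c = 0") (auto simp: rpoly_def)

lemma cpoly_add: "cpoly (p + q) a = cpoly p a + cpoly q a"
  by (induction p q rule: poly_induct2) (auto simp: scaleC_add_left algebra_simps)

lemma cpoly_smult: "cpoly (smult c p) a = scaleC c (cpoly p a)"
  by (induction p) (auto simp: scaleC_add_right scaleC_scaleC mult_scaleC_right)

lemma cpoly_mult: "cpoly (p * q) a = cpoly p a * cpoly q a"
  by (induction p)
    (auto simp: cpoly_add cpoly_smult distrib_right mult_scaleC_left mult.assoc)

lemma rpoly_add: "rpoly (p + q) a = rpoly p a + rpoly q a"
  by (induction p q rule: poly_induct2) (auto simp: algebra_simps)

lemma rpoly_smult: "rpoly (smult c p) a = c *\<^sub>R rpoly p a"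
  by (induction p) (auto simp: algebra_simps)

lemma rpoly_minus: "rpoly (- p) a = - rpoly p a"
  using rpoly_smult[of "-1" p a] by simp

lemma rpoly_diff: "rpoly (p - q) a = rpoly p a - rpoly q a"
  using rpoly_add[of p "- q" a] by (simp add: rpoly_minus)

lemma rpoly_mult: "rpoly (p * q) a = rpoly p a * rpoly q a"
  by (induction p) (auto simp: rpoly_add rpoly_smult distrib_right mult.assoc)

lemma rpoly_intertwine:
  assumes "x * a = b * x" shows "x * rpoly p a = rpoly p b * (x::'a::cstar_algebra_1)"
proof (induction p)
  case (pCons c p)
  have "x * (a * rpoly p a) = b * (x * rpoly p a)" by (metis assms mult.assoc)
  then show ?case using pCons by (simp add: distrib_left distrib_right mult.assoc)
qed simp

lemma self_adjoint_rpoly: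
  assumes "self_adjoint a" shows "self_adjoint (rpoly p a)"
proof (induction p)
  case 0 then show ?case by (simp add: self_adjoint_def)
next
  case (pCons c p)
  have "rpoly p a * a = a * rpoly p a" using rpoly_intertwine[of a a a p] by simp
  then show ?case using pCons assms by (simp add: self_adjoint_def cstar_add cstar_mult cstar_scaleR)
qed

lemma cpoly_of_real: "cpoly (map_poly complex_of_real p) a = rpoly p a"
  by (induction p) (auto simp: map_poly_pCons scaleC_of_real)

lemma poly_of_real: "poly (map_poly complex_of_real p) (of_real t) = of_real (poly p t)"
  by (induction p) (auto simp: map_poly_pCons)

text \<open>One half of the spectral mapping theorem. A root \<open>z\<close> of \<open>q\<close> is
  split off; if \<open>scaleC z 1 - a\<close> is invertible, non-invertibility passes to the
  cofactor, which has smaller degree.\<close>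

lemma non_unit_cpoly_root:
  fixes a :: "'a::cstar_algebra_1"
  assumes "q \<noteq> 0" "\<not> unit_elem (cpoly q a)"
  obtains z where "poly q z = 0" "\<not> unit_elem (scaleC z 1 - a)"
proof -
  have "q \<noteq> 0 \<Longrightarrow> \<not> unit_elem (cpoly q a) \<Longrightarrow> \<exists>z. poly q z = 0 \<and> \<not> unit_elem (scaleC z 1 - a)"
  proof (induction "degree q" arbitrary: q)
    case 0
    then obtain c where c: "q = [:c:]" "c \<noteq> 0" by (metis degree_eq_zeroE pCons_0_0)
    have "unit_elem (1::'a)" by (auto simp: unit_elem_def)
    then have "unit_elem (scaleC c (1::'a))" using c(2) by (rule unit_elem_scaleC[rotated])
    then show ?case using 0 c by simp
  next
    case (Suc n)
    obtain z where z: "poly q z = 0"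
      using fundamental_theorem_of_algebra[of q] Suc(2) by (auto simp: constant_degree)
    then obtain r where r: "q = [:- z, 1:] * r" by (metis dvdE poly_eq_0_iff_dvd)
    show ?case
    proof (cases "unit_elem (scaleC z 1 - a)")
      case True
      have "cpoly [:- z, 1:] a = scaleC (-1) (scaleC z 1 - a)"
        by (simp add: scaleC_diff_right)
      then have "unit_elem (cpoly [:- z, 1:] a)" 
        using unit_elem_scaleC[OF _ True, of "-1"] by (simp del: cpoly_pCons)
      then have "\<not> unit_elem (cpoly r a)"
        using Suc(4) r unit_elem_mult cpoly_mult by metis
      moreover have "r \<noteq> 0" using r Suc(3) by auto
      moreover have "n = degree r"
        using Suc(2) \<open>r \<noteq> 0\<close> r degree_mult_eq[of "[:- z, 1:]" r] by simp
      ultimately obtain w where "poly r w = 0" "\<not> unit_elem (scaleC w 1 - a)"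
        using Suc(1) by blast
      then show ?thesis using r by auto
    qed (use z in auto)
  qed
  then show ?thesis using assms that by blast
qed

text \<open>The norm of the self-adjoint element \<open>rpoly p a\<close> is, up to sign, a point
  \<open>m\<close> of its spectrum. So \<open>m - p\<close> evaluated at \<open>a\<close> is not
  invertible, and \<open>m\<close> is a value of \<open>p\<close> on the spectrum of
  \<open>a\<close>.\<close>

lemma norm_rpoly_le:
  fixes a :: "'a::cstar_algebra_1"
  assumes a: "self_adjoint a" and M: "\<And>t. t \<in> rspec a \<Longrightarrow> \<bar>poly p t\<bar> \<le> M"
  shows "norm (rpoly p a) \<le> M"
proof -
  obtain m where m: "m \<in> rspec (rpoly p a)" "\<bar>m\<bar> = norm (rpoly p a)"
    using norm_in_rspec[OF self_adjoint_rpoly[OF a]] by (metis abs_minus_cancel abs_norm_cancel)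
  obtain t0 where t0: "t0 \<in> rspec a" using rspec_nonempty[OF a] by blast
  define q where "q = [:m:] - p"
  \<comment> \<open>If \<open>p\<close> is the constant \<open>m\<close>, there is no root to be
    found, and any point of the nonempty spectrum serves.\<close>
  have "\<exists>t\<in>rspec a. poly q t = 0"
  proof (cases "q = 0")
    case False
    define Q where "Q = map_poly complex_of_real q"
    have "Q \<noteq> 0" using False by (simp add: Q_def map_poly_eq_0_iff)
    moreover have "\<not> unit_elem (cpoly Q a)"
      using m by (simp add: Q_def cpoly_of_real q_def rpoly_diff rspec_def)
    ultimately obtain z where z: "poly Q z = 0" "\<not> unit_elem (scaleC z 1 - a)"
      by (rule non_unit_cpoly_root)
    have "Im z = 0" using z(2) unit_elem_nonreal[OF a] by blast
    then have "z = of_real (Re z)" by (simp add: complex_eq_iff)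
    then obtain t where t: "z = of_real t" by blast
    then have "poly q t = 0" using z(1) by (simp add: Q_def poly_of_real)
    moreover have "t \<in> rspec a" using z(2) by (simp add: t rspec_def scaleC_of_real)
    ultimately show ?thesis by blast
  qed (use t0 in auto)
  then obtain t where "t \<in> rspec a" "poly p t = m" by (auto simp: q_def)
  then show ?thesis using M m by metis
qed

lemma uniform_limit_poly:
  fixes f :: "real \<Rightarrow> real"
  assumes "compact S" "continuous_on S f"
  obtains P where "uniform_limit S (\<lambda>n. poly (P n)) f sequentially"
proof -
  have "\<exists>p. \<forall>x\<in>S. \<bar>f x - poly p x\<bar> < 1 / real (Suc n)" for n
  proof -
    obtain g where g: "real_polynomial_function g" "\<And>x. x \<in> S \<Longrightarrow> \<bar>f x - g x\<bar> < 1 / real (Suc n)"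
      using Stone_Weierstrass_real_polynomial_function[OF assms, of "1 / real (Suc n)"] by auto
    obtain c m where "g = (\<lambda>x. \<Sum>i\<le>m. c i * x ^ i)"
      using g(1) by (auto simp: real_polynomial_function_iff_sum)
    then have "g = poly (\<Sum>i\<le>m. monom (c i) i)" by (simp add: poly_sum poly_monom fun_eq_iff)
    then show ?thesis using g(2) by blast
  qed
  then obtain P where P: "\<And>n x. x \<in> S \<Longrightarrow> \<bar>f x - poly (P n) x\<bar> < 1 / real (Suc n)" by metis
  have "uniform_limit S (\<lambda>n. poly (P n)) f sequentially"
    unfolding uniform_limit_iff
  proof (intro allI impI)
    fix e :: real assume "e > 0"
    then obtain N where N: "1 / real (Suc N) < e" using nat_approx_posE by blast
    show "\<forall>\<^sub>F n in sequentially. \<forall>x\<in>S. dist (poly (P n) x) (f x) < e"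
      using eventually_ge_at_top[of N]
    proof eventually_elim
      case (elim n)
      then have "1 / real (Suc n) \<le> 1 / real (Suc N)" by (simp add: frac_le)
      then show ?case using P[of _ n] N by (fastforce simp: dist_real_def abs_minus_commute)
    qed
  qed
  then show ?thesis using that by blast
qed

text \<open>\<open>fc f a\<close> is \<open>f\<close> applied to \<open>a\<close>, the value being meaningful if \<open>a\<close> is self-adjoint and
  \<open>f\<close> is continuous on its spectrum.\<close>
definition fc :: "(real \<Rightarrow> real) \<Rightarrow> 'a::cstar_algebra_1 \<Rightarrow> 'a" where
  "fc f a = (THE y. \<forall>p M. (\<forall>t\<in>rspec a. \<bar>poly p t - f t\<bar> \<le> M) \<longrightarrow> norm (rpoly p a - y) \<le> M)"

lemma fc_cong:
  "(\<And>t. t \<in> rspec a \<Longrightarrow> f t = g t) \<Longrightarrow> fc f a = fc g a"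
  unfolding fc_def by (metis (no_types, lifting))

text \<open>This shows that the description in \<open>fc\<close> has exactly one solution.
  Polynomials converging to \<open>f\<close> uniformly on the spectrum have Cauchy values at
  \<open>a\<close>, by \<open>norm_rpoly_le\<close>; their limit has the required property.\<close>

lemma norm_rpoly_diff_fc:
  fixes a :: "'a::cstar_algebra_1"
  assumes a: "self_adjoint a" and f: "continuous_on (rspec a) f"
    and M: "\<And>t. t \<in> rspec a \<Longrightarrow> \<bar>poly p t - f t\<bar> \<le> M"
  shows "norm (rpoly p a - fc f a) \<le> M"
proof -
  let ?Q = "\<lambda>y. \<forall>p M. (\<forall>t\<in>rspec a. \<bar>poly p t - f t\<bar> \<le> M) \<longrightarrow> norm (rpoly p a - y) \<le> M"
  obtain P where P: "uniform_limit (rspec a) (\<lambda>n. poly (P n)) f sequentially"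
    using uniform_limit_poly[OF compact_rspec f] by blast
  have close: "\<exists>N. \<forall>n\<ge>N. \<forall>t\<in>rspec a. \<bar>poly (P n) t - f t\<bar> \<le> e" if "e > 0" for e
    using P that unfolding uniform_limit_iff eventually_sequentially dist_real_def
    by (meson less_imp_le)
  have "Cauchy (\<lambda>n. rpoly (P n) a)"
  proof (rule CauchyI)
    fix e :: real assume "e > 0"
    then obtain N where N: "\<And>n t. n \<ge> N \<Longrightarrow> t \<in> rspec a \<Longrightarrow> \<bar>poly (P n) t - f t\<bar> \<le> e / 3"
      using close[of "e/3"] by auto
    have "norm (rpoly (P m) a - rpoly (P n) a) < e" if "m \<ge> N" "n \<ge> N" for m n
    proof -
      have "norm (rpoly (P m - P n) a) \<le> 2 * e / 3"
      proof (rule norm_rpoly_le[OF a])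
        fix t assume "t \<in> rspec a"
        then have "\<bar>poly (P m) t - f t\<bar> \<le> e / 3" "\<bar>poly (P n) t - f t\<bar> \<le> e / 3"
          using N that by auto
        then show "\<bar>poly (P m - P n) t\<bar> \<le> 2 * e / 3" unfolding poly_diff by linarith
      qed
      then show ?thesis using \<open>e > 0\<close> by (simp add: rpoly_diff)
    qed
    then show "\<exists>N. \<forall>m\<ge>N. \<forall>n\<ge>N. norm (rpoly (P m) a - rpoly (P n) a) < e" by blast
  qed
  then obtain y where y: "(\<lambda>n. rpoly (P n) a) \<longlonglongrightarrow> y" using Cauchy_convergent convergent_def by blast
  have ex: "?Q y"
  proof (intro allI impI)
    fix p M assume pM: "\<forall>t\<in>rspec a. \<bar>poly p t - f t\<bar> \<le> M"
    have "norm (rpoly p a - y) \<le> M + e" if "e > 0" for e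
    proof -
      obtain N where N: "\<And>n t. n \<ge> N \<Longrightarrow> t \<in> rspec a \<Longrightarrow> \<bar>poly (P n) t - f t\<bar> \<le> e"
        using close[OF \<open>e > 0\<close>] by auto
      have "norm (rpoly p a - rpoly (P n) a) \<le> M + e" if "n \<ge> N" for n
      proof -
        have "norm (rpoly (p - P n) a) \<le> M + e"
        proof (rule norm_rpoly_le[OF a])
          fix t assume t: "t \<in> rspec a"
          then have "\<bar>poly p t - f t\<bar> \<le> M" using pM by blast
          then show "\<bar>poly (p - P n) t\<bar> \<le> M + e" using N[OF that t] by (simp add: poly_diff)
        qed
        then show ?thesis by (simp add: rpoly_diff)
      qed
      moreover have "(\<lambda>n. norm (rpoly p a - rpoly (P n) a)) \<longlonglongrightarrow> norm (rpoly p a - y)"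
        by (intro tendsto_intros y)
      ultimately show ?thesis by (meson LIMSEQ_le_const2)
    qed
    then show "norm (rpoly p a - y) \<le> M" by (rule field_le_epsilon)
  qed
  \<comment> \<open>Uniqueness: both candidates are within \<open>e / 2\<close> of the same
    polynomial value.\<close>
  have "z = w" if "?Q z" "?Q w" for z w
  proof -
    have "norm (z - w) \<le> 0 + e" if e: "e > 0" for e
    proof -
      obtain N where "\<And>n t. n \<ge> N \<Longrightarrow> t \<in> rspec a \<Longrightarrow> \<bar>poly (P n) t - f t\<bar> \<le> e / 2"
        using close[of "e/2"] e by auto
      then have "norm (rpoly (P N) a - z) \<le> e / 2" "norm (rpoly (P N) a - w) \<le> e / 2"
        using \<open>?Q z\<close> \<open>?Q w\<close> by blast+
      then show ?thesis
        using norm_triangle_ineq4[of "rpoly (P N) a - w" "rpoly (P N) a - z"] by simp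
    qed
    then have "norm (z - w) \<le> 0" by (rule field_le_epsilon)
    then show ?thesis by simp
  qed
  then have "?Q (fc f a)" unfolding fc_def using ex by (intro theI[of ?Q y]) blast+
  then show ?thesis using M by blast
qed

lemma tendsto_rpoly_fc:
  fixes a :: "'a::cstar_algebra_1"
  assumes a: "self_adjoint a" and f: "continuous_on (rspec a) f"
    and P: "uniform_limit (rspec a) (\<lambda>n. poly (P n)) f sequentially"
  shows "(\<lambda>n. rpoly (P n) a) \<longlonglongrightarrow> fc f a"
proof (rule LIMSEQ_I)
  fix e :: real assume "e > 0"
  then obtain N where "\<And>n t. n \<ge> N \<Longrightarrow> t \<in> rspec a \<Longrightarrow> dist (poly (P n) t) (f t) < e / 2"
    using P unfolding uniform_limit_iff eventually_sequentially by (meson half_gt_zero)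
  then have "norm (rpoly (P n) a - fc f a) \<le> e / 2" if "n \<ge> N" for n
    using that by (intro norm_rpoly_diff_fc a f) (auto simp: dist_real_def less_imp_le)
  then show "\<exists>N. \<forall>n\<ge>N. norm (rpoly (P n) a - fc f a) < e"
    using \<open>e > 0\<close> by (intro exI[of _ N]) force
qed

lemma fc_poly:
  assumes "self_adjoint a" shows "fc (poly p) a = rpoly p a"
  using norm_rpoly_diff_fc[OF assms, of "poly p" p 0] by (simp add: continuous_on_poly)

lemma fc_const [simp]: "self_adjoint a \<Longrightarrow> fc (\<lambda>t. c) a = c *\<^sub>R 1"
  using fc_poly[of a "[:c:]"] fc_cong[of a "poly [:c:]" "\<lambda>t. c"] by simp

lemma fc_id [simp]: "self_adjoint a \<Longrightarrow> fc (\<lambda>t. t) a = a"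
  using fc_poly[of a "[:0, 1:]"] fc_cong[of a "poly [:0, 1:]" "\<lambda>t. t"] by simp

lemma fc_add:
  assumes a: "self_adjoint a" and f: "continuous_on (rspec a) f" and g: "continuous_on (rspec a) g"
  shows "fc (\<lambda>t. f t + g t) a = fc f a + fc g a"
proof -
  obtain P Q where PQ: "uniform_limit (rspec a) (\<lambda>n. poly (P n)) f sequentially"
    "uniform_limit (rspec a) (\<lambda>n. poly (Q n)) g sequentially"
    using uniform_limit_poly[OF compact_rspec] f g by metis
  have "(\<lambda>n. rpoly (P n + Q n) a) \<longlonglongrightarrow> fc (\<lambda>t. f t + g t) a"
  proof (intro tendsto_rpoly_fc a continuous_intros f g)
    show "uniform_limit (rspec a) (\<lambda>n. poly (P n + Q n)) (\<lambda>t. f t + g t) sequentially"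
      using uniform_limit_add[OF PQ] by (simp flip: poly_add)
  qed
  moreover have "(\<lambda>n. rpoly (P n + Q n) a) \<longlonglongrightarrow> fc f a + fc g a"
    unfolding rpoly_add by (intro tendsto_add tendsto_rpoly_fc a f g PQ)
  ultimately show ?thesis by (rule LIMSEQ_unique)
qed

lemma fc_mult:
  assumes a: "self_adjoint a" and f: "continuous_on (rspec a) f" and g: "continuous_on (rspec a) g"
  shows "fc (\<lambda>t. f t * g t) a = fc f a * fc g a"
proof -
  obtain P Q where PQ: "uniform_limit (rspec a) (\<lambda>n. poly (P n)) f sequentially"
    "uniform_limit (rspec a) (\<lambda>n. poly (Q n)) g sequentially"
    using uniform_limit_poly[OF compact_rspec] f g by metis
  have bd: "bounded (f ` rspec a)" "bounded (g ` rspec a)"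
    using f g compact_rspec by (auto intro!: compact_imp_bounded compact_continuous_image)
  have "(\<lambda>n. rpoly (P n * Q n) a) \<longlonglongrightarrow> fc (\<lambda>t. f t * g t) a"
  proof (intro tendsto_rpoly_fc a continuous_intros f g)
    show "uniform_limit (rspec a) (\<lambda>n. poly (P n * Q n)) (\<lambda>t. f t * g t) sequentially"
      using uniform_lim_mult[OF PQ bd] by (simp flip: poly_mult)
  qed
  moreover have "(\<lambda>n. rpoly (P n * Q n) a) \<longlonglongrightarrow> fc f a * fc g a"
    unfolding rpoly_mult by (intro tendsto_mult tendsto_rpoly_fc a f g PQ)
  ultimately show ?thesis by (rule LIMSEQ_unique)
qed

lemma fc_scale:
  "self_adjoint a \<Longrightarrow> continuous_on (rspec a) f \<Longrightarrow> fc (\<lambda>t. c * f t) a = c *\<^sub>R fc f a"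
  using fc_mult[of a "\<lambda>t. c" f] by simp

lemma fc_minus:
  "self_adjoint a \<Longrightarrow> continuous_on (rspec a) f \<Longrightarrow> fc (\<lambda>t. - f t) a = - fc f a"
  using fc_scale[of a f "-1"] by simp

lemma fc_diff:
  "self_adjoint a \<Longrightarrow> continuous_on (rspec a) f \<Longrightarrow> continuous_on (rspec a) g \<Longrightarrow>
    fc (\<lambda>t. f t - g t) a = fc f a - fc g a"
  using fc_add[of a f "\<lambda>t. - g t"] by (simp add: fc_minus continuous_on_minus)

lemma norm_fc_le:
  assumes a: "self_adjoint a" and f: "continuous_on (rspec a) f"
    and M: "\<And>t. t \<in> rspec a \<Longrightarrow> \<bar>f t\<bar> \<le> M"
  shows "norm (fc f a) \<le> M"
  using norm_rpoly_diff_fc[OF a f, of 0 M] M by simp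

lemma self_adjoint_fc:
  assumes a: "self_adjoint a" and f: "continuous_on (rspec a) f"
  shows "self_adjoint (fc f a)"
proof -
  obtain P where P: "uniform_limit (rspec a) (\<lambda>n. poly (P n)) f sequentially"
    using uniform_limit_poly[OF compact_rspec] f by metis
  note t = tendsto_rpoly_fc[OF a f P]
  have "(\<lambda>n. cstar (rpoly (P n) a)) \<longlonglongrightarrow> cstar (fc f a)" by (rule tendsto_cstar[OF t])
  then show ?thesis
    using t self_adjoint_rpoly[OF a] by (auto simp: self_adjoint_def intro: LIMSEQ_unique)
qed

text \<open>The same polynomials approximate \<open>f\<close> on both spectra, and for polynomials
  the claim is \<open>rpoly_intertwine\<close>. The main use is \<open>y f(b) = f(c) y\<close> for
  \<open>b = cstar y * y\<close> and \<open>c = y * cstar y\<close>.\<close>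

lemma fc_intertwine:
  assumes a: "self_adjoint a" and b: "self_adjoint b" and f: "continuous_on (rspec a \<union> rspec b) f"
    and x: "x * a = b * x"
  shows "x * fc f a = fc f b * x"
proof -
  obtain P where P: "uniform_limit (rspec a \<union> rspec b) (\<lambda>n. poly (P n)) f sequentially"
    using uniform_limit_poly[OF compact_Un[OF compact_rspec compact_rspec]] f by metis
  have "(\<lambda>n. rpoly (P n) a) \<longlonglongrightarrow> fc f a" "(\<lambda>n. rpoly (P n) b) \<longlonglongrightarrow> fc f b"
    using P f by (auto intro!: tendsto_rpoly_fc a b elim: uniform_limit_on_subset continuous_on_subset)
  then have "(\<lambda>n. x * rpoly (P n) a) \<longlonglongrightarrow> x * fc f a" "(\<lambda>n. rpoly (P n) b * x) \<longlonglongrightarrow> fc f b * x"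
    by (auto intro: tendsto_mult_left tendsto_mult_right)
  then show ?thesis unfolding rpoly_intertwine[OF x] by (rule LIMSEQ_unique)
qed

text \<open>Off the image of \<open>f\<close> the function \<open>1 / (s - f t)\<close> is
  continuous on the spectrum and supplies the inverse.\<close>

lemma rspec_fc:
  assumes a: "self_adjoint a" and f: "continuous_on (rspec a) f"
  shows "rspec (fc f a) \<subseteq> f ` rspec a"
proof
  fix s assume s: "s \<in> rspec (fc f a)"
  show "s \<in> f ` rspec a"
  proof (rule ccontr)
    assume "s \<notin> f ` rspec a"
    then have ne: "\<And>t. t \<in> rspec a \<Longrightarrow> s - f t \<noteq> 0" by auto
    let ?g = "\<lambda>t. 1 / (s - f t)"
    have g: "continuous_on (rspec a) ?g" using ne by (intro continuous_intros f) auto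
    have h: "continuous_on (rspec a) (\<lambda>t. s - f t)" by (intro continuous_intros f)
    have "fc (\<lambda>t. (s - f t) * ?g t) a = fc (\<lambda>t. 1) a" "fc (\<lambda>t. ?g t * (s - f t)) a = fc (\<lambda>t. 1) a"
      using ne by (auto intro!: fc_cong)
    then have "fc (\<lambda>t. s - f t) a * fc ?g a = 1" "fc ?g a * fc (\<lambda>t. s - f t) a = 1"
      using fc_mult[OF a h g] fc_mult[OF a g h] a by auto
    moreover have "fc (\<lambda>t. s - f t) a = s *\<^sub>R 1 - fc f a"
      using fc_diff[OF a, of "\<lambda>t. s" f] f a by simp
    ultimately show False using s by (auto simp: rspec_def unit_elem_def)
  qed
qed

text \<open>For polynomial \<open>g\<close> this is an induction; uniform approximation of
  \<open>g\<close> on the image of \<open>f\<close> controls both sides at once.\<close>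

lemma fc_compose:
  assumes a: "self_adjoint a" and f: "continuous_on (rspec a) f" and g: "continuous_on (f ` rspec a) g"
  shows "fc g (fc f a) = fc (\<lambda>t. g (f t)) a"
proof -
  have rp: "rpoly p (fc f a) = fc (\<lambda>t. poly p (f t)) a" for p
  proof (induction p)
    case (pCons c p)
    have "continuous_on (rspec a) (\<lambda>t. poly p (f t))" by (intro continuous_intros f)
    then show ?case using pCons f a by (simp add: fc_add fc_mult continuous_on_mult)
  qed (use a in simp)
  obtain P where P: "uniform_limit (f ` rspec a) (\<lambda>n. poly (P n)) g sequentially"
    using uniform_limit_poly[OF compact_continuous_image[OF f compact_rspec] g] by blast
  have gf: "continuous_on (rspec a) (\<lambda>t. g (f t))"
    using continuous_on_compose2[OF g f] by blast
  have "(\<lambda>n. rpoly (P n) (fc f a)) \<longlonglongrightarrow> fc g (fc f a)"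
    using rspec_fc[OF a f] P g
    by (intro tendsto_rpoly_fc self_adjoint_fc a f) (auto intro: uniform_limit_on_subset continuous_on_subset)
  moreover have "(\<lambda>n. rpoly (P n) (fc f a)) \<longlonglongrightarrow> fc (\<lambda>t. g (f t)) a"
  proof (rule LIMSEQ_I)
    fix e :: real assume "e > 0"
    then obtain N where N: "\<And>n t. n \<ge> N \<Longrightarrow> t \<in> rspec a \<Longrightarrow> dist (poly (P n) (f t)) (g (f t)) < e / 2"
      using P unfolding uniform_limit_iff eventually_sequentially by (meson half_gt_zero imageI)
    have "norm (rpoly (P n) (fc f a) - fc (\<lambda>t. g (f t)) a) \<le> e / 2" if "n \<ge> N" for n
    proof -
      have pf: "continuous_on (rspec a) (\<lambda>t. poly (P n) (f t))" by (intro continuous_intros f)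
      have "norm (fc (\<lambda>t. poly (P n) (f t) - g (f t)) a) \<le> e / 2"
        using N[OF that] by (intro norm_fc_le a continuous_intros pf gf) (auto simp: dist_real_def less_imp_le)
      then show ?thesis by (simp add: rp fc_diff[OF a pf gf])
    qed
    then show "\<exists>N. \<forall>n\<ge>N. norm (rpoly (P n) (fc f a) - fc (\<lambda>t. g (f t)) a) < e"
      using \<open>e > 0\<close> by (intro exI[of _ N]) force
  qed
  ultimately show ?thesis by (rule LIMSEQ_unique)
qed

lemma tendsto_fc:
  assumes a: "self_adjoint a" and F: "\<And>n. continuous_on (rspec a) (F n)"
    and lim: "uniform_limit (rspec a) F f sequentially"
  shows "(\<lambda>n. fc (F n) a) \<longlonglongrightarrow> fc f a"
proof (rule LIMSEQ_I)
  have f: "continuous_on (rspec a) f"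
    using uniform_limit_theorem[OF _ lim] F by simp
  fix e :: real assume "e > 0"
  then obtain N where N: "\<And>n t. n \<ge> N \<Longrightarrow> t \<in> rspec a \<Longrightarrow> dist (F n t) (f t) < e / 2"
    using lim unfolding uniform_limit_iff eventually_sequentially by (meson half_gt_zero)
  have "norm (fc (F n) a - fc f a) \<le> e / 2" if "n \<ge> N" for n
  proof -
    have "norm (fc (\<lambda>t. F n t - f t) a) \<le> e / 2"
      using N[OF that] by (intro norm_fc_le a continuous_intros F f) (auto simp: dist_real_def less_imp_le)
    then show ?thesis by (simp add: fc_diff[OF a F f])
  qed
  then show "\<exists>N. \<forall>n\<ge>N. norm (fc (F n) a - fc f a) < e"
    using \<open>e > 0\<close> by (intro exI[of _ N]) force
qed

section \<open>Positive elements\<close>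

definition positive_elem :: "'a::cstar_algebra_1 \<Rightarrow> bool" where
  "positive_elem a \<longleftrightarrow> self_adjoint a \<and> (\<forall>t\<in>rspec a. 0 \<le> t)"

lemma positive_self_adjoint: "positive_elem a \<Longrightarrow> self_adjoint a"
  by (simp add: positive_elem_def)

lemma unit_elem_minus: "unit_elem (- x) \<longleftrightarrow> unit_elem (x::'a::cstar_algebra_1)"
  using unit_elem_scaleR[of "-1" x] unit_elem_scaleR[of "-1" "- x"] by auto

lemma rspec_reflect: "r - t \<in> rspec (r *\<^sub>R 1 - a) \<longleftrightarrow> t \<in> rspec a"
proof -
  have "(r - t) *\<^sub>R 1 - (r *\<^sub>R 1 - a) = - (t *\<^sub>R 1 - a)" by (simp add: scaleR_diff_left)
  then show ?thesis unfolding rspec_def by (simp only: mem_Collect_eq unit_elem_minus)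
qed

lemma self_adjoint_simps:
  "self_adjoint 0" "self_adjoint (1::'a::cstar_algebra_1)"
  "self_adjoint x \<Longrightarrow> self_adjoint y \<Longrightarrow> self_adjoint (x + y)"
  "self_adjoint x \<Longrightarrow> self_adjoint y \<Longrightarrow> self_adjoint (x - y)"
  "self_adjoint x \<Longrightarrow> self_adjoint (- x)"
  "self_adjoint x \<Longrightarrow> self_adjoint (r *\<^sub>R x)"
  by (auto simp: self_adjoint_def cstar_add cstar_diff cstar_scaleR)

text \<open>With \<open>positiveI_norm\<close> this is the description of positivity by norms. It
  makes stability under sums and limits accessible, which the spectral definition does not.\<close>

lemma positive_norm:
  assumes a: "positive_elem a" and r: "norm a \<le> r"
  shows "norm (r *\<^sub>R 1 - a) \<le> r"
proof -
  have sa: "self_adjoint a" using a by (rule positive_self_adjoint)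
  have "norm (fc (\<lambda>t. r - t) a) \<le> r"
  proof (rule norm_fc_le[OF sa])
    fix t assume t: "t \<in> rspec a"
    then show "\<bar>r - t\<bar> \<le> r" using a r rspec_bound[OF t] by (simp add: positive_elem_def)
  qed (intro continuous_intros)
  then show ?thesis using fc_diff[OF sa, of "\<lambda>t. r" "\<lambda>t. t"] sa by simp
qed

lemma positiveI_norm:
  assumes "self_adjoint a" "norm (r *\<^sub>R 1 - a) \<le> r"
  shows "positive_elem a"
  unfolding positive_elem_def
proof (intro conjI ballI)
  fix t assume "t \<in> rspec a"
  then have "\<bar>r - t\<bar> \<le> norm (r *\<^sub>R 1 - a)" using rspec_bound rspec_reflect by blast
  then show "0 \<le> t" using assms by linarith
qed (rule assms)

lemma positive_add:
  assumes "positive_elem a" "positive_elem b" shows "positive_elem (a + b)"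
proof (rule positiveI_norm)
  show "self_adjoint (a + b)" using assms by (simp add: positive_elem_def self_adjoint_simps)
  have "(norm a + norm b) *\<^sub>R 1 - (a + b) = (norm a *\<^sub>R 1 - a) + (norm b *\<^sub>R 1 - b)"
    by (simp add: scaleR_add_left)
  then show "norm ((norm a + norm b) *\<^sub>R 1 - (a + b)) \<le> norm a + norm b"
    by (simp only:) (intro norm_triangle_mono positive_norm assms order_refl)
qed

lemma positive_fc:
  assumes "self_adjoint a" "continuous_on (rspec a) f" "\<And>t. t \<in> rspec a \<Longrightarrow> 0 \<le> f t"
  shows "positive_elem (fc f a)"
  using rspec_fc[OF assms(1,2)] assms(3) self_adjoint_fc[OF assms(1,2)] by (auto simp: positive_elem_def)

lemma positive_0 [simp]: "positive_elem 0"
  by (rule positiveI_norm[of _ 0]) (auto simp: self_adjoint_simps)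

lemma positive_scaleR:
  assumes "positive_elem a" "0 \<le> c" shows "positive_elem (c *\<^sub>R a)"
proof -
  have "positive_elem (fc (\<lambda>t. c * t) a)"
    using assms by (intro positive_fc continuous_intros) (auto simp: positive_elem_def)
  then show ?thesis using assms fc_scale[of a "\<lambda>t. t" c] by (simp add: positive_elem_def)
qed

lemma positive_tendsto:
  assumes lim: "A \<longlonglongrightarrow> a" and A: "\<And>n. positive_elem (A n)"
  shows "positive_elem a"
proof -
  obtain K where K: "\<And>n. norm (A n) \<le> K"
    using convergent_imp_Bseq[of A] lim by (auto simp: convergent_def Bseq_def)
  have sa: "self_adjoint a"
    using tendsto_cstar[OF lim] lim A
    by (auto simp: positive_elem_def self_adjoint_def intro: LIMSEQ_unique)
  have "(\<lambda>n. norm (K *\<^sub>R 1 - A n)) \<longlonglongrightarrow> norm (K *\<^sub>R 1 - a)" by (intro tendsto_intros lim)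
  then have "norm (K *\<^sub>R 1 - a) \<le> K"
    by (rule LIMSEQ_le_const2) (use positive_norm[OF A K] in blast)
  then show ?thesis using sa by (rule positiveI_norm[rotated])
qed

lemma positive_square:
  assumes "self_adjoint h" shows "positive_elem (h * h)"
proof -
  have "positive_elem (fc (\<lambda>t. t * t) h)" by (intro positive_fc continuous_intros assms) auto
  then show ?thesis using fc_mult[OF assms, of "\<lambda>t. t" "\<lambda>t. t"] assms by simp
qed

lemma positive_uminus_eq_0:
  assumes "positive_elem a" "positive_elem (- a)" shows "a = 0"
proof -
  have "t = 0" if "t \<in> rspec a" for t
    using that rspec_reflect[of 0 t a] assms by (force simp: positive_elem_def)
  then show ?thesis using norm_in_rspec[of a] assms(1) by (force simp: positive_elem_def)
qed

text \<open>If \<open>g\<close> inverts \<open>t - x * y\<close>, then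
  \<open>(1 + y * g * x) / t\<close> inverts \<open>t - y * x\<close>. Hence both products have the
  same nonzero spectrum.\<close>

lemma unit_elem_swap:
  fixes x y :: "'a::cstar_algebra_1"
  assumes t: "t \<noteq> 0" and u: "unit_elem (t *\<^sub>R 1 - x * y)"
  shows "unit_elem (t *\<^sub>R 1 - y * x)"
proof -
  obtain g where g: "(t *\<^sub>R 1 - x * y) * g = 1" "g * (t *\<^sub>R 1 - x * y) = 1"
    using u by (auto simp: unit_elem_def)
  have g': "x * (y * g) = t *\<^sub>R g - 1" "g * (x * y) = t *\<^sub>R g - 1"
    using g by (auto simp: algebra_simps)
  have g'': "g * (x * (y * x)) = t *\<^sub>R (g * x) - x"
    using arg_cong[OF g'(2), of "\<lambda>z. z * x"] by (simp add: algebra_simps)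
  have g''': "x * (y * (g * x)) = t *\<^sub>R (g * x) - x"
    using arg_cong[OF g'(1), of "\<lambda>z. z * x"] by (simp add: algebra_simps)
  show ?thesis unfolding unit_elem_def
    by (intro exI[of _ "(1/t) *\<^sub>R (1 + y * g * x)"])
      (simp add: t algebra_simps g'' g''')
qed

text \<open>Up to real factors, \<open>c\<close> and \<open>d\<close> are the real and imaginary
  parts of \<open>x\<close>. Thus the symmetrized product is a sum of two squares of self-adjoint
  elements.\<close>

lemma cstar_mult_square_split:
  fixes x :: "'a::cstar_algebra_1"
  defines "c \<equiv> x + cstar x" and "d \<equiv> scaleC \<i> (x - cstar x)"
  shows "c * c + d * d = 2 *\<^sub>R (cstar x * x + x * cstar x)"
  by (simp add: c_def d_def mult_scaleC_left mult_scaleC_right scaleC_scaleC algebra_simps scaleR_2 scaleC_diff_right)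

text \<open>With the negative part \<open>n\<close> of \<open>h = cstar x * x\<close> and
  \<open>y = x * n\<close>, the product \<open>cstar y * y\<close> is the negative of the cube of
  \<open>n\<close>. Comparing it with \<open>y * cstar y\<close>, which has the same nonzero
  spectrum, shows that it is also positive. So the cube of \<open>n\<close> vanishes, then
  \<open>n\<close> itself.\<close>

lemma positive_cstar_mult: "positive_elem (cstar x * (x::'a::cstar_algebra_1))"
proof -
  define h where "h = cstar x * x"
  have h: "self_adjoint h" by (simp add: h_def self_adjoint_def cstar_mult cstar_cstar)
  have ct: "continuous_on S (\<lambda>t. max (- t) 0)" "continuous_on S (\<lambda>t. max t 0)" for S :: "real set"
    by (auto intro!: continuous_intros)
  define n where "n = fc (\<lambda>t. max (- t) 0) h"
  have n: "self_adjoint n" unfolding n_def by (intro self_adjoint_fc h ct)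
  have nhn: "n * h * n = - (n * n * n)"
  proof -
    have "fc (\<lambda>t. max (- t) 0 * t * max (- t) 0) h = fc (\<lambda>t. - (max (- t) 0 * max (- t) 0 * max (- t) 0)) h"
      by (rule fc_cong) (auto simp: max_def)
    then show ?thesis using h
      by (simp add: fc_mult fc_minus continuous_on_mult ct continuous_on_minus n_def)
  qed
  have n3: "positive_elem (n * n * n)"
  proof -
    have "positive_elem (fc (\<lambda>t. max (- t) 0 * max (- t) 0 * max (- t) 0) h)"
      by (intro positive_fc h continuous_intros) auto
    then show ?thesis using h by (simp add: fc_mult continuous_on_mult ct n_def)
  qed
  define y where "y = x * n"
  have "cstar y * y = n * h * n"
    using n by (simp add: y_def cstar_mult self_adjoint_def h_def mult.assoc)
  then have y1: "cstar y * y = - (n * n * n)" by (simp only: nhn)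
  \<comment> \<open>This is half the sum of two squares minus \<open>cstar y * y\<close>, and minus
    \<open>cstar y * y\<close> is the positive cube of \<open>n\<close>.\<close>
  have "positive_elem (y * cstar y)"
  proof -
    define c where "c = y + cstar y"
    define d where "d = scaleC \<i> (y - cstar y)"
    have "self_adjoint c"
      by (simp add: c_def self_adjoint_def cstar_add cstar_cstar add.commute)
    moreover have "self_adjoint d"
      by (simp add: d_def self_adjoint_def cstar_diff cstar_cstar cstar_scaleC scaleC_diff_right)
    ultimately have "positive_elem (c * c + d * d)" by (intro positive_add positive_square)
    then have "positive_elem ((1/2) *\<^sub>R (c * c + d * d))" by (rule positive_scaleR) simp
    then have "positive_elem (cstar y * y + y * cstar y)"
      using cstar_mult_square_split[of y] by (simp add: c_def d_def)
    then have "positive_elem (cstar y * y + y * cstar y + n * n * n)" using n3 by (rule positive_add)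
    then show ?thesis by (simp add: y1)
  qed
  have "positive_elem (cstar y * y)"
    unfolding positive_elem_def
  proof (intro conjI ballI)
    show "self_adjoint (cstar y * y)" by (simp add: self_adjoint_def cstar_mult cstar_cstar)
    fix t assume t: "t \<in> rspec (cstar y * y)"
    show "0 \<le> t"
    proof (cases "t = 0")
      case False
      then have "t \<in> rspec (y * cstar y)" using t unit_elem_swap by (auto simp: rspec_def)
      then show ?thesis using \<open>positive_elem (y * cstar y)\<close> by (simp add: positive_elem_def)
    qed simp
  qed
  then have "n * n * n = 0" using positive_uminus_eq_0[of "n * n * n"] n3 y1 by simp
  then have "(n * n) * (n * n) = 0" by (simp add: mult.assoc[symmetric])
  then have "norm (n * n) = 0"
    using norm_square_self_adjoint[of "n * n"] n by (simp add: self_adjoint_def cstar_mult)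
  then have "n = 0" using norm_square_self_adjoint[OF n] by simp
  have "fc (\<lambda>t. t) h = fc (\<lambda>t. max t 0 - max (- t) 0) h"
    by (rule fc_cong) (auto simp: max_def)
  also have "\<dots> = fc (\<lambda>t. max t 0) h - n" unfolding n_def by (intro fc_diff h ct)
  finally have "h = fc (\<lambda>t. max t 0) h" using \<open>n = 0\<close> fc_id[OF h] by simp
  moreover have "positive_elem (fc (\<lambda>t. max t 0) h)" by (intro positive_fc h ct) auto
  ultimately have "positive_elem h" by simp
  then show ?thesis by (simp add: h_def)
qed

lemma positive_sqrt:
  assumes "positive_elem a"
  obtains m where "self_adjoint m" "m * m = a"
proof (rule that)
  have a: "self_adjoint a" using assms by (simp add: positive_elem_def)
  show "self_adjoint (fc sqrt a)" by (intro self_adjoint_fc a continuous_intros)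
  have "fc sqrt a * fc sqrt a = fc (\<lambda>t. sqrt t * sqrt t) a"
    by (rule fc_mult[symmetric, OF a]) (intro continuous_intros)+
  also have "\<dots> = fc (\<lambda>t. t) a" using assms by (intro fc_cong) (auto simp: positive_elem_def)
  finally show "fc sqrt a * fc sqrt a = a" using a by simp
qed

lemma positive_conj:
  assumes "positive_elem a" shows "positive_elem (cstar x * a * x)"
proof -
  obtain m where m: "self_adjoint m" "m * m = a" using positive_sqrt[OF assms] .
  have "cstar x * a * x = cstar (m * x) * (m * x)"
    using m by (simp add: cstar_mult self_adjoint_def mult.assoc[symmetric]) (simp add: mult.assoc)
  then show ?thesis by (metis positive_cstar_mult)
qed

lemma positive_norm_minus:
  assumes "self_adjoint h" "norm h \<le> r" shows "positive_elem (r *\<^sub>R 1 - h)"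
proof -
  have "positive_elem (fc (\<lambda>t. r - t) h)"
    using assms rspec_bound[of _ h] by (intro positive_fc continuous_intros) force+
  then show ?thesis using assms fc_diff[of h "\<lambda>t. r" "\<lambda>t. t"] by simp
qed

lemma norm_le_positive:
  assumes a: "positive_elem a" and ab: "positive_elem (r *\<^sub>R 1 - a)"
  shows "norm a \<le> r"
proof -
  have "t \<le> r" "0 \<le> t" if "t \<in> rspec a" for t
    using that rspec_reflect[of r t a] assms by (force simp: positive_elem_def)+
  then show ?thesis using norm_in_rspec[of a] a rspec_nonempty[of a] by (force simp: positive_elem_def)
qed

lemma norm_mono_positive:
  assumes a: "positive_elem a" and ab: "positive_elem (b - a)"
  shows "norm a \<le> norm b"
proof (rule norm_le_positive[OF a])
  have "self_adjoint ((b - a) + a)" using a ab by (intro self_adjoint_simps positive_self_adjoint)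
  then have "positive_elem (norm b *\<^sub>R 1 - b)" by (intro positive_norm_minus) auto
  then show "positive_elem (norm b *\<^sub>R 1 - a)" using positive_add[OF _ ab] by fastforce
qed

section \<open>The Loewner--Heinz inequality\<close>

definition strictly_positive :: "'a::cstar_algebra_1 \<Rightarrow> bool" where
  "strictly_positive a \<longleftrightarrow> self_adjoint a \<and> (\<forall>t\<in>rspec a. 0 < t)"

text \<open>Since \<open>0 powr s = 0\<close> for every \<open>s\<close>, including
  \<open>s = 0\<close>, exponents that are zero or negative are used only for strictly positive
  elements.\<close>

definition pw :: "real \<Rightarrow> 'a::cstar_algebra_1 \<Rightarrow> 'a" where
  "pw s a = fc (\<lambda>t. t powr s) a"

lemma continuous_on_powr_strict:
  "strictly_positive a \<Longrightarrow> continuous_on (rspec a) (\<lambda>t. t powr s)"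
  by (intro continuous_intros) (auto simp: strictly_positive_def)

lemma self_adjoint_pw_strict: "strictly_positive a \<Longrightarrow> self_adjoint (pw s a)"
  unfolding pw_def by (intro self_adjoint_fc continuous_on_powr_strict) (auto simp: strictly_positive_def)

lemma pw_add_strict: "strictly_positive a \<Longrightarrow> pw s a * pw r a = pw (s + r) a"
  unfolding pw_def powr_add
  by (intro fc_mult[symmetric] continuous_on_powr_strict) (auto simp: strictly_positive_def)

lemma pw_0_strict: "strictly_positive a \<Longrightarrow> pw 0 a = 1"
  unfolding pw_def using fc_const[of a 1] fc_cong[of a "\<lambda>t. t powr 0" "\<lambda>t. 1"]
  by (force simp: strictly_positive_def)

lemma pw_1_strict: "strictly_positive a \<Longrightarrow> pw 1 a = a"
  unfolding pw_def using fc_id[of a] fc_cong[of a "\<lambda>t. t powr 1" "\<lambda>t. t"]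
  by (force simp: strictly_positive_def)

text \<open>A spectral radius argument: similarity bounds all powers of \<open>h\<close> by
  \<open>norm g * norm g'\<close>, whereas the powers with exponent \<open>2 ^ k\<close> of a
  self-adjoint \<open>h\<close> have norm \<open>norm h ^ (2 ^ k)\<close>, which is unbounded if
  \<open>norm h > 1\<close>.\<close>

lemma norm_le_1_similar:
  fixes h :: "'a::cstar_algebra_1"
  assumes h: "self_adjoint h" and eq: "h = g * w * g'" and inv: "g' * g = 1" and w: "norm w \<le> 1"
  shows "norm h \<le> 1"
proof (rule ccontr)
  assume "\<not> norm h \<le> 1"
  then have gt: "1 < norm h" by simp
  have gw: "g' * (g * z) = z" for z by (metis inv mult.assoc mult_1_left)
  have pow: "h ^ Suc n = g * w ^ Suc n * g'" for n
    by (induction n) (simp_all add: eq mult.assoc gw)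
  have bound: "norm (h ^ Suc n) \<le> norm g * norm g'" for n
  proof -
    have "norm (h ^ Suc n) \<le> norm (g * w ^ Suc n) * norm g'"
      unfolding pow by (rule norm_mult_ineq)
    also have "norm (g * w ^ Suc n) \<le> norm g * norm (w ^ Suc n)" by (rule norm_mult_ineq)
    also have "norm (w ^ Suc n) \<le> norm w ^ Suc n" by (rule norm_power_ineq)
    also have "norm w ^ Suc n \<le> 1" using w by (intro power_le_one) auto
    finally show ?thesis by (simp add: mult_left_mono mult_right_mono)
  qed
  have sa: "self_adjoint (h ^ n)" for n
    using h by (induction n) (auto simp: self_adjoint_def cstar_mult power_commutes)
  have sq: "norm (h ^ (2 ^ k)) = norm h ^ (2 ^ k)" for k
  proof (induction k)
    case (Suc k)
    have "h ^ (2 ^ Suc k) = h ^ (2 ^ k) * h ^ (2 ^ k)" by (simp add: mult_2 power_add)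
    then show ?case
      using norm_square_self_adjoint[OF sa] Suc by (simp add: mult_2 power_add power2_eq_square)
  qed simp
  obtain n where n: "norm g * norm g' < norm h ^ n" using real_arch_pow[OF gt] by blast
  also have "norm h ^ n \<le> norm h ^ (2 ^ n)" using gt by (intro power_increasing) auto
  also have "\<dots> = norm (h ^ (2 ^ n))" by (rule sq[symmetric])
  also have "\<dots> \<le> norm g * norm g'" using bound[of "2 ^ n - 1"] by simp
  finally show False by simp
qed

text \<open>If \<open>s\<close> were missing, the nearest points of \<open>G\<close> on its two
  sides would have a midpoint in \<open>G\<close> that is nearer.\<close>

lemma midpoint_closed_set:
  fixes G :: "real set"
  assumes G: "closed G" "0 \<in> G" "1 \<in> G" and mid: "\<And>x y. x \<in> G \<Longrightarrow> y \<in> G \<Longrightarrow> (x + y) / 2 \<in> G"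
    and s: "0 \<le> s" "s \<le> 1"
  shows "s \<in> G"
proof (rule ccontr)
  assume sG: "s \<notin> G"
  have "Sup (G \<inter> {..s}) \<in> G \<inter> {..s}"
    by (rule closed_contains_Sup) (use G s in \<open>auto intro: closed_Int bdd_aboveI[of _ s]\<close>)
  moreover have "Inf (G \<inter> {s..}) \<in> G \<inter> {s..}"
    by (rule closed_contains_Inf) (use G s in \<open>auto intro: closed_Int bdd_belowI[of _ s]\<close>)
  ultimately obtain l r where lr: "l \<in> G" "l \<le> s" "r \<in> G" "s \<le> r"
    and l: "l = Sup (G \<inter> {..s})" and r: "r = Inf (G \<inter> {s..})" by auto
  have "l < s" "s < r" using lr sG by (auto simp: order_less_le)
  have m: "(l + r) / 2 \<in> G" using mid lr by blast
  show False
  proof (cases "(l + r) / 2 \<le> s")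
    case True
    then have "(l + r) / 2 \<le> l" unfolding l
      by (intro cSup_upper) (use m in \<open>auto simp: l intro: bdd_aboveI[of _ s]\<close>)
    then show False using \<open>l < s\<close> \<open>s < r\<close> by simp
  next
    case False
    then have "r \<le> (l + r) / 2" unfolding r
      by (intro cInf_lower) (use m in \<open>auto simp: r intro: bdd_belowI[of _ s]\<close>)
    then show False using \<open>l < s\<close> \<open>s < r\<close> by simp
  qed
qed

text \<open>The power function is uniformly continuous in exponent and base jointly on the compact
  set of exponents in \<open>{-1..1}\<close> and bases in the spectrum.\<close>

lemma tendsto_pw_exponent:
  assumes a: "strictly_positive a" and lim: "\<sigma> \<longlonglongrightarrow> s" and bd: "\<And>n. \<sigma> n \<in> {-1..1}"
  shows "(\<lambda>n. pw (\<sigma> n) a) \<longlonglongrightarrow> pw s a"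
  unfolding pw_def
proof (rule tendsto_fc)
  have cont: "uniformly_continuous_on ({-1..1} \<times> rspec a) (\<lambda>x. snd x powr fst x)"
    using a by (intro compact_uniformly_continuous compact_Times compact_rspec continuous_intros)
      (auto simp: strictly_positive_def)
  have "uniform_limit (rspec a) (\<lambda>n t. (\<sigma> n, t)) (\<lambda>t. (s, t)) sequentially"
    using lim unfolding uniform_limit_iff tendsto_iff by (auto simp: dist_Pair_Pair elim: eventually_mono)
  from uniform_limit_compose_uniformly_continuous_on[OF this cont]
  show "uniform_limit (rspec a) (\<lambda>n t. t powr \<sigma> n) (\<lambda>t. t powr s) sequentially"
    using bd by (auto intro: closed_Times compact_imp_closed compact_rspec)
qed (use a continuous_on_powr_strict in \<open>auto simp: strictly_positive_def\<close>)

text \<open>Pedersen's argument: the set of exponents for which the bound holds is closed and stable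
  under midpoints, as \<open>\<parallel>h\<parallel>\<close> is the spectral radius of a self-adjoint \<open>h\<close>.\<close>
lemma norm_pw_quotient_le_1:
  assumes a: "strictly_positive a" and b: "strictly_positive b" and ab: "positive_elem (b - a)"
    and s: "0 \<le> s" "s \<le> 1"
  shows "norm (pw (s/2) a * pw (- (s/2)) b) \<le> 1"
proof -
  define G where "G = {s\<in>{0..1}. norm (pw (s/2) a * pw (- (s/2)) b) \<le> 1}"
  have "s \<in> G"
  proof (rule midpoint_closed_set[OF _ _ _ _ s])
    show "closed G"
      unfolding closed_sequential_limits
    proof (intro allI impI)
      fix f l assume f: "(\<forall>n. f n \<in> G) \<and> f \<longlonglongrightarrow> l"
      then have f01: "\<And>n. f n \<in> {0..1}" and lim: "f \<longlonglongrightarrow> l" by (auto simp: G_def)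
      have f1: "f n / 2 \<in> {-1..1}" "- (f n / 2) \<in> {-1..1}" for n using f01[of n] by auto
      have l: "l \<in> {0..1}" using closed_sequentially[of "{0..1}" f l] f01 lim by auto
      have "(\<lambda>n. pw (f n / 2) a) \<longlonglongrightarrow> pw (l/2) a" "(\<lambda>n. pw (- (f n / 2)) b) \<longlonglongrightarrow> pw (- (l/2)) b"
        by (intro tendsto_pw_exponent a b tendsto_intros lim f1; simp)+
      then have "(\<lambda>n. norm (pw (f n / 2) a * pw (- (f n / 2)) b)) \<longlonglongrightarrow> norm (pw (l/2) a * pw (- (l/2)) b)"
        by (intro tendsto_norm tendsto_mult)
      then have "norm (pw (l/2) a * pw (- (l/2)) b) \<le> 1"
        by (rule LIMSEQ_le_const2) (use f in \<open>auto simp: G_def\<close>)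
      then show "l \<in> G" using l by (simp add: G_def)
    qed
    show "0 \<in> G" by (simp add: G_def pw_0_strict a b)
    \<comment> \<open>Conjugating \<open>b - a\<close> by the inverse root \<open>?c\<close> of
      \<open>b\<close> yields \<open>1 - cstar X * X\<close> for
      \<open>X = pw (1/2) a * ?c\<close>.\<close>
    show "1 \<in> G"
    proof -
      let ?c = "pw (- (1/2)) b"
      have c: "cstar ?c = ?c" using self_adjoint_pw_strict[OF b] by (simp add: self_adjoint_def)
      have ha: "cstar (pw (1/2) a) = pw (1/2) a" using self_adjoint_pw_strict[OF a] by (simp add: self_adjoint_def)
      have "pw (- (1/2)) b * pw 1 b * pw (- (1/2)) b = 1"
        by (simp only: pw_add_strict[OF b]) (simp add: pw_0_strict b)
      then have cbc: "?c * b * ?c = 1" by (simp add: pw_1_strict b)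
      have aa: "pw (1/2) a * pw (1/2) a = a" by (simp only: pw_add_strict[OF a]) (simp add: pw_1_strict a)
      have "positive_elem (cstar ?c * (b - a) * ?c)" by (rule positive_conj[OF ab])
      then have "positive_elem (1 *\<^sub>R 1 - ?c * a * ?c)" by (simp add: c left_diff_distrib right_diff_distrib cbc)
      moreover have "?c * a * ?c = cstar (pw (1/2) a * ?c) * (pw (1/2) a * ?c)"
      proof -
        have "pw (1/2) a * (pw (1/2) a * z) = a * z" for z by (metis aa mult.assoc)
        then show ?thesis by (simp add: cstar_mult c ha mult.assoc)
      qed
      ultimately have "positive_elem (1 *\<^sub>R 1 - cstar (pw (1/2) a * ?c) * (pw (1/2) a * ?c))" by simp
      then have "norm (cstar (pw (1/2) a * ?c) * (pw (1/2) a * ?c)) \<le> 1"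
        by (rule norm_le_positive[OF positive_cstar_mult])
      then have "(norm (pw (1/2) a * ?c))\<^sup>2 \<le> 1\<^sup>2" by (simp add: cstar_identity)
      then have "norm (pw (1/2) a * ?c) \<le> 1" by (rule power2_le_imp_le) simp
      then show ?thesis by (simp add: G_def)
    qed
    fix x y assume xy: "x \<in> G" "y \<in> G"
    define m where "m = (x + y) / 2"
    define X where "X = pw (m/2) a * pw (- (m/2)) b"
    define U where "U = pw (x/2) a * pw (- (x/2)) b"
    define V where "V = pw (y/2) a * pw (- (y/2)) b"
    \<comment> \<open>Conjugation by \<open>pw d b\<close> redistributes the unequal exponents of
      \<open>b\<close> in \<open>cstar U * V\<close> evenly and turns it into
      \<open>cstar X * X\<close>.\<close>
    define d where "d = (y - x) / 4"
    have sa: "cstar (pw r a) = pw r a" "cstar (pw r b) = pw r b" for r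
      using self_adjoint_pw_strict[OF a] self_adjoint_pw_strict[OF b] by (auto simp: self_adjoint_def)
    have a3: "pw r a * (pw r' a * z) = pw (r + r') a * z" for r r' z
      using pw_add_strict[OF a] by (metis mult.assoc)
    have b3: "pw r b * (pw r' b * z) = pw (r + r') b * z" for r r' z
      using pw_add_strict[OF b] by (metis mult.assoc)
    have "norm (cstar X * X) \<le> 1"
    proof (rule norm_le_1_similar)
      show "self_adjoint (cstar X * X)" by (simp add: self_adjoint_def cstar_mult cstar_cstar)
      show "pw d b * pw (- d) b = 1" by (simp add: pw_add_strict pw_0_strict b)
      have "cstar X * X = pw (- (m/2)) b * (pw m a * pw (- (m/2)) b)"
        by (simp add: X_def cstar_mult sa mult.assoc a3)
      moreover have "pw (- d) b * (cstar U * V) * pw d b = pw (- d - x/2) b * (pw (x/2 + y/2) a * pw (d - y/2) b)"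
        by (simp add: U_def V_def cstar_mult sa mult.assoc a3 b3 pw_add_strict b add.commute)
      moreover have "- d - x/2 = - (m/2)" "d - y/2 = - (m/2)" "x/2 + y/2 = m"
        by (simp_all add: d_def m_def field_simps)
      ultimately show "cstar X * X = pw (- d) b * (cstar U * V) * pw d b" by metis
      have "norm (cstar U * V) \<le> norm U * norm V" using norm_mult_ineq[of "cstar U" V] by simp
      also have "\<dots> \<le> 1 * 1" using xy by (intro mult_mono) (auto simp: U_def V_def G_def)
      finally show "norm (cstar U * V) \<le> 1" by simp
    qed
    then have "(norm X)\<^sup>2 \<le> 1\<^sup>2" by (simp add: cstar_identity)
    then have "norm X \<le> 1" by (rule power2_le_imp_le) simp
    then show "(x + y) / 2 \<in> G" using xy by (simp add: G_def X_def m_def)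
  qed
  then show ?thesis by (simp add: G_def)
qed

lemma positive_one_minus_square:
  assumes "norm X \<le> 1" shows "positive_elem (1 - cstar X * X)"
proof -
  have "norm (cstar X * X) \<le> 1" using assms by (simp add: cstar_identity power_le_one)
  then show ?thesis
    using positive_norm_minus[of "cstar X * X" 1] by (simp add: self_adjoint_def cstar_mult cstar_cstar)
qed

text \<open>For the contraction \<open>X\<close> both \<open>1 - cstar X * X\<close> and
  \<open>1 - X * cstar X\<close> are positive. Conjugation by \<open>pw (s/2) b\<close> gives the
  first claim, conjugation by \<open>pw (- (s/2)) a\<close> the second.\<close>

lemma Loewner_Heinz_strict:
  assumes a: "strictly_positive a" and b: "strictly_positive b" and ab: "positive_elem (b - a)"
    and s: "0 \<le> s" "s \<le> 1"
  shows "positive_elem (pw s b - pw s a)" "positive_elem (pw (- s) a - pw (- s) b)"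
proof -
  define X where "X = pw (s/2) a * pw (- (s/2)) b"
  have X: "norm X \<le> 1" unfolding X_def by (rule norm_pw_quotient_le_1) fact+
  have sa: "cstar (pw r a) = pw r a" "cstar (pw r b) = pw r b" for r
    using self_adjoint_pw_strict[OF a] self_adjoint_pw_strict[OF b] by (auto simp: self_adjoint_def)
  have a3: "pw r a * (pw r' a * z) = pw (r + r') a * z" for r r' z
    using pw_add_strict[OF a] by (metis mult.assoc)
  have b3: "pw r b * (pw r' b * z) = pw (r + r') b * z" for r r' z
    using pw_add_strict[OF b] by (metis mult.assoc)
  note simps = X_def cstar_mult sa mult.assoc a3 b3 pw_add_strict pw_0_strict a b
    left_diff_distrib right_diff_distrib
  have "positive_elem (cstar (pw (s/2) b) * (1 - cstar X * X) * pw (s/2) b)"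
    by (intro positive_conj positive_one_minus_square X)
  then show "positive_elem (pw s b - pw s a)" by (simp add: simps)
  have "norm (cstar X) \<le> 1" using X by simp
  then have "positive_elem (1 - X * cstar X)" using positive_one_minus_square[of "cstar X"] by (simp add: cstar_cstar)
  then have "positive_elem (cstar (pw (- (s/2)) a) * (1 - X * cstar X) * pw (- (s/2)) a)"
    by (rule positive_conj)
  then show "positive_elem (pw (- s) a - pw (- s) b)" by (simp add: simps)
qed

text \<open>Adding \<open>e\<close> makes both elements strictly positive. The claims are phrased as
  functions of \<open>a\<close> and \<open>b\<close> themselves, ready for the calculus.\<close>

lemma Loewner_Heinz_shift:
  assumes a: "positive_elem a" and b: "positive_elem b" and ab: "positive_elem (b - a)" and e: "0 < e"
    and s: "0 \<le> s" "s \<le> 1"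
  shows "positive_elem (fc (\<lambda>t. (t + e) powr s) b - fc (\<lambda>t. (t + e) powr s) a)"
    "positive_elem (fc (\<lambda>t. (t + e) powr (- s)) a - fc (\<lambda>t. (t + e) powr (- s)) b)"
proof -
  have sh: "strictly_positive (c + e *\<^sub>R 1)" "pw r (c + e *\<^sub>R 1) = fc (\<lambda>t. (t + e) powr r) c"
    if c: "positive_elem c" for c :: 'a and r
  proof -
    have sa: "self_adjoint c" using c by (rule positive_self_adjoint)
    have ct: "continuous_on S (\<lambda>t. t + e)" for S by (intro continuous_intros)
    have eq: "fc (\<lambda>t. t + e) c = c + e *\<^sub>R 1" using fc_add[OF sa, of "\<lambda>t. t" "\<lambda>t. e"] sa by simp
    have "rspec (c + e *\<^sub>R 1) \<subseteq> (\<lambda>t. t + e) ` rspec c" using rspec_fc[OF sa ct] eq by simp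
    then show "strictly_positive (c + e *\<^sub>R 1)"
      using c e sa by (force simp: strictly_positive_def positive_elem_def self_adjoint_simps)
    have "continuous_on ((\<lambda>t. t + e) ` rspec c) (\<lambda>t. t powr r)"
      using c e by (intro continuous_intros) (auto simp: positive_elem_def add_nonneg_eq_0_iff)
    then show "pw r (c + e *\<^sub>R 1) = fc (\<lambda>t. (t + e) powr r) c"
      unfolding pw_def using fc_compose[OF sa ct, of "\<lambda>t. t powr r"] eq by simp
  qed
  have "positive_elem ((b + e *\<^sub>R 1) - (a + e *\<^sub>R 1))" using ab by simp
  from Loewner_Heinz_strict[OF sh(1)[OF a] sh(1)[OF b] this s]
  show "positive_elem (fc (\<lambda>t. (t + e) powr s) b - fc (\<lambda>t. (t + e) powr s) a)"
    "positive_elem (fc (\<lambda>t. (t + e) powr (- s)) a - fc (\<lambda>t. (t + e) powr (- s)) b)"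
    by (simp_all add: sh a b)
qed

lemma continuous_on_powr_nonneg:
  "0 < s \<Longrightarrow> (\<And>t. t \<in> S \<Longrightarrow> (0::real) \<le> t) \<Longrightarrow> continuous_on S (\<lambda>t. t powr s)"
  by (intro continuous_on_powr' continuous_intros) auto

lemma inverse_Suc_tendsto_0: "(\<lambda>n. 1 / real (Suc n)) \<longlonglongrightarrow> 0"
  using LIMSEQ_inverse_real_of_nat by (simp add: inverse_eq_divide)

text \<open>The shift \<open>1 / real (Suc n)\<close> tends to zero and positive elements form a
  closed set.\<close>

lemma Loewner_Heinz:
  assumes a: "positive_elem a" and ab: "positive_elem (b - a)" and s: "0 < s" "s \<le> 1"
  shows "positive_elem (pw s b - pw s a)"
proof -
  have b: "positive_elem b" using positive_add[OF a ab] by simp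
  have lim: "(\<lambda>n. fc (\<lambda>t. (t + 1 / real (Suc n)) powr s) c) \<longlonglongrightarrow> pw s c" if c: "positive_elem c" for c :: 'a
    unfolding pw_def
  proof (rule tendsto_fc)
    show "self_adjoint c" using c by (rule positive_self_adjoint)
    show "continuous_on (rspec c) (\<lambda>t. (t + 1 / real (Suc n)) powr s)" for n
      using c by (intro continuous_intros) (auto simp: positive_elem_def add_nonneg_eq_0_iff)
    have cont: "uniformly_continuous_on {0..norm c + 1} (\<lambda>t. t powr s)"
      using s by (intro compact_uniformly_continuous continuous_on_powr_nonneg) auto
    have lim: "uniform_limit (rspec c) (\<lambda>n t. t + 1 / real (Suc n)) (\<lambda>t. t) sequentially"
      using inverse_Suc_tendsto_0 unfolding uniform_limit_iff tendsto_iff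
      by (auto simp: dist_real_def elim: eventually_mono)
    have "t + 1 / real (Suc n) \<in> {0..norm c + 1}" if t: "t \<in> rspec c" for t n
    proof -
      have "1 / real (Suc n) \<le> 1" "0 \<le> 1 / real (Suc n)" by simp_all
      moreover have "0 \<le> t" "t \<le> norm c" using t c rspec_bound[OF t] by (auto simp: positive_elem_def)
      ultimately show ?thesis unfolding atLeastAtMost_iff by linarith
    qed
    then have "\<forall>\<^sub>F n in sequentially. \<forall>t\<in>rspec c. t + 1 / real (Suc n) \<in> {0..norm c + 1}"
      by (intro always_eventually allI ballI)
    then show "uniform_limit (rspec c) (\<lambda>n t. (t + 1 / real (Suc n)) powr s) (\<lambda>t. t powr s) sequentially"
      by (rule uniform_limit_compose_uniformly_continuous_on[OF lim cont]) (rule closed_atLeastAtMost)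
  qed
  have "(\<lambda>n. fc (\<lambda>t. (t + 1 / real (Suc n)) powr s) b - fc (\<lambda>t. (t + 1 / real (Suc n)) powr s) a)
      \<longlonglongrightarrow> pw s b - pw s a"
    by (intro tendsto_diff lim a b)
  then show ?thesis
    by (rule positive_tendsto) (intro Loewner_Heinz_shift a b ab; use s in simp)
qed

section \<open>Factorization\<close>

lemma continuous_on_powr_positive:
  "positive_elem a \<Longrightarrow> 0 < s \<Longrightarrow> continuous_on (rspec a) (\<lambda>t. t powr s)"
  by (rule continuous_on_powr_nonneg) (auto simp: positive_elem_def)

lemma positive_pw: "positive_elem a \<Longrightarrow> 0 < s \<Longrightarrow> positive_elem (pw s a)"
  unfolding pw_def by (intro positive_fc continuous_on_powr_positive) (auto simp: positive_elem_def)

lemma cstar_pw [simp]: "positive_elem a \<Longrightarrow> 0 < s \<Longrightarrow> cstar (pw s a) = pw s a"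
  using positive_pw[of a s] by (simp add: positive_elem_def self_adjoint_def)

lemma pw_add: "positive_elem a \<Longrightarrow> 0 < s \<Longrightarrow> 0 < r \<Longrightarrow> pw s a * pw r a = pw (s + r) a"
  unfolding pw_def powr_add
  by (intro fc_mult[symmetric] continuous_on_powr_positive) (auto simp: positive_elem_def)

lemma pw_1: "positive_elem a \<Longrightarrow> pw 1 a = a"
  unfolding pw_def using fc_id[of a] fc_cong[of a "\<lambda>t. t powr 1" "\<lambda>t. t"]
  by (force simp: positive_elem_def)

lemma pw_pw:
  assumes "positive_elem a" "0 < s" "0 < r" shows "pw r (pw s a) = pw (s * r) a"
  unfolding pw_def using assms
  by (subst fc_compose) (auto intro!: continuous_on_powr_positive continuous_on_powr_nonneg simp: positive_elem_def powr_powr)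

lemma pw_scaleR:
  assumes a: "positive_elem a" and c: "0 \<le> c" and r: "0 < r"
  shows "pw r (c *\<^sub>R a) = (c powr r) *\<^sub>R pw r a"
proof -
  have sa: "self_adjoint a" using a by (rule positive_self_adjoint)
  have ct: "continuous_on S (\<lambda>t. c * t)" for S by (intro continuous_intros)
  have "pw r (c *\<^sub>R a) = fc (\<lambda>t. t powr r) (fc (\<lambda>t. c * t) a)"
    using fc_scale[OF sa, of "\<lambda>t. t" c] sa by (simp add: pw_def)
  also have "\<dots> = fc (\<lambda>t. (c * t) powr r) a"
    by (rule fc_compose[OF sa ct]) (use a c r in \<open>auto intro!: continuous_on_powr_nonneg simp: positive_elem_def\<close>)
  also have "\<dots> = fc (\<lambda>t. c powr r * t powr r) a"
    by (rule fc_cong) (use a c in \<open>auto simp: positive_elem_def powr_mult\<close>)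
  also have "\<dots> = (c powr r) *\<^sub>R pw r a"
    unfolding pw_def by (intro fc_scale sa continuous_on_powr_positive a r)
  finally show ?thesis .
qed

text \<open>With \<open>q = t / (t + e)\<close> the absolute value is \<open>1 - q powr g\<close>,
  hence at most \<open>1 - q = e / (t + e)\<close>. The remaining inequality follows by comparing
  \<open>t\<close> with \<open>e\<close>. The bound is uniform in \<open>t\<close> and drives the
  limits below.\<close>

lemma powr_regularization_bound:
  fixes t e g \<theta> :: real
  assumes t: "0 \<le> t" and e: "0 < e" and \<theta>: "0 < \<theta>" "\<theta> \<le> 1" and g: "0 < g" "g \<le> 1"
  shows "t powr \<theta> * \<bar>(t + e) powr (- g) * t powr g - 1\<bar> \<le> e powr \<theta>"
proof (cases "t = 0")
  case False
  then have t: "0 < t" using t by simp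
  let ?q = "t / (t + e)"
  have q: "0 \<le> ?q" "?q \<le> 1" using t e by auto
  have "(t + e) powr (- g) * t powr g = ?q powr g"
    using t e by (simp add: powr_divide powr_minus divide_simps)
  moreover have "?q \<le> ?q powr g" using powr_mono'[of g 1 ?q] q g t e by simp
  moreover have "?q powr g \<le> 1" using q g powr_mono2[of g ?q 1] by simp
  ultimately have "\<bar>(t + e) powr (- g) * t powr g - 1\<bar> \<le> 1 - ?q" using q by simp
  also have "1 - ?q = e / (t + e)" using t e by (simp add: divide_simps)
  finally have "t powr \<theta> * \<bar>(t + e) powr (- g) * t powr g - 1\<bar> \<le> t powr \<theta> * (e / (t + e))"
    by (rule mult_left_mono) simp
  also have "\<dots> \<le> e powr \<theta>"
  proof (cases "t \<le> e")
    case True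
    then have "t powr \<theta> \<le> e powr \<theta>" using t \<theta> by (intro powr_mono2) auto
    then have "t powr \<theta> * (e / (t + e)) \<le> e powr \<theta> * 1" using t e by (intro mult_mono) auto
    then show ?thesis by simp
  next
    case False
    have "t powr (\<theta> - 1) \<le> e powr (\<theta> - 1)" using False e \<theta> by (intro powr_mono2') auto
    then have "t powr (\<theta> - 1) * t \<le> e powr (\<theta> - 1) * t" using t by simp
    then have "t powr \<theta> * e \<le> e powr \<theta> * t"
      using t e by (simp add: powr_diff field_simps)
    also have "\<dots> \<le> e powr \<theta> * (t + e)" using e by (intro mult_left_mono) auto
    finally show ?thesis using t e by (simp add: divide_simps)
  qed
  finally show ?thesis .
qed (use e \<theta> in simp)

lemma continuous_on_regularization:
  "positive_elem b \<Longrightarrow> continuous_on (rspec b) (\<lambda>t. (t + 1 / real (Suc n)) powr r)"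
  by (intro continuous_intros) (auto simp: positive_elem_def add_nonneg_eq_0_iff)

lemma tendsto_inverse_Suc_powr: "0 < \<theta> \<Longrightarrow> (\<lambda>n. (1 / real (Suc n)) powr \<theta>) \<longlonglongrightarrow> 0"
  using tendsto_powr'[OF inverse_Suc_tendsto_0 tendsto_const[of \<theta>]] by simp

text \<open>As \<open>cstar x * x\<close> is below \<open>b\<close>, the C*-identity replaces
  \<open>x * g(b)\<close> by \<open>g(b) * b * g(b)\<close>, whose norm is read off from the
  spectrum of \<open>b\<close>.\<close>

lemma norm_mult_fc_le:
  assumes b: "positive_elem b" and xb: "positive_elem (b - cstar x * x)" and g: "continuous_on (rspec b) g"
    and M: "0 \<le> M" and bound: "\<And>t. t \<in> rspec b \<Longrightarrow> t powr (1/2) * \<bar>g t\<bar> \<le> M"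
  shows "norm (x * fc g b) \<le> M"
proof -
  have sa: "self_adjoint b" using b by (rule positive_self_adjoint)
  let ?g = "fc g b"
  have gs: "cstar ?g = ?g" using self_adjoint_fc[OF sa g] by (simp add: self_adjoint_def)
  have "(norm (x * ?g))\<^sup>2 = norm (cstar (x * ?g) * (x * ?g))" by (simp add: cstar_identity)
  also have "\<dots> \<le> norm (?g * b * ?g)"
  proof (rule norm_mono_positive[OF positive_cstar_mult])
    have "positive_elem (cstar ?g * (b - cstar x * x) * ?g)" by (rule positive_conj[OF xb])
    then show "positive_elem (?g * b * ?g - cstar (x * ?g) * (x * ?g))"
      by (simp add: gs cstar_mult algebra_simps)
  qed
  also have "?g * b * ?g = fc (\<lambda>t. g t * t * g t) b"
    using sa g by (simp add: fc_mult continuous_on_mult)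
  also have "norm \<dots> \<le> M\<^sup>2"
  proof (rule norm_fc_le[OF sa])
    fix t assume t: "t \<in> rspec b"
    then have t0: "0 \<le> t" using b by (simp add: positive_elem_def)
    have "g t * t * g t = t * (g t)\<^sup>2" by (simp add: power2_eq_square)
    then have "\<bar>g t * t * g t\<bar> = t * (g t)\<^sup>2" using t0 by (simp only: abs_of_nonneg mult_nonneg_nonneg zero_le_power2)
    also have "\<dots> = (t powr (1/2) * \<bar>g t\<bar>)\<^sup>2"
      using t0 by (simp add: power_mult_distrib powr_half_sqrt)
    also have "\<dots> \<le> M\<^sup>2" using bound[OF t] by (intro power_mono) auto
    finally show "\<bar>g t * t * g t\<bar> \<le> M\<^sup>2" .
  qed (intro continuous_intros g)
  finally show ?thesis using M by (rule power2_le_imp_le)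
qed

text \<open>Formally \<open>u\<close> is \<open>x\<close> times the power \<open>- g\<close> of
  \<open>b\<close>, but \<open>b\<close> need not be invertible, so \<open>u\<close> is obtained as
  a limit of regularizations. The limit itself is part of the conclusion because
  \<open>pw_sum_in_pspan\<close> computes with it.\<close>

lemma factorization:
  fixes x b :: "'a::cstar_algebra_1"
  assumes b: "positive_elem b" and xb: "positive_elem (b - cstar x * x)" and g: "0 < g" "g < 1/2"
  obtains u where "(\<lambda>n. x * fc (\<lambda>t. (t + 1 / real (Suc n)) powr (- g)) b) \<longlonglongrightarrow> u" "u * pw g b = x"
proof -
  define e where "e n = 1 / real (Suc n)" for n
  have e: "0 < e n" for n by (simp add: e_def)
  define F where "F n t = (t + e n) powr (- g)" for n t
  have F: "continuous_on (rspec b) (F n)" for n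
    unfolding F_def e_def by (rule continuous_on_regularization[OF b])
  have sa: "self_adjoint b" using b by (rule positive_self_adjoint)
  \<comment> \<open>Domination by \<open>b\<close> provides the weight \<open>t powr (1/2)\<close>;
    the part \<open>t powr g\<close> compensates the singularity, and a positive exponent is left
    for convergence exactly because \<open>g < 1/2\<close>.\<close>
  define \<theta> where "\<theta> = 1/2 - g"
  have \<theta>: "0 < \<theta>" "\<theta> \<le> 1" using g by (auto simp: \<theta>_def)
  have cauchy: "norm (x * fc (F m) b - x * fc (F n) b) \<le> e m powr \<theta> + e n powr \<theta>" for m n
  proof -
    have "norm (x * fc (\<lambda>t. F m t - F n t) b) \<le> e m powr \<theta> + e n powr \<theta>"
    proof (rule norm_mult_fc_le[OF b xb])
      fix t assume "t \<in> rspec b"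
      then have t: "0 \<le> t" using b by (simp add: positive_elem_def)
      have eq: "(F m t * t powr g - 1) - (F n t * t powr g - 1) = (F m t - F n t) * t powr g"
        by (simp add: left_diff_distrib)
      have "t powr (1/2) = t powr \<theta> * t powr g" by (simp add: \<theta>_def flip: powr_add)
      then have "t powr (1/2) * \<bar>F m t - F n t\<bar> = t powr \<theta> * \<bar>(F m t * t powr g - 1) - (F n t * t powr g - 1)\<bar>"
        by (simp add: eq abs_mult)
      also have "\<dots> \<le> t powr \<theta> * (\<bar>F m t * t powr g - 1\<bar> + \<bar>F n t * t powr g - 1\<bar>)"
        by (intro mult_left_mono abs_triangle_ineq4) simp
      also have "\<dots> \<le> e m powr \<theta> + e n powr \<theta>"
        using powr_regularization_bound[OF t e \<theta>, of g m] powr_regularization_bound[OF t e \<theta>, of g n] g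
        by (simp add: F_def distrib_left)
      finally show "t powr (1/2) * \<bar>F m t - F n t\<bar> \<le> e m powr \<theta> + e n powr \<theta>" .
    qed (use F in \<open>auto intro: continuous_on_diff\<close>)
    then show ?thesis by (simp add: fc_diff[OF sa F F] right_diff_distrib)
  qed
  have e0: "(\<lambda>n. e n powr \<theta>) \<longlonglongrightarrow> 0" if "0 < \<theta>" for \<theta> :: real
    unfolding e_def by (rule tendsto_inverse_Suc_powr[OF that])
  have "Cauchy (\<lambda>n. x * fc (F n) b)"
  proof (rule CauchyI)
    fix \<epsilon> :: real assume "\<epsilon> > 0"
    then have "\<forall>\<^sub>F n in sequentially. e n powr \<theta> < \<epsilon> / 2"
      using order_tendstoD(2)[OF e0[OF \<theta>(1)], of "\<epsilon> / 2"] by simp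
    then obtain N where N: "\<And>n. n \<ge> N \<Longrightarrow> e n powr \<theta> < \<epsilon> / 2"
      by (auto simp: eventually_sequentially)
    show "\<exists>N. \<forall>m\<ge>N. \<forall>n\<ge>N. norm (x * fc (F m) b - x * fc (F n) b) < \<epsilon>"
    proof (intro exI allI impI)
      fix m n assume "N \<le> m" "N \<le> n"
      then show "norm (x * fc (F m) b - x * fc (F n) b) < \<epsilon>"
        using cauchy[of m n] N[of m] N[of n] by linarith
    qed
  qed
  then obtain u where u: "(\<lambda>n. x * fc (F n) b) \<longlonglongrightarrow> u" using Cauchy_convergent convergent_def by blast
  have pc: "continuous_on (rspec b) (\<lambda>t. t powr g)" by (rule continuous_on_powr_positive[OF b g(1)])
  have close: "norm (x * fc (F n) b * pw g b - x) \<le> e n powr (1/2)" for n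
  proof -
    have c: "continuous_on (rspec b) (\<lambda>t. F n t * t powr g)" by (intro continuous_on_mult F pc)
    have "norm (x * fc (\<lambda>t. F n t * t powr g - 1) b) \<le> e n powr (1/2)"
    proof (rule norm_mult_fc_le[OF b xb])
      show "continuous_on (rspec b) (\<lambda>t. F n t * t powr g - 1)" by (intro continuous_intros c)
      fix t assume "t \<in> rspec b"
      then have t: "0 \<le> t" using b by (simp add: positive_elem_def)
      show "t powr (1/2) * \<bar>F n t * t powr g - 1\<bar> \<le> e n powr (1/2)"
        unfolding F_def by (rule powr_regularization_bound[OF t e]) (use g in auto)
    qed simp
    moreover have "fc (\<lambda>t. F n t * t powr g - 1) b = fc (F n) b * pw g b - 1"
      using fc_diff[OF sa c, of "\<lambda>t. 1"] fc_mult[OF sa F pc] sa by (simp add: pw_def)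
    ultimately show ?thesis by (simp add: right_diff_distrib mult.assoc)
  qed
  have "(\<lambda>n. x * fc (F n) b * pw g b - x) \<longlonglongrightarrow> 0"
    by (rule Lim_null_comparison[OF _ e0[of "1/2"]]) (use close in auto)
  moreover have "(\<lambda>n. x * fc (F n) b * pw g b - x) \<longlonglongrightarrow> u * pw g b - x"
    by (intro tendsto_intros u)
  ultimately have "u * pw g b - x = 0" by (rule LIMSEQ_unique[symmetric])
  then show ?thesis using that[of u] u unfolding F_def e_def by simp
qed

text \<open>The difference from \<open>t powr s\<close> is \<open>t powr s\<close> times the
  regularization error for \<open>g = 1 - s\<close>, so the scalar bound with
  \<open>\<theta> = s\<close> gives uniform convergence.\<close>

lemma tendsto_regularized_pw:
  assumes b: "positive_elem b" and s: "0 < s" "s < 1"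
  shows "(\<lambda>n. fc (\<lambda>t. t * (t + 1 / real (Suc n)) powr (s - 1)) b) \<longlonglongrightarrow> pw s b"
  unfolding pw_def
proof (rule tendsto_fc)
  show "self_adjoint b" using b by (rule positive_self_adjoint)
  show "continuous_on (rspec b) (\<lambda>t. t * (t + 1 / real (Suc n)) powr (s - 1))" for n
    by (intro continuous_on_mult continuous_on_id continuous_on_regularization b)
  show "uniform_limit (rspec b) (\<lambda>n t. t * (t + 1 / real (Suc n)) powr (s - 1)) (\<lambda>t. t powr s) sequentially"
    unfolding uniform_limit_iff
  proof (intro allI impI)
    fix e :: real assume "e > 0"
    then have "\<forall>\<^sub>F n in sequentially. (1 / real (Suc n)) powr s < e"
      using order_tendstoD(2)[OF tendsto_inverse_Suc_powr[OF s(1)]] by blast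
    then show "\<forall>\<^sub>F n in sequentially. \<forall>t\<in>rspec b. dist (t * (t + 1 / real (Suc n)) powr (s - 1)) (t powr s) < e"
    proof eventually_elim
      case (elim n)
      show ?case
      proof
        fix t assume "t \<in> rspec b"
        then have t: "0 \<le> t" using b by (simp add: positive_elem_def)
        have "t powr s * t powr (1 - s) = t" using t by (simp flip: powr_add)
        moreover have "t powr s * (A * t powr (1 - s) - 1) = (t powr s * t powr (1 - s)) * A - t powr s" for A
          by (simp add: algebra_simps)
        ultimately have "t * (t + 1 / real (Suc n)) powr (s - 1) - t powr s
            = t powr s * ((t + 1 / real (Suc n)) powr (- (1 - s)) * t powr (1 - s) - 1)"
          by simp
        then have "\<bar>t * (t + 1 / real (Suc n)) powr (s - 1) - t powr s\<bar>
            = t powr s * \<bar>(t + 1 / real (Suc n)) powr (- (1 - s)) * t powr (1 - s) - 1\<bar>"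
          by (simp add: abs_mult)
        also have "\<dots> \<le> (1 / real (Suc n)) powr s"
          by (rule powr_regularization_bound[OF t]) (use s in auto)
        finally show "dist (t * (t + 1 / real (Suc n)) powr (s - 1)) (t powr s) < e"
          using elim by (simp only: dist_real_def)
      qed
    qed
  qed
qed

section \<open>Powers of the ideal generated by a positive element\<close>

text \<open>This is the \<open>M\<^sub>r\<close> of the introduction. It is stable under negation
  and complex multiples, as these can be absorbed into the factor \<open>a\<close>.\<close>

inductive_set pspan :: "'a::cstar_algebra_1 \<Rightarrow> real \<Rightarrow> 'a set" for e r where
  zero: "0 \<in> pspan e r"
| gen: "a * pw r e * b \<in> pspan e r"
| add: "x \<in> pspan e r \<Longrightarrow> y \<in> pspan e r \<Longrightarrow> x + y \<in> pspan e r"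

lemma pspan_mult: "x \<in> pspan e r \<Longrightarrow> c * x * d \<in> pspan e r"
proof (induction rule: pspan.induct)
  case (gen a b)
  then show ?case using pspan.gen[of "c * a" r e "b * d"] by (simp add: mult.assoc)
qed (auto simp: distrib_left distrib_right intro: pspan.intros)

lemma pspan_mult_left: "x \<in> pspan e r \<Longrightarrow> c * x \<in> pspan e r"
  using pspan_mult[of x e r c 1] by simp

lemma pspan_mult_right: "x \<in> pspan e r \<Longrightarrow> x * c \<in> pspan e r"
  using pspan_mult[of x e r 1 c] by simp

lemma pspan_scaleC: "x \<in> pspan e r \<Longrightarrow> scaleC c x \<in> pspan e r"
  using pspan_mult_left[of x e r "scaleC c 1"] by (simp add: mult_scaleC_left)

lemma pspan_scaleR: "x \<in> pspan e r \<Longrightarrow> c *\<^sub>R x \<in> pspan e r"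
  using pspan_scaleC[of x e r "complex_of_real c"] by (simp add: scaleC_of_real)

lemma pspan_minus: "x \<in> pspan e r \<Longrightarrow> - x \<in> pspan e r"
  using pspan_scaleR[of x e r "-1"] by simp

lemma pspan_diff: "x \<in> pspan e r \<Longrightarrow> y \<in> pspan e r \<Longrightarrow> x - y \<in> pspan e r"
  using pspan.add[of x e r "- y"] by (simp add: pspan_minus)

lemma pspan_sum_list: "(\<And>x. x \<in> set xs \<Longrightarrow> f x \<in> pspan e r) \<Longrightarrow> sum_list (map f xs) \<in> pspan e r"
  by (induction xs) (auto intro: pspan.intros)

lemma pspan_antimono:
  assumes e: "positive_elem e" and sr: "0 < s" "s \<le> r"
  shows "pspan e r \<subseteq> pspan e s"
proof
  fix x assume "x \<in> pspan e r"
  then show "x \<in> pspan e s"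
  proof (induction rule: pspan.induct)
    case (gen a b)
    show ?case
    proof (cases "s = r")
      case False
      then have "pw r e = pw (r - s) e * pw s e" using pw_add[OF e, of "r - s" s] sr by simp
      then show ?thesis using pspan.gen[of "a * pw (r - s) e" s e b] by (simp add: mult.assoc)
    qed (auto intro: pspan.gen)
  qed (auto intro: pspan.intros)
qed

lemma positive_sum_list:
  "(\<And>x. x \<in> set xs \<Longrightarrow> positive_elem (f x)) \<Longrightarrow> positive_elem (sum_list (map f xs))"
  by (induction xs) (auto intro: positive_add)

lemma tendsto_sum_list:
  fixes F :: "'b \<Rightarrow> nat \<Rightarrow> 'a::real_normed_vector"
  shows "(\<And>y. y \<in> set ys \<Longrightarrow> F y \<longlonglongrightarrow> G y) \<Longrightarrow>
    (\<lambda>n. sum_list (map (\<lambda>y. F y n) ys)) \<longlonglongrightarrow> sum_list (map G ys)"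
  by (induction ys) (auto intro!: tendsto_add)

text \<open>Rotfel'd's trick: \<open>S\<^sup>s\<close> is the sum of the \<open>z\<^sub>y\<^sup>* z\<^sub>y\<close> with \<open>z\<^sub>y = y S\<^bsup>(s-1)/2\<^esup>\<close>, and
  \<open>z\<^sub>y z\<^sub>y\<^sup>* = y S\<^bsup>s-1\<^esup> y\<^sup>* \<le> (y y\<^sup>*)\<^sup>s\<close> because \<open>S \<ge> y\<^sup>* y\<close>.\<close>
lemma pw_sum_in_pspan:
  fixes e :: "'a::cstar_algebra_1"
  defines "S \<equiv> \<lambda>ys. sum_list (map (\<lambda>y::'a. cstar y * y) ys)"
  assumes e: "positive_elem e" and r: "0 < r" and s: "0 < s" "s < 1" and q: "0 < q" "q < s * r"
    and ys: "\<And>y. y \<in> set ys \<Longrightarrow> \<exists>c\<ge>0. positive_elem (c *\<^sub>R pw r e - y * cstar y)"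
  shows "pw s (S ys) \<in> pspan e q"
proof -
  define \<gamma> where "\<gamma> = (1 - s) / 2"
  have \<gamma>: "0 < \<gamma>" "\<gamma> < 1/2" using s by (auto simp: \<gamma>_def)
  let ?S = "S ys"
  have S: "positive_elem ?S" unfolding S_def by (intro positive_sum_list positive_cstar_mult)
  have Ssa: "self_adjoint ?S" using S by (rule positive_self_adjoint)
  have le: "positive_elem (?S - cstar y * y)" if "y \<in> set ys" for y
    unfolding S_def using sum_list_map_remove1[OF that, of "\<lambda>y. cstar y * y"]
    by (simp add: positive_sum_list positive_cstar_mult)
  define F where "F n t = (t + 1 / real (Suc n)) powr (- \<gamma>)" for n t
  define G where "G n t = (t + 1 / real (Suc n)) powr (- (1 - s))" for n t
  have ct: "continuous_on (rspec b) (F n)" "continuous_on (rspec b) (G n)" if "positive_elem b" for b :: 'a and n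
    unfolding F_def G_def by (intro continuous_on_regularization that)+
  have GF: "G n = (\<lambda>t. F n t * F n t)" for n
    by (rule ext) (simp add: G_def F_def \<gamma>_def flip: powr_add)
  have Fs: "cstar (fc (F n) ?S) = fc (F n) ?S" for n
    using self_adjoint_fc[OF Ssa ct(1)[OF S]] by (simp add: self_adjoint_def)
  have FF: "fc (F n) ?S * fc (F n) ?S = fc (G n) ?S" for n
    unfolding GF by (intro fc_mult[symmetric] Ssa ct S)
  have "\<forall>y\<in>set ys. \<exists>z. (\<lambda>n. y * fc (F n) ?S) \<longlonglongrightarrow> z"
    using factorization[OF S le \<gamma>] unfolding F_def by metis
  then obtain z where z: "\<And>y. y \<in> set ys \<Longrightarrow> (\<lambda>n. y * fc (F n) ?S) \<longlonglongrightarrow> z y" by metis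
  \<comment> \<open>The regularized sums converge to the sum of the
    \<open>cstar (z y) * z y\<close>; the calculus identifies them with regularizations of
    \<open>pw s ?S\<close>, so the two limits agree.\<close>
  have "(\<lambda>n. sum_list (map (\<lambda>y. cstar (y * fc (F n) ?S) * (y * fc (F n) ?S)) ys))
      \<longlonglongrightarrow> sum_list (map (\<lambda>y. cstar (z y) * z y) ys)"
    by (intro tendsto_sum_list tendsto_mult tendsto_cstar z)
  moreover have "sum_list (map (\<lambda>y. cstar (y * fc (F n) ?S) * (y * fc (F n) ?S)) ys)
      = fc (\<lambda>t. t * (t + 1 / real (Suc n)) powr (s - 1)) ?S" for n
  proof -
    let ?f = "fc (F n) ?S"
    have "sum_list (map (\<lambda>y. cstar (y * ?f) * (y * ?f)) ys) = ?f * ?S * ?f"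
    proof -
      have "sum_list (map (\<lambda>y. cstar (y * f) * (y * f)) ys) = cstar f * S ys * f" for f
        unfolding S_def by (induction ys) (simp_all add: cstar_mult algebra_simps)
      then show ?thesis by (simp add: Fs)
    qed
    also have "\<dots> = fc (\<lambda>t. F n t * t * F n t) ?S"
      using Ssa ct(1)[OF S] by (simp add: fc_mult continuous_on_mult)
    also have "\<dots> = fc (\<lambda>t. t * (t + 1 / real (Suc n)) powr (s - 1)) ?S"
    proof (rule fc_cong)
      fix t
      have "F n t * F n t = (t + 1 / real (Suc n)) powr (s - 1)"
        using fun_cong[OF GF, of n t] by (simp add: G_def)
      moreover have "F n t * t * F n t = t * (F n t * F n t)" by simp
      ultimately show "F n t * t * F n t = t * (t + 1 / real (Suc n)) powr (s - 1)" by (simp only:)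
    qed
    finally show ?thesis .
  qed
  ultimately have sum: "pw s ?S = sum_list (map (\<lambda>y. cstar (z y) * z y) ys)"
    using LIMSEQ_unique[OF tendsto_regularized_pw[OF S s]] by simp
  have "cstar (z y) * z y \<in> pspan e q" if y: "y \<in> set ys" for y
  proof -
    obtain c where c: "0 \<le> c" "positive_elem (c *\<^sub>R pw r e - y * cstar y)" using ys[OF y] by blast
    have yy: "positive_elem (cstar y * y)" "positive_elem (y * cstar y)"
      using positive_cstar_mult[of y] positive_cstar_mult[of "cstar y"] by (auto simp: cstar_cstar)
    \<comment> \<open>The decreasing function \<open>G n\<close> reverses the order, so
      \<open>?S\<close> may be replaced by the smaller \<open>cstar y * y\<close>. Moving
      \<open>y\<close> past it leaves a function of \<open>y * cstar y\<close> that lies below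
      \<open>t powr s\<close>.\<close>
    have step: "positive_elem (pw s (y * cstar y) - y * fc (F n) ?S * cstar (y * fc (F n) ?S))" for n
    proof -
      have "positive_elem (fc (G n) (cstar y * y) - fc (G n) ?S)"
        unfolding G_def using s by (intro Loewner_Heinz_shift(2) yy S le[OF y]) auto
      from positive_conj[OF this, of "cstar y"]
      have "positive_elem (y * fc (G n) (cstar y * y) * cstar y - y * fc (G n) ?S * cstar y)"
        by (simp add: cstar_cstar left_diff_distrib right_diff_distrib)
      moreover have "y * fc (G n) (cstar y * y) = fc (G n) (y * cstar y) * y"
      proof (rule fc_intertwine)
        have "continuous_on {0..} (G n)"
          unfolding G_def by (intro continuous_intros) (auto simp: add_nonneg_eq_0_iff)
        then show "continuous_on (rspec (cstar y * y) \<union> rspec (y * cstar y)) (G n)"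
          by (rule continuous_on_subset) (use yy in \<open>auto simp: positive_elem_def\<close>)
      qed (auto simp: mult.assoc intro: positive_self_adjoint yy)
      moreover have "fc (G n) (y * cstar y) * (y * cstar y) = fc (\<lambda>t. G n t * t) (y * cstar y)"
        using fc_mult[OF positive_self_adjoint[OF yy(2)] ct(2)[OF yy(2)], of "\<lambda>t. t"] yy
        by (simp add: positive_self_adjoint)
      ultimately have 1: "positive_elem (fc (\<lambda>t. G n t * t) (y * cstar y) - y * fc (G n) ?S * cstar y)"
        by (simp add: mult.assoc)
      have cG: "continuous_on (rspec (y * cstar y)) (\<lambda>t. G n t * t)"
        by (intro continuous_on_mult continuous_on_id ct yy)
      have cp: "continuous_on (rspec (y * cstar y)) (\<lambda>t. t powr s)"
        by (rule continuous_on_powr_positive[OF yy(2) s(1)])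
      have "positive_elem (fc (\<lambda>t. t powr s - G n t * t) (y * cstar y))"
      proof (rule positive_fc)
        show "self_adjoint (y * cstar y)" using yy(2) by (rule positive_self_adjoint)
        show "continuous_on (rspec (y * cstar y)) (\<lambda>t. t powr s - G n t * t)"
          by (intro continuous_on_diff cp cG)
        fix t assume "t \<in> rspec (y * cstar y)"
        then have t: "0 \<le> t" using yy by (simp add: positive_elem_def)
        show "0 \<le> t powr s - G n t * t"
        proof (cases "t = 0")
          case False
          then have "G n t \<le> t powr (- (1 - s))"
            unfolding G_def using t s by (intro powr_mono2') auto
          then have "G n t * t \<le> t powr (s - 1) * t" using t by (simp add: mult_right_mono)
          also have "\<dots> = t powr s" using t False by (simp add: powr_diff)
          finally show ?thesis by simp
        qed simp
      qed
      then have "positive_elem (pw s (y * cstar y) - fc (\<lambda>t. G n t * t) (y * cstar y))"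
        unfolding pw_def using fc_diff[OF positive_self_adjoint[OF yy(2)] cp cG] by simp
      from positive_add[OF this 1] show ?thesis
        by (simp add: cstar_mult Fs mult.assoc[symmetric]) (simp add: FF mult.assoc)
    qed
    have "(\<lambda>n. pw s (y * cstar y) - y * fc (F n) ?S * cstar (y * fc (F n) ?S))
        \<longlonglongrightarrow> pw s (y * cstar y) - z y * cstar (z y)"
      by (intro tendsto_intros tendsto_cstar z y)
    then have 1: "positive_elem (pw s (y * cstar y) - z y * cstar (z y))"
      by (rule positive_tendsto) (rule step)
    have 2: "positive_elem (pw s (c *\<^sub>R pw r e) - pw s (y * cstar y))"
      using Loewner_Heinz[OF yy(2) c(2) s(1)] s by simp
    define D where "D = (c powr s) *\<^sub>R pw (r * s) e"
    have rs: "0 < r * s" using r s by simp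
    have D: "positive_elem D" unfolding D_def by (intro positive_scaleR positive_pw e rs) simp
    have "pw s (c *\<^sub>R pw r e) = D"
      using pw_scaleR[OF positive_pw[OF e r] c(1) s(1)] pw_pw[OF e r s(1)] by (simp add: D_def)
    then have "positive_elem (D - cstar (cstar (z y)) * cstar (z y))"
      using positive_add[OF 2 1] by (simp add: cstar_cstar)
    \<comment> \<open>Chosen so that \<open>pw \<beta> D\<close> is a multiple of
      \<open>pw (q/2) e\<close>; the loss \<open>q < s * r\<close> is what makes
      \<open>\<beta> < 1/2\<close>.\<close>
    moreover define \<beta> where "\<beta> = q / (2 * (r * s))"
    have \<beta>: "0 < \<beta>" "\<beta> < 1/2" using q rs by (auto simp: \<beta>_def divide_simps mult.commute)
    ultimately obtain u where u: "u * pw \<beta> D = cstar (z y)"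
      using factorization[OF D _ \<beta>] by blast
    define d where "d = (c powr s) powr \<beta>"
    have qq: "q / 2 = r * s * \<beta>" using r s by (simp add: \<beta>_def)
    have "pw \<beta> D = d *\<^sub>R pw (q/2) e"
      using pw_scaleR[OF positive_pw[OF e rs] _ \<beta>(1), of "c powr s"] pw_pw[OF e rs \<beta>(1)]
      by (simp add: D_def d_def qq)
    then have zu: "cstar (z y) = d *\<^sub>R (u * pw (q/2) e)" using u by simp
    have "z y = cstar (d *\<^sub>R (u * pw (q/2) e))" by (simp add: cstar_cstar flip: zu)
    then have zy: "z y = d *\<^sub>R (pw (q/2) e * cstar u)"
      using e q by (simp add: cstar_scaleR cstar_mult)
    have "cstar (z y) * z y = (d * d) *\<^sub>R (u * (pw (q/2) e * pw (q/2) e) * cstar u)"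
      by (simp only: zu) (simp add: zy mult.assoc)
    then show ?thesis using q by (simp add: pw_add e pspan_scaleR pspan.gen)
  qed
  then show ?thesis unfolding sum by (rule pspan_sum_list)
qed

text \<open>For a generator, positivity of \<open>pw r e\<close> conjugated by
  \<open>cstar a - b\<close> bounds the mixed terms by the diagonal ones, which gives the list
  \<open>[cstar a, b]\<close>. Lists are concatenated for sums.\<close>

lemma pspan_dominated:
  assumes e: "positive_elem e" and r: "0 < r" and x: "x \<in> pspan e r"
  shows "\<exists>qs. positive_elem (sum_list (map (\<lambda>q. cstar q * pw r e * q) qs) - (x + cstar x))"
  using x
proof (induction rule: pspan.induct)
  case zero
  show ?case by (rule exI[of _ "[]"]) simp
next
  case (gen a b)
  have "positive_elem (cstar (cstar a - b) * pw r e * (cstar a - b))"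
    by (intro positive_conj positive_pw e r)
  moreover have "cstar (cstar a - b) * pw r e * (cstar a - b)
      = sum_list (map (\<lambda>q. cstar q * pw r e * q) [cstar a, b]) - (a * pw r e * b + cstar (a * pw r e * b))"
    using e r by (simp add: cstar_diff cstar_mult cstar_cstar algebra_simps)
  ultimately have "positive_elem (sum_list (map (\<lambda>q. cstar q * pw r e * q) [cstar a, b])
      - (a * pw r e * b + cstar (a * pw r e * b)))" by (simp only:)
  then show ?case by (rule exI)
next
  case (add x y)
  then obtain qs ps where "positive_elem (sum_list (map (\<lambda>q. cstar q * pw r e * q) qs) - (x + cstar x))"
    "positive_elem (sum_list (map (\<lambda>q. cstar q * pw r e * q) ps) - (y + cstar y))" by blast
  from positive_add[OF this] show ?case
    by (intro exI[of _ "qs @ ps"]) (simp add: cstar_add algebra_simps)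
qed

text \<open>\<open>b\<close> is dominated by a sum \<open>S\<close> to which
  \<open>pw_sum_in_pspan\<close> applies. Loewner-Heinz carries the domination over to
  \<open>pw s\<close>, and factorization then writes \<open>pw s b\<close> as a conjugate of a
  slightly smaller power of \<open>S\<close>.\<close>

lemma pw_in_pspan:
  assumes e: "positive_elem e" and r: "0 < r" and b: "positive_elem b" "b \<in> pspan e r"
    and s: "0 < s" "s < 1" and q: "0 < q" "q < s * r"
  shows "pw s b \<in> pspan e q"
proof -
  have bs: "cstar b = b" using b by (simp add: positive_elem_def self_adjoint_def)
  obtain ps where ps: "positive_elem (sum_list (map (\<lambda>p. cstar p * pw r e * p) ps) - (b + b))"
    using pspan_dominated[OF e r b(2)] bs by auto
  define ys where "ys = map (\<lambda>p. pw (r/2) e * p) ps"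
  define S where "S = sum_list (map (\<lambda>y. cstar y * y) ys)"
  have "cstar (pw (r/2) e * p) * (pw (r/2) e * p) = cstar p * pw r e * p" for p
  proof -
    have "cstar (pw (r/2) e * p) * (pw (r/2) e * p) = cstar p * (pw (r/2) e * pw (r/2) e) * p"
      using e r by (simp add: cstar_mult mult.assoc)
    then show ?thesis using r by (simp add: pw_add e)
  qed
  then have Seq: "S = sum_list (map (\<lambda>p. cstar p * pw r e * p) ps)"
    by (simp add: S_def ys_def o_def)
  have S: "positive_elem S" unfolding S_def by (intro positive_sum_list positive_cstar_mult)
  \<comment> \<open>\<open>S\<close> dominates \<open>b + b\<close>, hence also \<open>b\<close>,
    since \<open>b\<close> is positive.\<close>
  have bS: "positive_elem (S - b)" using positive_add[OF ps b(1)] by (simp add: Seq)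
  have "q / r < s" using q r by (simp add: divide_simps)
  \<comment> \<open>The room between \<open>q / r\<close> and \<open>s\<close> is spent twice:
    \<open>q < s1 * r\<close> for the power of \<open>S\<close>, and \<open>s1 < s\<close> for an
    exponent below \<open>1/2\<close> in the factorization.\<close>
  then obtain s1 where s1: "q / r < s1" "s1 < s" using dense by blast
  have "0 < q / r" using q r by simp
  then have s1': "0 < s1" using s1 by simp
  have S1: "pw s1 S \<in> pspan e q"
    unfolding S_def
  proof (rule pw_sum_in_pspan[OF e r s1'])
    show "s1 < 1" "0 < q" "q < s1 * r" using s1 s q r by (auto simp: divide_simps)
    fix y assume "y \<in> set ys"
    then obtain p where p: "y = pw (r/2) e * p" by (auto simp: ys_def)
    have "positive_elem (1 *\<^sub>R ((norm (p * cstar p)) *\<^sub>R 1 - p * cstar p))"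
      by (intro positive_scaleR positive_norm_minus) (auto simp: self_adjoint_def cstar_mult cstar_cstar)
    then have "positive_elem (cstar (pw (r/2) e) * ((norm (p * cstar p)) *\<^sub>R 1 - p * cstar p) * pw (r/2) e)"
      by (intro positive_conj) simp
    moreover have "cstar (pw (r/2) e) * ((norm (p * cstar p)) *\<^sub>R 1 - p * cstar p) * pw (r/2) e
        = norm (p * cstar p) *\<^sub>R (pw (r/2) e * pw (r/2) e) - y * cstar y"
      using e r by (simp add: p cstar_mult algebra_simps)
    ultimately show "\<exists>c\<ge>0. positive_elem (c *\<^sub>R pw r e - y * cstar y)"
      using r by (intro exI[of _ "norm (p * cstar p)"]) (simp add: pw_add e)
  qed
  define x where "x = pw (s/2) b"
  have xs: "cstar x = x" using b s by (simp add: x_def)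
  have xx: "x * x = pw s b" using b s by (simp add: x_def pw_add)
  have "positive_elem (pw s S - cstar x * x)"
    using Loewner_Heinz[OF b(1) bS s(1)] s by (simp add: xs xx)
  moreover have "0 < s1 / (2 * s)" "s1 / (2 * s) < 1/2" using s1 s1' s by (auto simp: divide_simps)
  ultimately obtain u where u: "u * pw (s1 / (2 * s)) (pw s S) = x"
    using factorization[OF positive_pw[OF S s(1)]] by metis
  have "pw (s1 / (2 * s)) (pw s S) = pw (s1/2) S"
    using pw_pw[OF S s(1) \<open>0 < s1 / (2 * s)\<close>] s by simp
  then have ux: "x = u * pw (s1/2) S" using u by simp
  then have "x = pw (s1/2) S * cstar u" using xs s1' S by (metis cstar_mult cstar_pw half_gt_zero)
  then have "x * x = u * (pw (s1/2) S * pw (s1/2) S) * cstar u" using ux by (metis mult.assoc)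
  then have "pw s b = u * pw s1 S * cstar u" using s1' by (simp add: xx pw_add S)
  then show ?thesis using pspan_mult[OF S1] by simp
qed

text \<open>Every element is a complex combination of elements \<open>cstar c * c\<close>, so a
  claim linear in \<open>w\<close> reduces to these.\<close>

lemma polarization:
  fixes w :: "'a::cstar_algebra_1"
  shows "4 *\<^sub>R w = (cstar (1 + w) * (1 + w) - cstar (1 - w) * (1 - w))
    + scaleC (- \<i>) (cstar (1 + scaleC \<i> w) * (1 + scaleC \<i> w) - cstar (1 - scaleC \<i> w) * (1 - scaleC \<i> w))"
proof -
  have 4: "4 *\<^sub>R w = (w + w) + (w + w)"
    by (simp flip: scaleR_2)
  show ?thesis unfolding 4
    by (simp add: cstar_add cstar_diff cstar_scaleC algebra_simps mult_scaleC_left mult_scaleC_right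
        scaleC_scaleC scaleC_add_right scaleC_diff_right)
qed

text \<open>For \<open>y = c e\<^sup>r\<close>, the element \<open>y\<^sup>* y\<close> lies in the ideal generated by any power \<open>(y y\<^sup>*)\<^sup>s\<close>
  with \<open>s < 1\<close>, while \<open>y y\<^sup>*\<close> contains the factor \<open>e\<^bsup>2r\<^esup>\<close>; the general case follows by
  polarization.\<close>
lemma pspan_product:
  assumes e: "positive_elem e" and r: "0 < r" and q: "0 < q" "q < 2 * r"
    and x: "x \<in> pspan e r" and y: "y \<in> pspan e r"
  shows "x * y \<in> pspan e q"
proof -
  let ?E = "pw r e"
  have sq: "?E * (cstar c * c) * ?E \<in> pspan e q" for c
  proof -
    define y where "y = c * ?E"
    have yy: "y * cstar y = c * pw (2 * r) e * cstar c"
      using e r by (simp add: y_def cstar_mult mult.assoc) (simp add: pw_add mult.assoc[symmetric] e)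
    have b: "positive_elem (y * cstar y)" using positive_cstar_mult[of "cstar y"] by (simp add: cstar_cstar)
    have "y * cstar y \<in> pspan e (2 * r)" unfolding yy by (rule pspan.gen)
    moreover have "q / (2 * r) < 1" using q r by (simp add: divide_simps)
    \<comment> \<open>\<open>s < 1\<close> permits the factorization through
      \<open>pw (s/2)\<close>, and \<open>q < s * (2 * r)\<close> is what \<open>pw_in_pspan\<close>
      requires.\<close>
    then obtain s where s: "q / (2 * r) < s" "s < 1" using dense by blast
    moreover have "0 < q / (2 * r)" using q r by simp
    then have s0: "0 < s" using s by simp
    ultimately have p: "pw s (y * cstar y) \<in> pspan e q"
      using r q by (intro pw_in_pspan[OF e _ b]) (auto simp: divide_simps mult.commute)
    obtain u where u: "u * pw (s/2) (y * cstar y) = cstar y"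
    proof (rule factorization[OF b])
      show "positive_elem (y * cstar y - cstar (cstar y) * cstar y)" by (simp add: cstar_cstar)
      show "0 < s/2" "s/2 < 1/2" using s s0 by auto
    qed
    then have "y = pw (s/2) (y * cstar y) * cstar u" using b s0 by (metis cstar_cstar cstar_mult cstar_pw half_gt_zero)
    then have "cstar y * y = u * (pw (s/2) (y * cstar y) * pw (s/2) (y * cstar y)) * cstar u"
      using u by (metis mult.assoc)
    then have "cstar y * y = u * pw s (y * cstar y) * cstar u" using s0 by (simp add: pw_add b)
    moreover have "?E * (cstar c * c) * ?E = cstar y * y" using e r by (simp add: y_def cstar_mult mult.assoc)
    ultimately show ?thesis using pspan_mult[OF p] by simp
  qed
  have core: "?E * w * ?E \<in> pspan e q" for w
  proof -
    have "?E * (4 *\<^sub>R w) * ?E = (?E * (cstar (1 + w) * (1 + w)) * ?E - ?E * (cstar (1 - w) * (1 - w)) * ?E)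
      + scaleC (- \<i>) (?E * (cstar (1 + scaleC \<i> w) * (1 + scaleC \<i> w)) * ?E
          - ?E * (cstar (1 - scaleC \<i> w) * (1 - scaleC \<i> w)) * ?E)"
      by (subst polarization)
        (simp only: distrib_left distrib_right left_diff_distrib right_diff_distrib mult_scaleC_left mult_scaleC_right)
    also have "\<dots> \<in> pspan e q" by (intro pspan.add pspan_diff pspan_scaleC sq)
    finally have "(1/4) *\<^sub>R (?E * (4 *\<^sub>R w) * ?E) \<in> pspan e q" by (rule pspan_scaleR)
    then show ?thesis by simp
  qed
  have gen: "x * (c * ?E * d) \<in> pspan e q" for c d
    using x
  proof (induction rule: pspan.induct)
    case (gen a b)
    show ?case using pspan_mult[OF core[of "b * c"], of a d] by (simp add: mult.assoc)
  qed (auto simp: distrib_right intro: pspan.intros)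
  show ?thesis using y
    by (induction rule: pspan.induct) (auto simp: distrib_left gen intro: pspan.intros)
qed

section \<open>The unitization\<close>

text \<open>A type of its own, because pairs already carry the square root of the sum of the squared
  norms, in general not a C*-norm.\<close>

datatype 'a unitization = Unitization (uelem: 'a) (uscal: complex)

lemma unitization_eqI: "uelem u = uelem v \<Longrightarrow> uscal u = uscal v \<Longrightarrow> u = v"
  by (rule unitization.expand) simp

instantiation unitization :: (cstar_algebra) ring_1
begin

definition "0 = Unitization 0 0"
definition "1 = Unitization 0 1"
definition "u + v = Unitization (uelem u + uelem v) (uscal u + uscal v)"
definition "- u = Unitization (- uelem u) (- uscal u)"
definition "u - v = Unitization (uelem u - uelem v) (uscal u - uscal v)"
definition "u * v = Unitization (uelem u * uelem v + scaleC (uscal u) (uelem v) + scaleC (uscal v) (uelem u))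
  (uscal u * uscal v)"

lemma unitization_sel [simp]:
  "uelem 0 = (0::'a)" "uscal (0::'a unitization) = 0" "uelem 1 = (0::'a)" "uscal (1::'a unitization) = 1"
  "uelem (u + v) = uelem u + uelem v" "uscal (u + v) = uscal u + uscal v"
  "uelem (- u) = - uelem u" "uscal (- u) = - uscal u"
  "uelem (u - v) = uelem u - uelem v" "uscal (u - v) = uscal u - uscal v"
  "uelem (u * v) = uelem u * uelem v + scaleC (uscal u) (uelem v) + scaleC (uscal v) (uelem u)"
  "uscal (u * v) = uscal u * uscal v"
  for u v :: "'a unitization"
  by (simp_all add: zero_unitization_def one_unitization_def plus_unitization_def
      uminus_unitization_def minus_unitization_def times_unitization_def)

instance
  by standard (auto intro!: unitization_eqI simp: algebra_simps scaleC_add_right scaleC_add_left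
      mult_scaleC_left mult_scaleC_right scaleC_scaleC zero_unitization_def one_unitization_def)

end

text \<open>Left multiplication by \<open>u\<close> on the original algebra, which is an ideal of
  the unitization.\<close>

definition unitization_op :: "'a::cstar_algebra unitization \<Rightarrow> 'a \<Rightarrow> 'a" where
  "unitization_op u y = uelem u * y + scaleC (uscal u) y"

lemma bounded_linear_unitization_op: "bounded_linear (unitization_op u)"
  unfolding unitization_op_def
  by (intro bounded_linear_add bounded_linear_mult_right bounded_linear_scaleC)

lemma unitization_op_mult: "unitization_op (u * v) = unitization_op u \<circ> unitization_op v"
  by (rule ext) (simp add: unitization_op_def algebra_simps scaleC_add_right scaleC_add_left
      mult_scaleC_left mult_scaleC_right scaleC_scaleC)

lemma unitization_op_add: "unitization_op (u + v) = (\<lambda>y. unitization_op u y + unitization_op v y)"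
  by (rule ext) (simp add: unitization_op_def algebra_simps scaleC_add_left)

text \<open>The operator norm of left multiplication by \<open>u\<close> on the algebra may vanish if the algebra
  already has a unit; the maximum with the norm of the scalar part is a norm in all cases.\<close>
instantiation unitization :: (cstar_algebra) real_normed_algebra_1
begin

definition "r *\<^sub>R u = Unitization (r *\<^sub>R uelem u) (of_real r * uscal u)"
definition "norm u = max (cmod (uscal u)) (onorm (unitization_op u))"
definition "dist u v = norm (u - v :: 'a unitization)"
definition "sgn u = inverse (norm u) *\<^sub>R (u :: 'a unitization)"
definition "uniformity = (INF e\<in>{0<..}. principal {(u, v :: 'a unitization). dist u v < e})"
definition "open U = (\<forall>u\<in>U. eventually (\<lambda>(u', v). u' = u \<longrightarrow> v \<in> U) (uniformity :: ('a unitization \<times> _) filter))"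

lemma unitization_sel_scaleR [simp]:
  "uelem (r *\<^sub>R u) = r *\<^sub>R uelem u" "uscal (r *\<^sub>R u) = of_real r * uscal u" for u :: "'a unitization"
  by (simp_all add: scaleR_unitization_def)

lemma unitization_op_scaleR: "unitization_op (r *\<^sub>R u) = (\<lambda>y. r *\<^sub>R unitization_op u y)" for u :: "'a unitization"
proof
  fix y :: 'a
  have "scaleC (complex_of_real r * uscal u) y = r *\<^sub>R scaleC (uscal u) y"
    by (metis scaleC_of_real scaleC_scaleC)
  then show "unitization_op (r *\<^sub>R u) y = r *\<^sub>R unitization_op u y"
    by (simp add: unitization_op_def scaleR_add_right)
qed

text \<open>The multiplication operator is tested on \<open>cstar x\<close>, where the C*-identity
  gives the square of the norm.\<close>

lemma norm_le_onorm_mult: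
  "norm x \<le> onorm (\<lambda>y. x * y)" for x :: 'a
proof (cases "x = 0")
  case False
  have "norm (x * cstar x) = (norm x)\<^sup>2" using cstar_identity[of "cstar x"] by (simp add: cstar_cstar)
  moreover have "norm (x * cstar x) \<le> onorm (\<lambda>y. x * y) * norm (cstar x)"
    by (rule onorm[OF bounded_linear_mult_right])
  ultimately have "norm x * norm x \<le> onorm (\<lambda>y. x * y) * norm x" by (simp add: power2_eq_square)
  then show ?thesis using False by simp
qed (simp add: onorm_pos_le bounded_linear_mult_right)

instance
proof
  fix a b :: real and u v w :: "'a unitization"
  show "a *\<^sub>R (u + v) = a *\<^sub>R u + a *\<^sub>R v" "(a + b) *\<^sub>R u = a *\<^sub>R u + b *\<^sub>R u"
    "a *\<^sub>R b *\<^sub>R u = (a * b) *\<^sub>R u" "1 *\<^sub>R u = u"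
    by (auto intro!: unitization_eqI simp: algebra_simps)
  show "a *\<^sub>R u * v = a *\<^sub>R (u * v)" "u * a *\<^sub>R v = a *\<^sub>R (u * v)"
    by (auto intro!: unitization_eqI simp: algebra_simps scaleC_scaleR scaleC_scaleC[symmetric] scaleC_of_real
        simp flip: scaleC_scaleC)
  show "dist u v = norm (u - v)" by (simp add: dist_unitization_def)
  show "sgn u = inverse (norm u) *\<^sub>R u" by (simp add: sgn_unitization_def)
  show "uniformity = (INF e\<in>{0<..}. principal {(u, v :: 'a unitization). dist u v < e})"
    by (simp add: uniformity_unitization_def)
  show "open U \<longleftrightarrow> (\<forall>u\<in>U. \<forall>\<^sub>F (u', v) in uniformity. u' = u \<longrightarrow> v \<in> U)" for U :: "'a unitization set"
    by (simp add: open_unitization_def)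
  show "norm u = 0 \<longleftrightarrow> u = 0"
  proof
    assume "norm u = 0"
    then have s: "cmod (uscal u) \<le> 0" "onorm (unitization_op u) \<le> 0"
      unfolding norm_unitization_def by (metis max.cobounded1, metis max.cobounded2)
    then have "uscal u = 0" by simp
    then have "unitization_op u = (\<lambda>y. uelem u * y)" by (simp add: unitization_op_def fun_eq_iff)
    then have "norm (uelem u) \<le> 0" using order_trans[OF norm_le_onorm_mult[of "uelem u"]] s(2) by metis
    then show "u = 0" using s(1) by (intro unitization_eqI) auto
  next
    assume "u = 0"
    then have "unitization_op u = (\<lambda>y. 0)" by (simp add: unitization_op_def fun_eq_iff)
    then show "norm u = 0" using \<open>u = 0\<close> by (simp add: norm_unitization_def onorm_zero)
  qed
  show "norm (u + v) \<le> norm u + norm v"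
  proof -
    have "onorm (unitization_op (u + v)) \<le> onorm (unitization_op u) + onorm (unitization_op v)"
      unfolding unitization_op_add by (intro onorm_triangle bounded_linear_unitization_op)
    moreover have "cmod (uscal (u + v)) \<le> cmod (uscal u) + cmod (uscal v)" by (simp add: norm_triangle_ineq)
    ultimately show ?thesis unfolding norm_unitization_def by linarith
  qed
  show "norm (a *\<^sub>R u) = \<bar>a\<bar> * norm u"
    unfolding norm_unitization_def unitization_op_scaleR
    by (simp add: onorm_scaleR bounded_linear_unitization_op norm_mult max_mult_distrib_left)
  show "norm (u * v) \<le> norm u * norm v"
  proof -
    have "onorm (unitization_op (u * v)) \<le> onorm (unitization_op u) * onorm (unitization_op v)"
      unfolding unitization_op_mult by (intro onorm_compose bounded_linear_unitization_op)
    also have "\<dots> \<le> norm u * norm v"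
      unfolding norm_unitization_def
      by (intro mult_mono) (auto simp: onorm_pos_le bounded_linear_unitization_op le_max_iff_disj)
    finally have "onorm (unitization_op (u * v)) \<le> norm u * norm v" .
    moreover have "cmod (uscal (u * v)) \<le> norm u * norm v"
      unfolding norm_unitization_def by (simp add: norm_mult, intro mult_mono) (auto simp: le_max_iff_disj)
    ultimately show ?thesis by (simp add: norm_unitization_def[of "u * v"])
  qed
  have "onorm (unitization_op (1 :: 'a unitization)) \<le> 1"
    by (rule onorm_bound) (simp_all add: unitization_op_def)
  then show "norm (1 :: 'a unitization) = 1" by (simp add: norm_unitization_def)
qed

end

lemma cmod_uscal_le: "cmod (uscal u) \<le> norm u"
  by (simp add: norm_unitization_def)

lemma onorm_unitization_op_le: "onorm (unitization_op u) \<le> norm u"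
  by (simp add: norm_unitization_def)

lemma norm_unitization_le: "norm u \<le> norm (uelem u) + cmod (uscal u)"
proof -
  have "norm (unitization_op u y) \<le> (norm (uelem u) + cmod (uscal u)) * norm y" for y
    unfolding unitization_op_def
    by (rule order_trans[OF norm_triangle_ineq])
      (simp add: norm_scaleC distrib_right norm_mult_ineq)
  then have "onorm (unitization_op u) \<le> norm (uelem u) + cmod (uscal u)" by (intro onorm_bound) auto
  then show ?thesis by (simp add: norm_unitization_def)
qed

text \<open>Together with \<open>cmod_uscal_le\<close> and \<open>norm_unitization_le\<close> this
  makes the norm equivalent to the sum of the component norms, so completeness can be checked
  componentwise.\<close>

lemma norm_uelem_le: "norm (uelem u) \<le> 2 * norm u"
proof -
  have "norm (uelem u) \<le> onorm (\<lambda>y. uelem u * y)" by (rule norm_le_onorm_mult)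
  also have "\<dots> \<le> norm u + cmod (uscal u)"
  proof (rule onorm_bound)
    show "0 \<le> norm u + cmod (uscal u)" by simp
    fix y
    have "norm (uelem u * y) = norm (unitization_op u y - scaleC (uscal u) y)" by (simp add: unitization_op_def)
    also have "\<dots> \<le> norm (unitization_op u y) + norm (scaleC (uscal u) y)" by (rule norm_triangle_ineq4)
    also have "norm (unitization_op u y) \<le> onorm (unitization_op u) * norm y"
      by (rule onorm[OF bounded_linear_unitization_op])
    also have "onorm (unitization_op u) * norm y \<le> norm u * norm y"
      by (intro mult_right_mono onorm_unitization_op_le) simp
    finally show "norm (uelem u * y) \<le> (norm u + cmod (uscal u)) * norm y"
      by (simp add: norm_scaleC distrib_right)
  qed
  finally show ?thesis using cmod_uscal_le[of u] by simp
qed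

instantiation unitization :: (cstar_algebra) cstar_algebra_1
begin

definition "scaleC c u = Unitization (scaleC c (uelem u)) (c * uscal u)"
definition "cstar u = Unitization (cstar (uelem u)) (cnj (uscal u))"

lemma unitization_sel_scaleC [simp]:
  "uelem (scaleC c u) = scaleC c (uelem u)" "uscal (scaleC c u) = c * uscal u"
  "uelem (cstar u) = cstar (uelem u)" "uscal (cstar u) = cnj (uscal u)" for u :: "'a unitization"
  by (simp_all add: scaleC_unitization_def cstar_unitization_def)

instance
proof
  fix u v :: "'a unitization" and c d :: complex and r :: real
  show "scaleC c (u + v) = scaleC c u + scaleC c v" "scaleC (c + d) u = scaleC c u + scaleC d u"
    "scaleC c (scaleC d u) = scaleC (c * d) u" "scaleC (complex_of_real r) u = r *\<^sub>R u"
    "scaleC c u * v = scaleC c (u * v)" "u * scaleC c v = scaleC c (u * v)"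
    "cstar (u + v) = cstar u + cstar v" "cstar (scaleC c u) = scaleC (cnj c) (cstar u)"
    "cstar (cstar u) = u"
    by (auto intro!: unitization_eqI simp: scaleC_add_right scaleC_add_left scaleC_scaleC scaleC_of_real
        mult_scaleC_left mult_scaleC_right cstar_add cstar_scaleC cstar_cstar algebra_simps)
  show mult: "cstar (u * v) = cstar v * cstar u" for u v :: "'a unitization"
    by (auto intro!: unitization_eqI simp: cstar_add cstar_scaleC cstar_mult)
  show "norm (scaleC c u) = cmod c * norm u"
  proof -
    have "unitization_op (scaleC c u) = (\<lambda>y. scaleC c (unitization_op u y))"
      by (rule ext) (simp add: unitization_op_def scaleC_add_right mult_scaleC_left scaleC_scaleC)
    moreover have "onorm (\<lambda>y. scaleC c (unitization_op u y)) = cmod c * onorm (unitization_op u)"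
    proof -
      have "onorm (\<lambda>y. scaleC c (unitization_op u y)) = onorm (\<lambda>y. cmod c *\<^sub>R unitization_op u y)"
        unfolding onorm_def by (simp add: norm_scaleC)
      then show ?thesis by (simp add: onorm_scaleR bounded_linear_unitization_op)
    qed
    ultimately show ?thesis by (simp add: norm_unitization_def norm_mult max_mult_distrib_left)
  qed
  have sq: "(norm u)\<^sup>2 \<le> norm (cstar u * u)" for u :: "'a unitization"
  proof -
    let ?K = "onorm (unitization_op (cstar u * u))"
    have K: "0 \<le> ?K" by (intro onorm_pos_le bounded_linear_unitization_op)
    have "onorm (unitization_op u) \<le> sqrt ?K"
    proof (rule onorm_bound)
      show "0 \<le> sqrt ?K" using K by simp
      fix y
      \<comment> \<open>Both sides lie in the original algebra, whose C*-identity now bounds the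
        operator norm of \<open>u\<close> by that of \<open>cstar u * u\<close>.\<close>
      have "cstar (unitization_op u y) * unitization_op u y = cstar y * unitization_op (cstar u * u) y"
        by (simp add: unitization_op_def cstar_add cstar_mult cstar_scaleC algebra_simps
            scaleC_add_right mult_scaleC_left mult_scaleC_right scaleC_scaleC)
      then have "(norm (unitization_op u y))\<^sup>2 = norm (cstar y * unitization_op (cstar u * u) y)"
        by (metis cstar_identity)
      also have "\<dots> \<le> norm y * norm (unitization_op (cstar u * u) y)"
        using norm_mult_ineq[of "cstar y"] by simp
      also have "\<dots> \<le> norm y * (?K * norm y)"
        by (intro mult_left_mono onorm[OF bounded_linear_unitization_op]) simp
      also have "\<dots> = (sqrt ?K * norm y)\<^sup>2" using K by (simp add: power_mult_distrib power2_eq_square)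
      finally show "norm (unitization_op u y) \<le> sqrt ?K * norm y"
        by (rule power2_le_imp_le) (use K in simp)
    qed
    then have "(onorm (unitization_op u))\<^sup>2 \<le> (sqrt ?K)\<^sup>2"
      by (intro power_mono onorm_pos_le bounded_linear_unitization_op)
    then have 1: "(onorm (unitization_op u))\<^sup>2 \<le> norm (cstar u * u)"
      using K onorm_unitization_op_le[of "cstar u * u"] by simp
    have "(cmod (uscal u))\<^sup>2 = cmod (uscal (cstar u * u))" by (simp add: norm_mult power2_eq_square)
    then have "(cmod (uscal u))\<^sup>2 \<le> norm (cstar u * u)" using cmod_uscal_le[of "cstar u * u"] by simp
    with 1 show ?thesis by (simp add: norm_unitization_def[of u] max_def)
  qed
  have le: "norm u \<le> norm (cstar u)" for u :: "'a unitization"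
  proof (cases "u = 0")
    case False
    have "norm u * norm u \<le> norm (cstar u) * norm u"
      using sq[of u] norm_mult_ineq[of "cstar u" u] by (simp add: power2_eq_square)
    then show ?thesis using False by simp
  qed simp
  have "cstar (cstar u) = u" by (auto intro!: unitization_eqI simp: cstar_cstar)
  then have "norm (cstar u) = norm u" using le[of u] le[of "cstar u"] by simp
  then have "norm (cstar u * u) \<le> (norm u)\<^sup>2"
    using norm_mult_ineq[of "cstar u" u] by (simp add: power2_eq_square)
  then show "norm (cstar u * u) = (norm u)\<^sup>2" using sq[of u] by simp
  fix X :: "nat \<Rightarrow> 'a unitization"
  assume X: "Cauchy X"
  have "Cauchy (\<lambda>n. uelem (X n))"
  proof (rule CauchyI)
    fix e :: real assume "e > 0"
    then obtain N where N: "\<And>m n. m \<ge> N \<Longrightarrow> n \<ge> N \<Longrightarrow> norm (X m - X n) < e / 2"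
      using CauchyD[OF X, of "e / 2"] by auto
    have "norm (uelem (X m) - uelem (X n)) < e" if "m \<ge> N" "n \<ge> N" for m n
      using norm_uelem_le[of "X m - X n"] N[OF that] by simp
    then show "\<exists>N. \<forall>m\<ge>N. \<forall>n\<ge>N. norm (uelem (X m) - uelem (X n)) < e" by blast
  qed
  then obtain x where x: "(\<lambda>n. uelem (X n)) \<longlonglongrightarrow> x" using Cauchy_convergent convergent_def by blast
  have "Cauchy (\<lambda>n. uscal (X n))"
  proof (rule CauchyI)
    fix e :: real assume "e > 0"
    then obtain N where N: "\<And>m n. m \<ge> N \<Longrightarrow> n \<ge> N \<Longrightarrow> norm (X m - X n) < e"
      using CauchyD[OF X, of e] by auto
    have "norm (uscal (X m) - uscal (X n)) < e" if "m \<ge> N" "n \<ge> N" for m n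
      using cmod_uscal_le[of "X m - X n"] N[OF that] by simp
    then show "\<exists>N. \<forall>m\<ge>N. \<forall>n\<ge>N. norm (uscal (X m) - uscal (X n)) < e" by blast
  qed
  then obtain s where s: "(\<lambda>n. uscal (X n)) \<longlonglongrightarrow> s" using Cauchy_convergent convergent_def by blast
  have "(\<lambda>n. norm (uelem (X n) - x) + norm (uscal (X n) - s)) \<longlonglongrightarrow> 0 + 0"
    by (intro tendsto_add tendsto_norm_zero LIM_zero x s)
  then have lim: "(\<lambda>n. norm (uelem (X n) - x) + norm (uscal (X n) - s)) \<longlonglongrightarrow> 0" by simp
  have "norm (X n - Unitization x s) \<le> norm (uelem (X n) - x) + norm (uscal (X n) - s)" for n
    using norm_unitization_le[of "X n - Unitization x s"] by simp
  then have "(\<lambda>n. X n - Unitization x s) \<longlonglongrightarrow> 0"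
    by (intro Lim_null_comparison[OF always_eventually lim] allI)
  then have "X \<longlonglongrightarrow> Unitization x s" by (rule LIM_zero_cancel)
  then show "convergent X" unfolding convergent_def by (rule exI)
qed

end

section \<open>Transfer of positivity and roots between the algebra and its unitization\<close>

definition incl :: "'a::cstar_algebra \<Rightarrow> 'a unitization" where
  "incl x = Unitization x 0"

lemma incl_sel [simp]: "uelem (incl x) = x" "uscal (incl x) = 0"
  by (simp_all add: incl_def)

lemma incl_uelem: "uscal u = 0 \<Longrightarrow> incl (uelem u) = u"
  by (rule unitization_eqI) simp_all

lemma incl_inject: "incl x = incl y \<Longrightarrow> x = y"
  by (metis incl_sel(1))

lemma incl_simps:
  "incl 0 = 0" "incl (x + y) = incl x + incl y" "incl (- x) = - incl x"
  "incl (x * y) = incl x * incl y" "incl (cstar x) = cstar (incl x)"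
  by (auto intro!: unitization_eqI)

lemma incl_sum_list: "incl (sum_list (map f xs)) = sum_list (map (\<lambda>x. incl (f x)) xs)"
  by (induction xs) (simp_all add: incl_simps)

lemma unit_elem_unitization_iff:
  "unit_elem (Unitization b l) \<longleftrightarrow>
    (\<exists>u. unitization_mult u (b, l) = (0, 1) \<and> unitization_mult (b, l) u = (0, 1))"
proof
  assume "unit_elem (Unitization b l)"
  then obtain v where v: "Unitization b l * v = 1" "v * Unitization b l = 1" by (auto simp: unit_elem_def)
  have "unitization_mult (uelem v, uscal v) (b, l) = (0, 1)" "unitization_mult (b, l) (uelem v, uscal v) = (0, 1)"
    using arg_cong[OF v(1), of uelem] arg_cong[OF v(1), of uscal] arg_cong[OF v(2), of uelem] arg_cong[OF v(2), of uscal]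
    by (simp_all add: unitization_mult_def)
  then show "\<exists>u. unitization_mult u (b, l) = (0, 1) \<and> unitization_mult (b, l) u = (0, 1)" by blast
next
  assume "\<exists>u. unitization_mult u (b, l) = (0, 1) \<and> unitization_mult (b, l) u = (0, 1)"
  then obtain y s where "unitization_mult (y, s) (b, l) = (0, 1)" "unitization_mult (b, l) (y, s) = (0, 1)" by auto
  then show "unit_elem (Unitization b l)"
    unfolding unit_elem_def
    by (intro exI[of _ "Unitization y s"]) (auto intro!: unitization_eqI simp: unitization_mult_def)
qed

lemma cstar_spectrum_iff: "l \<in> cstar_spectrum a \<longleftrightarrow> \<not> unit_elem (scaleC l 1 - incl a)"
proof -
  have "scaleC l 1 - incl a = Unitization (- a) l" by (rule unitization_eqI) simp_all
  then show ?thesis by (simp add: cstar_spectrum_def unit_elem_unitization_iff)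
qed

lemma cstar_positives_iff: "a \<in> cstar_positives \<longleftrightarrow> positive_elem (incl a)"
proof
  assume a: "a \<in> cstar_positives"
  have "0 \<le> t" if "t \<in> rspec (incl a)" for t
  proof -
    have "complex_of_real t \<in> cstar_spectrum a"
      using that by (simp add: cstar_spectrum_iff rspec_def scaleC_of_real)
    then show ?thesis using a by (force simp: cstar_positives_def)
  qed
  then show "positive_elem (incl a)"
    using a by (simp add: positive_elem_def self_adjoint_def cstar_positives_def flip: incl_simps)
next
  assume a: "positive_elem (incl a)"
  then have sa: "self_adjoint (incl a)" by (rule positive_self_adjoint)
  have "l \<in> \<real> \<and> 0 \<le> Re l" if l: "l \<in> cstar_spectrum a" for l
  proof -
    have "Im l = 0" using l unit_elem_nonreal[OF sa] by (auto simp: cstar_spectrum_iff)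
    then have lr: "l = of_real (Re l)" by (simp add: complex_eq_iff)
    then have "Re l \<in> rspec (incl a)"
      using l by (metis cstar_spectrum_iff mem_Collect_eq rspec_def scaleC_of_real)
    then have "0 \<le> Re l" using a by (simp add: positive_elem_def)
    then show ?thesis using lr by (metis Reals_of_real)
  qed
  moreover have "cstar a = a" using sa by (simp add: self_adjoint_def incl_inject flip: incl_simps)
  ultimately show "a \<in> cstar_positives" by (simp add: cstar_positives_def)
qed

lemma uscal_rpoly_incl: "uscal (rpoly p (incl a)) = complex_of_real (poly p 0)"
  by (induction p) simp_all

text \<open>\<open>uscal\<close> is a continuous character vanishing on \<open>incl a\<close>, so it
  sends \<open>f\<close> of \<open>incl a\<close> to \<open>f 0\<close>. Functions with
  \<open>f 0 = 0\<close> therefore stay in the original algebra.\<close>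

lemma uscal_fc_incl:
  assumes a: "self_adjoint (incl a)" and f: "continuous_on (rspec (incl a)) f"
  shows "uscal (fc f (incl a)) = complex_of_real (f 0)"
proof -
  \<comment> \<open>Such a product has scalar part zero. Hence zero is in the spectrum, and the
    uniform limit may be evaluated there.\<close>
  have "v \<noteq> 1" if "v = (0 *\<^sub>R 1 - incl a) * w" for v w :: "'a unitization"
    using that by (metis diff_zero incl_sel(2) minus_diff_eq mult_zero_left neg_equal_0_iff_equal scaleR_zero_left
        unitization_sel(12,4,8) diff_0 zero_neq_one)
  then have 0: "0 \<in> rspec (incl a)" unfolding rspec_def unit_elem_def by blast
  obtain P where P: "uniform_limit (rspec (incl a)) (\<lambda>n. poly (P n)) f sequentially"
    using uniform_limit_poly[OF compact_rspec f] by blast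
  have "bounded_linear (uscal :: 'a unitization \<Rightarrow> complex)"
    by (rule bounded_linear_intro[of _ 1]) (simp_all add: cmod_uscal_le scaleR_conv_of_real[where 'a = complex])
  then have "(\<lambda>n. uscal (rpoly (P n) (incl a))) \<longlonglongrightarrow> uscal (fc f (incl a))"
    using tendsto_rpoly_fc[OF a f P] by (rule bounded_linear.tendsto)
  moreover have "(\<lambda>n. complex_of_real (poly (P n) 0)) \<longlonglongrightarrow> complex_of_real (f 0)"
    by (intro tendsto_of_real tendsto_uniform_limitI[OF P 0])
  ultimately show ?thesis by (simp add: uscal_rpoly_incl LIMSEQ_unique)
qed

definition root_pw :: "real \<Rightarrow> 'a::cstar_algebra \<Rightarrow> 'a" where
  "root_pw s a = uelem (pw s (incl a))"

lemma uscal_pw_incl: "positive_elem (incl a) \<Longrightarrow> 0 < s \<Longrightarrow> uscal (pw s (incl a)) = 0"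
  unfolding pw_def by (subst uscal_fc_incl) (auto intro: continuous_on_powr_positive positive_self_adjoint)

lemma incl_root_pw: "positive_elem (incl a) \<Longrightarrow> 0 < s \<Longrightarrow> incl (root_pw s a) = pw s (incl a)"
  by (simp add: root_pw_def incl_uelem uscal_pw_incl)

lemma root_pw_add:
  "positive_elem (incl a) \<Longrightarrow> 0 < s \<Longrightarrow> 0 < r \<Longrightarrow> root_pw s a * root_pw r a = root_pw (s + r) a"
  by (rule incl_inject) (simp add: incl_simps incl_root_pw pw_add)

lemma pw_power: "positive_elem a \<Longrightarrow> 0 < s \<Longrightarrow> pw s a ^ Suc n = pw (real (Suc n) * s) a"
  by (induction n) (simp_all add: pw_add algebra_simps add_pos_nonneg)

lemma incl_list_product: "xs \<noteq> [] \<Longrightarrow> incl (list_product xs) = prod_list (map incl xs)"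
  by (induction xs rule: list_product.induct) (simp_all add: incl_simps)

lemma list_product_append:
  "xs \<noteq> [] \<Longrightarrow> ys \<noteq> [] \<Longrightarrow> list_product (xs @ ys) = list_product xs * list_product ys"
  by (rule incl_inject) (simp add: incl_list_product incl_simps)

lemma incl_list_product_replicate:
  assumes "n \<ge> 1" shows "incl (list_product (replicate n b)) = incl b ^ n"
proof -
  have "prod_list (replicate n (incl b)) = incl b ^ n" by (induction n) simp_all
  then show ?thesis using assms by (simp add: incl_list_product)
qed

lemma cstar_nth_root_eq:
  assumes a: "positive_elem (incl a)" and n: "n \<ge> 1"
  shows "cstar_nth_root n a = root_pw (1 / real n) a"
  unfolding cstar_nth_root_def
proof (rule the_equality)
  obtain m where m: "n = Suc m" using n by (cases n) auto
  have n0: "0 < 1 / real n" using n by simp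
  have "pw (1 / real n) (incl a) ^ n = pw (real n * (1 / real n)) (incl a)"
    using pw_power[OF a n0, of m] by (simp only: m)
  also have "\<dots> = incl a" using n a by (simp add: pw_1)
  finally have "incl (list_product (replicate n (root_pw (1 / real n) a))) = incl a"
    using n by (simp only: incl_list_product_replicate incl_root_pw[OF a n0])
  then have "list_product (replicate n (root_pw (1 / real n) a)) = a" by (rule incl_inject)
  then show "root_pw (1 / real n) a \<in> cstar_positives
      \<and> list_product (replicate n (root_pw (1 / real n) a)) = a"
    using positive_pw[OF a n0] by (simp only: cstar_positives_iff incl_root_pw[OF a n0] simp_thms)
  \<comment> \<open>Uniqueness of the root: applying \<open>pw (1 / real n)\<close> to
    \<open>a\<close>, which is \<open>pw (real n)\<close> of \<open>b\<close>, returns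
    \<open>b\<close>.\<close>
  fix b assume "b \<in> cstar_positives \<and> list_product (replicate n b) = a"
  then have b: "positive_elem (incl b)" and eq: "incl a = incl b ^ n"
    using incl_list_product_replicate[OF n, of b] by (auto simp: cstar_positives_iff)
  have bn: "incl b ^ n = pw (real n) (incl b)"
    using pw_power[OF b zero_less_one, of m] by (simp only: m pw_1[OF b] mult_1_right)
  have "0 < real n" using n by simp
  then have "pw (1 / real n) (incl a) = pw (real n * (1 / real n)) (incl b)"
    unfolding eq bn by (rule pw_pw[OF b _ n0])
  also have "real n * (1 / real n) = 1" using n by simp
  also have "pw 1 (incl b) = incl b" by (rule pw_1[OF b])
  finally have "incl b = incl (root_pw (1 / real n) a)" by (simp only: incl_root_pw[OF a n0])
  then show "b = root_pw (1 / real n) a" by (rule incl_inject)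
qed

section \<open>Ideals\<close>

lemma cstar_idealD:
  assumes "cstar_ideal I"
  shows "0 \<in> I" "x \<in> I \<Longrightarrow> y \<in> I \<Longrightarrow> x + y \<in> I" "x \<in> I \<Longrightarrow> - x \<in> I"
    "x \<in> I \<Longrightarrow> a * x \<in> I" "x \<in> I \<Longrightarrow> x * a \<in> I"
  using assms by (auto simp: cstar_ideal_def additive_subgroup_set_def)

lemma additive_subgroup_hull: "additive_subgroup_set (additive_subgroup_set hull S)"
  by (rule hull_in) (fastforce simp: additive_subgroup_set_def)

lemma ideal_power_gen: "length xs = n \<Longrightarrow> set xs \<subseteq> I \<Longrightarrow> list_product xs \<in> ideal_power I n"
  unfolding ideal_power_def by (rule hull_inc) blast

lemma ideal_power_induct:
  assumes "x \<in> ideal_power I n" "additive_subgroup_set H"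
    "\<And>xs. length xs = n \<Longrightarrow> set xs \<subseteq> I \<Longrightarrow> list_product xs \<in> H"
  shows "x \<in> H"
proof -
  have "{list_product xs |xs. length xs = n \<and> set xs \<subseteq> I} \<subseteq> H" using assms(3) by blast
  then have "ideal_power I n \<subseteq> H" unfolding ideal_power_def using assms(2) by (rule hull_minimal)
  then show ?thesis using assms(1) by blast
qed

lemma ideal_power_subgroup: "additive_subgroup_set (ideal_power I n)"
  unfolding ideal_power_def by (rule additive_subgroup_hull)

lemma ideal_power_mono: "I \<subseteq> K \<Longrightarrow> ideal_power I n \<subseteq> ideal_power K n"
  unfolding ideal_power_def by (rule hull_mono) blast

lemma ideal_power_one:
  assumes "cstar_ideal I" shows "ideal_power I 1 = I"
proof
  show "ideal_power I 1 \<subseteq> I"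
  proof
    fix x assume "x \<in> ideal_power I 1"
    then show "x \<in> I"
      by (rule ideal_power_induct) (use assms in \<open>auto simp: cstar_ideal_def length_Suc_conv\<close>)
  qed
  show "I \<subseteq> ideal_power I 1" using ideal_power_gen[of "[_]" 1 I] by auto
qed

lemma cstar_ideal_power:
  assumes I: "cstar_ideal I" and n: "n \<ge> 1"
  shows "cstar_ideal (ideal_power I n)"
  unfolding cstar_ideal_def
proof (intro conjI allI ballI)
  show sub: "additive_subgroup_set (ideal_power I n)" by (rule ideal_power_subgroup)
  fix a x assume x: "x \<in> ideal_power I n"
  show "a * x \<in> ideal_power I n"
  proof -
    have "x \<in> {x. a * x \<in> ideal_power I n}"
      using x
    proof (rule ideal_power_induct)
      show "additive_subgroup_set {x. a * x \<in> ideal_power I n}"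
        using sub by (auto simp: additive_subgroup_set_def distrib_left)
      fix xs assume xs: "length xs = n" "set xs \<subseteq> I"
      then obtain y ys where ys: "xs = y # ys" using n by (cases xs) auto
      have "a * list_product xs = list_product ((a * y) # ys)"
        by (cases ys) (simp_all add: ys mult.assoc)
      moreover have "list_product ((a * y) # ys) \<in> ideal_power I n"
        using xs cstar_idealD(4)[OF I] by (intro ideal_power_gen) (auto simp: ys)
      ultimately show "list_product xs \<in> {x. a * x \<in> ideal_power I n}" by simp
    qed
    then show ?thesis by simp
  qed
  show "x * a \<in> ideal_power I n"
  proof -
    have "x \<in> {x. x * a \<in> ideal_power I n}"
      using x
    proof (rule ideal_power_induct)
      show "additive_subgroup_set {x. x * a \<in> ideal_power I n}"
        using sub by (auto simp: additive_subgroup_set_def distrib_right)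
      fix xs assume xs: "length xs = n" "set xs \<subseteq> I"
      then obtain y ys where ys: "xs = ys @ [y]" using n by (cases xs rule: rev_cases) auto
      have "list_product xs * a = list_product (ys @ [y * a])"
        by (cases "ys = []") (simp_all add: ys list_product_append mult.assoc)
      moreover have "list_product (ys @ [y * a]) \<in> ideal_power I n"
        using xs cstar_idealD(5)[OF I] by (intro ideal_power_gen) (auto simp: ys)
      ultimately show "list_product xs \<in> {x. x * a \<in> ideal_power I n}" by simp
    qed
    then show ?thesis by simp
  qed
qed

text \<open>Only finitely many factors occur in an element of the power; this allows a single
  positive element to dominate all of them.\<close>

lemma ideal_power_finite:
  assumes "x \<in> ideal_power I n"
  obtains zs where "set zs \<subseteq> I" "x \<in> ideal_power (set zs) n"
proof -
  have "x \<in> {x. \<exists>zs. set zs \<subseteq> I \<and> x \<in> ideal_power (set zs) n}"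
    using assms
  proof (rule ideal_power_induct)
    show "additive_subgroup_set {x. \<exists>zs. set zs \<subseteq> I \<and> x \<in> ideal_power (set zs) n}"
      unfolding additive_subgroup_set_def
    proof (intro conjI ballI)
      have "0 \<in> ideal_power (set []) n" using ideal_power_subgroup by (auto simp: additive_subgroup_set_def)
      then show "0 \<in> {x. \<exists>zs. set zs \<subseteq> I \<and> x \<in> ideal_power (set zs) n}" by (intro CollectI exI[of _ "[]"]) simp
      fix x assume "x \<in> {x. \<exists>zs. set zs \<subseteq> I \<and> x \<in> ideal_power (set zs) n}"
      then obtain zs where zs: "set zs \<subseteq> I" "x \<in> ideal_power (set zs) n" by blast
      then show "- x \<in> {x. \<exists>zs. set zs \<subseteq> I \<and> x \<in> ideal_power (set zs) n}"
        using ideal_power_subgroup[of "set zs" n] by (auto simp: additive_subgroup_set_def)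
      fix y assume "y \<in> {x. \<exists>zs. set zs \<subseteq> I \<and> x \<in> ideal_power (set zs) n}"
      then obtain ws where ws: "set ws \<subseteq> I" "y \<in> ideal_power (set ws) n" by blast
      have "x \<in> ideal_power (set (zs @ ws)) n" "y \<in> ideal_power (set (zs @ ws)) n"
        using zs(2) ws(2) ideal_power_mono[of "set zs" "set (zs @ ws)" n] ideal_power_mono[of "set ws" "set (zs @ ws)" n]
        by auto
      then have "x + y \<in> ideal_power (set (zs @ ws)) n"
        using ideal_power_subgroup[of "set (zs @ ws)" n] by (simp add: additive_subgroup_set_def)
      then show "x + y \<in> {x. \<exists>zs. set zs \<subseteq> I \<and> x \<in> ideal_power (set zs) n}"
        using zs(1) ws(1) by (intro CollectI exI[of _ "zs @ ws"]) simp
    qed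
    fix xs assume "length xs = n" "set xs \<subseteq> I"
    then show "list_product xs \<in> {x. \<exists>zs. set zs \<subseteq> I \<and> x \<in> ideal_power (set zs) n}"
      using ideal_power_gen[of xs n "set xs"] by blast
  qed
  then show ?thesis using that by blast
qed

text \<open>Coefficients in \<open>pspan\<close> come from the unitization, where \<open>I\<close>
  need not absorb them without a cushion. Since \<open>r > 1\<close>, the power splits as
  \<open>e\<close> between two copies of \<open>pw s (incl e)\<close>, and these pull the
  coefficients into the original algebra.\<close>

lemma pspan_in_ideal:
  assumes I: "cstar_ideal I" "e \<in> I" and e: "positive_elem (incl e)" and r: "1 < r"
    and x: "incl x \<in> pspan (incl e) r"
  shows "x \<in> I"
proof -
  have "uelem u \<in> I" if "u \<in> pspan (incl e) r" for u
    using that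
  proof (induction rule: pspan.induct)
    case (gen a b)
    define s where "s = (r - 1) / 2"
    have s: "0 < s" using r by (simp add: s_def)
    have "pw s (incl e) * incl e * pw s (incl e) = pw s (incl e) * pw 1 (incl e) * pw s (incl e)"
      by (simp add: pw_1 e)
    also have "\<dots> = pw (s + 1 + s) (incl e)" using s e by (simp add: pw_add)
    also have "s + 1 + s = r" by (simp add: s_def)
    finally have eq: "pw s (incl e) * incl e * pw s (incl e) = pw r (incl e)" .
    define p where "p = uelem (a * pw s (incl e))"
    define q where "q = uelem (pw s (incl e) * b)"
    have p: "incl p = a * pw s (incl e)" unfolding p_def
      by (rule incl_uelem) (simp add: uscal_pw_incl[OF e s])
    have q: "incl q = pw s (incl e) * b" unfolding q_def
      by (rule incl_uelem) (simp add: uscal_pw_incl[OF e s])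
    have "a * pw r (incl e) * b = (a * pw s (incl e)) * incl e * (pw s (incl e) * b)"
      by (simp add: mult.assoc flip: eq)
    also have "\<dots> = incl p * incl e * incl q"
      by (simp only: p q)
    finally have "uelem (a * pw r (incl e) * b) = p * e * q"
      by (metis incl_simps(4) incl_sel(1))
    then show ?case using cstar_idealD(4,5)[OF I(1)] I(2) by simp
  qed (use cstar_idealD[OF I(1)] in auto)
  from this[OF x] show ?thesis by simp
qed

lemma positive_incl_square: "positive_elem (incl (cstar x * x))" "positive_elem (incl (x * cstar x))"
  using positive_cstar_mult[of "incl x"] positive_cstar_mult[of "cstar (incl x)"]
  by (simp_all add: incl_simps cstar_cstar)

text \<open>The list is halved repeatedly. Each doubling multiplies the exponent by
  \<open>3/2\<close>, since \<open>pspan_product\<close> reaches only exponents strictly below twice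
  the given one.\<close>

lemma list_product_in_pspan:
  assumes e: "positive_elem e" and r: "0 < r" and xs: "\<And>x. x \<in> set xs \<Longrightarrow> incl x \<in> pspan e r"
    and len: "length xs = 2 ^ k"
  shows "incl (list_product xs) \<in> pspan e ((3/2) ^ k * r)"
  using xs len
proof (induction k arbitrary: xs)
  case 0
  then obtain x where "xs = [x]" by (auto simp: length_Suc_conv)
  then show ?case using 0 by simp
next
  case (Suc k)
  define ys zs where "ys = take (2 ^ k) xs" and "zs = drop (2 ^ k) xs"
  have xs: "xs = ys @ zs" by (simp add: ys_def zs_def)
  have len: "length ys = 2 ^ k" "length zs = 2 ^ k" using Suc(3) by (simp_all add: ys_def zs_def)
  have "ys \<noteq> []" "zs \<noteq> []" using len by auto
  then have "incl (list_product xs) = incl (list_product ys) * incl (list_product zs)"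
    by (simp add: xs list_product_append incl_simps)
  also have "\<dots> \<in> pspan e ((3/2) ^ Suc k * r)"
  proof (rule pspan_product[OF e])
    show "incl (list_product ys) \<in> pspan e ((3/2) ^ k * r)" "incl (list_product zs) \<in> pspan e ((3/2) ^ k * r)"
      using Suc.IH[of ys] Suc.IH[of zs] Suc.prems(1) len by (auto simp: xs)
  qed (use r in auto)
  finally show ?case .
qed

text \<open>A sufficiently high power of \<open>I\<close> places \<open>x\<close> in
  \<open>pspan\<close> with an exponent so large that even after taking the root it exceeds 1, and
  \<open>pspan_in_ideal\<close> applies.\<close>

lemma roots_in_ideal:
  assumes I: "cstar_ideal I" and x: "\<And>n. n \<ge> 1 \<Longrightarrow> x \<in> ideal_power I n" and m: "m \<ge> (1::nat)"
  shows "root_pw (1 / real m) (cstar x * x) \<in> I" "root_pw (1 / real m) (x * cstar x) \<in> I"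
proof -
  \<comment> \<open>Half of the desired exponent, so that \<open>s < 1\<close> even for
    \<open>m = 1\<close>; the root is recovered as a square.\<close>
  define s where "s = 1 / (2 * real m)"
  have s: "0 < s" "s < 1" using m by (auto simp: s_def)
  obtain k where k: "16 / s < (3/2::real) ^ k" using real_arch_pow[of "3/2" "16 / s"] by auto
  obtain zs where zs: "set zs \<subseteq> I" "x \<in> ideal_power (set zs) (2 ^ k)"
    using ideal_power_finite[OF x[of "2 ^ k"]] by auto
  \<comment> \<open>\<open>e\<close> dominates every \<open>cstar z * z\<close>, so each
    \<open>z\<close> factors through a power of \<open>e\<close>.\<close>
  define e where "e = sum_list (map (\<lambda>z. cstar z * z) zs)"
  have ince: "incl e = sum_list (map (\<lambda>z. cstar (incl z) * incl z) zs)"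
    by (simp add: e_def incl_sum_list incl_simps)
  have e: "positive_elem (incl e)" unfolding ince by (intro positive_sum_list positive_cstar_mult)
  have eI: "e \<in> I"
    using zs(1) unfolding e_def by (induction zs) (auto intro: cstar_idealD[OF I])
  have z: "incl z \<in> pspan (incl e) (1/8)" if "z \<in> set zs" for z
  proof -
    have "positive_elem (incl e - cstar (incl z) * incl z)"
      unfolding ince using sum_list_map_remove1[OF that, of "\<lambda>z. cstar (incl z) * incl z"]
      by (simp add: positive_sum_list positive_cstar_mult)
    then obtain u where "u * pw (1/4) (incl e) = incl z"
      using factorization[OF e, of "incl z" "1/4"] by auto
    moreover have "pw (1/8) (incl e) * pw (1/8) (incl e) = pw (1/4) (incl e)" using pw_add[OF e, of "1/8" "1/8"] by simp
    ultimately have "incl z = u * pw (1/8) (incl e) * pw (1/8) (incl e)" by (simp add: mult.assoc)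
    then show ?thesis using pspan.gen by metis
  qed
  define r where "r = (3/2) ^ k * (1/8::real)"
  have r: "0 < r" "2 < s * r" using k s by (auto simp: r_def divide_simps mult.commute)
  have xr: "incl x \<in> pspan (incl e) r"
  proof -
    have "x \<in> {x. incl x \<in> pspan (incl e) r}"
      using zs(2)
    proof (rule ideal_power_induct)
      show "additive_subgroup_set {x. incl x \<in> pspan (incl e) r}"
        by (auto simp: additive_subgroup_set_def incl_simps intro: pspan.intros pspan_minus)
      fix xs :: "'a list" assume "length xs = 2 ^ k" "set xs \<subseteq> set zs"
      then have "incl (list_product xs) \<in> pspan (incl e) r"
        unfolding r_def using z by (intro list_product_in_pspan[OF e]) auto
      then show "list_product xs \<in> {x. incl x \<in> pspan (incl e) r}" by simp
    qed
    then show ?thesis by simp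
  qed
  have main: "root_pw (1 / real m) b \<in> I" if b: "positive_elem (incl b)" and br: "incl b \<in> pspan (incl e) r" for b
  proof -
    have "pw s (incl b) \<in> pspan (incl e) 2"
      by (rule pw_in_pspan[OF e r(1) b br s _ r(2)]) simp
    then have "root_pw s b \<in> I"
      by (intro pspan_in_ideal[OF I eI e, of 2]) (simp_all add: incl_root_pw b s)
    then have "root_pw s b * root_pw s b \<in> I" by (rule cstar_idealD[OF I])
    then have "root_pw (s + s) b \<in> I" by (simp only: root_pw_add[OF b s(1) s(1)])
    moreover have "s + s = 1 / real m" by (simp add: s_def)
    ultimately show ?thesis by simp
  qed
  show "root_pw (1 / real m) (cstar x * x) \<in> I"
    by (rule main[OF positive_incl_square(1)]) (simp only: incl_simps pspan_mult_left xr)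
  show "root_pw (1 / real m) (x * cstar x) \<in> I"
    by (rule main[OF positive_incl_square(2)]) (simp only: incl_simps pspan_mult_right xr)
qed

lemma roots_imp_ideal_power:
  assumes I: "cstar_ideal I" and e: "positive_elem (incl e)"
    and roots: "\<And>m. m \<ge> 1 \<Longrightarrow> root_pw (1 / real m) e \<in> I"
    and x: "incl x = a * pw (1/4) (incl e) * b" and n: "n \<ge> 1"
  shows "x \<in> ideal_power I n"
proof -
  \<comment> \<open>\<open>pw (1/4)\<close> becomes a product of \<open>n + 2\<close> equal factors
    in \<open>I\<close>: \<open>n\<close> of them give an element of the power, and the outer two
    absorb \<open>a\<close> and \<open>b\<close> from the unitization.\<close>
  define d where "d = 1 / real (4 * (n + 2))"
  have d: "0 < d" by (simp add: d_def)
  define c where "c = root_pw d e"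
  have c: "c \<in> I" unfolding c_def d_def by (rule roots) simp
  have ic: "incl c = pw d (incl e)" unfolding c_def by (rule incl_root_pw[OF e d])
  have "incl c ^ (n + 2) = pw (real (n + 2) * d) (incl e)"
    using pw_power[OF e d, of "Suc n"] by (simp add: ic)
  also have "real (n + 2) * d = 1/4" by (simp add: d_def divide_simps)
  finally have "pw (1/4) (incl e) = incl c * incl c ^ n * incl c" by (simp add: power_commutes mult.assoc)
  then have "incl x = (a * incl c) * incl c ^ n * (incl c * b)" by (simp add: x mult.assoc)
  also have "\<dots> = incl (uelem (a * incl c) * list_product (replicate n c) * uelem (incl c * b))"
  proof -
    have "incl (uelem (a * incl c)) = a * incl c" "incl (uelem (incl c * b)) = incl c * b"
      by (rule incl_uelem, simp)+
    then show ?thesis using n by (simp only: incl_simps incl_list_product_replicate)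
  qed
  finally have "x = uelem (a * incl c) * list_product (replicate n c) * uelem (incl c * b)" by (rule incl_inject)
  moreover have "list_product (replicate n c) \<in> ideal_power I n"
    using c by (intro ideal_power_gen) auto
  ultimately show ?thesis using cstar_idealD(4,5)[OF cstar_ideal_power[OF I n]] by simp
qed

lemma cstar_nth_root_in_positives_iff:
  assumes "n \<ge> 1"
  shows "cstar_nth_root n (cstar x * x) \<in> ideal_positives I \<longleftrightarrow> root_pw (1 / real n) (cstar x * x) \<in> I"
    "cstar_nth_root n (x * cstar x) \<in> ideal_positives I \<longleftrightarrow> root_pw (1 / real n) (x * cstar x) \<in> I"
  using assms positive_incl_square[of x]
  by (auto simp: cstar_nth_root_eq ideal_positives_def cstar_positives_iff incl_root_pw positive_pw)

text \<open>One inclusion is \<open>roots_in_ideal\<close>. For the other, \<open>x\<close> factors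
  through the fourth root of \<open>cstar x * x\<close>, or by taking adjoints through that of
  \<open>x * cstar x\<close>, and \<open>roots_imp_ideal_power\<close> applies.\<close>

lemma Inter_ideal_power_eq:
  assumes I: "cstar_ideal I"
  shows "(\<Inter>n\<in>{1..}. ideal_power I n) = {x. \<forall>m\<ge>1. root_pw (1 / real m) (cstar x * x) \<in> I}"
    "(\<Inter>n\<in>{1..}. ideal_power I n) = {x. \<forall>m\<ge>1. root_pw (1 / real m) (x * cstar x) \<in> I}"
proof -
  have fact: "\<exists>u. incl x = u * pw (1/4) (incl (cstar x * x)) * 1" for x :: 'a
  proof -
    obtain u where "u * pw (1/4) (incl (cstar x * x)) = incl x"
      using factorization[OF positive_incl_square(1), of x "incl x" "1/4"] by (auto simp: incl_simps)
    then show ?thesis by (metis mult_1_right)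
  qed
  have fact2: "\<exists>u. incl x = 1 * pw (1/4) (incl (x * cstar x)) * u" for x :: 'a
  proof -
    obtain u where u: "incl (cstar x) = u * pw (1/4) (incl (x * cstar x))"
      using fact[of "cstar x"] by (auto simp: cstar_cstar)
    have "incl x = cstar (incl (cstar x))" by (simp add: incl_simps cstar_cstar)
    also have "\<dots> = pw (1/4) (incl (x * cstar x)) * cstar u"
      unfolding u by (simp add: cstar_mult positive_incl_square)
    finally show ?thesis by (metis mult_1_left)
  qed
  have "x \<in> ideal_power I n" if x: "\<forall>m\<ge>1. root_pw (1 / real m) (cstar x * x) \<in> I" and n: "n \<ge> 1" for x n
  proof -
    obtain u where u: "incl x = u * pw (1/4) (incl (cstar x * x)) * 1" using fact by blast
    show ?thesis by (rule roots_imp_ideal_power[OF I positive_incl_square(1) _ u n]) (use x in blast)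
  qed
  then show "(\<Inter>n\<in>{1..}. ideal_power I n) = {x. \<forall>m\<ge>1. root_pw (1 / real m) (cstar x * x) \<in> I}"
    using roots_in_ideal(1)[OF I] by (intro set_eqI iffI) blast+
  have "x \<in> ideal_power I n" if x: "\<forall>m\<ge>1. root_pw (1 / real m) (x * cstar x) \<in> I" and n: "n \<ge> 1" for x n
  proof -
    obtain u where u: "incl x = 1 * pw (1/4) (incl (x * cstar x)) * u" using fact2 by blast
    show ?thesis by (rule roots_imp_ideal_power[OF I positive_incl_square(2) _ u n]) (use x in blast)
  qed
  then show "(\<Inter>n\<in>{1..}. ideal_power I n) = {x. \<forall>m\<ge>1. root_pw (1 / real m) (x * cstar x) \<in> I}"
    using roots_in_ideal(2)[OF I] by (intro set_eqI iffI) blast+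
qed

section \<open>Semiprime ideals and intersections of powers\<close>

lemma Inter_ideal_power_ideal:
  assumes "cstar_ideal I" shows "cstar_ideal (\<Inter>n\<in>{1..}. ideal_power I n)"
proof (rule cstar_ideal_Inter)
  fix K assume "K \<in> ideal_power I ` {1..}"
  then show "cstar_ideal K" using cstar_ideal_power[OF assms] by (elim imageE) simp
qed

lemma Inter_ideal_power_subset:
  assumes "cstar_ideal I" shows "(\<Inter>n\<in>{1..}. ideal_power I n) \<subseteq> I"
proof -
  have "(\<Inter>n\<in>{1..}. ideal_power I n) \<subseteq> ideal_power I 1" by (rule INT_lower) simp
  then show ?thesis by (simp only: ideal_power_one[OF assms])
qed

text \<open>Membership of \<open>x\<close> depends only on the roots of
  \<open>e = cstar x * x\<close>. These are also roots of the fourth power of \<open>e\<close>,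
  which is controlled because \<open>e * e\<close> lies in the square of \<open>K\<close>.\<close>

lemma semiprime_Inter_ideal_power:
  assumes I: "cstar_ideal I" shows "semiprime_ideal (\<Inter>n\<in>{1..}. ideal_power I n)"
  unfolding semiprime_ideal_def
proof (intro conjI allI impI subsetI Inter_ideal_power_ideal I)
  fix K x assume K: "cstar_ideal K \<and> ideal_power K 2 \<subseteq> (\<Inter>n\<in>{1..}. ideal_power I n)" and x: "x \<in> K"
  define e where "e = cstar x * x"
  have "e \<in> K" unfolding e_def using K x cstar_idealD(4) by blast
  then have "e * e \<in> ideal_power K 2" using ideal_power_gen[of "[e, e]" 2 K] by simp
  then have "e * e \<in> (\<Inter>n\<in>{1..}. ideal_power I n)" using K by blast
  then have ee: "\<And>m. m \<ge> 1 \<Longrightarrow> root_pw (1 / real m) (cstar (e * e) * (e * e)) \<in> I"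
    unfolding Inter_ideal_power_eq(1)[OF I] by blast
  have e: "positive_elem (incl e)" unfolding e_def by (rule positive_incl_square)
  have es: "cstar e = e" by (simp add: e_def cstar_mult cstar_cstar)
  have "incl (cstar (e * e) * (e * e)) = pw 1 (incl e) ^ Suc 3"
    by (simp add: es cstar_mult incl_simps pw_1 e numeral_3_eq_3 mult.assoc)
  also have "\<dots> = pw 4 (incl e)" using pw_power[OF e, of 1 3] by simp
  finally have e4: "incl (cstar (e * e) * (e * e)) = pw 4 (incl e)" .
  have "root_pw (1 / real m) e \<in> I" if m: "m \<ge> 1" for m
  proof -
    have "pw (1 / real (4 * m)) (pw 4 (incl e)) = pw (1 / real m) (incl e)"
      using pw_pw[OF e, of 4 "1 / real (4 * m)"] m by simp
    then have "root_pw (1 / real (4 * m)) (cstar (e * e) * (e * e)) = root_pw (1 / real m) e"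
      by (simp only: root_pw_def e4)
    then show ?thesis using ee[of "4 * m"] m by simp
  qed
  then show "x \<in> (\<Inter>n\<in>{1..}. ideal_power I n)"
    unfolding Inter_ideal_power_eq(1)[OF I] by (simp add: e_def)
qed

text \<open>The ideals \<open>K r\<close> grow as \<open>r\<close> decreases. \<open>K 2\<close> is
  in \<open>J\<close>, and semiprimeness shrinks the exponent by the factor \<open>2/3\<close> at
  each step, so \<open>J\<close> contains all roots of \<open>e\<close>.\<close>

lemma semiprime_subset_Inter_ideal_power:
  assumes J: "semiprime_ideal J" shows "J \<subseteq> (\<Inter>n\<in>{1..}. ideal_power J n)"
proof
  fix x assume x: "x \<in> J"
  have I: "cstar_ideal J" using J by (simp add: semiprime_ideal_def)
  define e where "e = cstar x * x"
  have eJ: "e \<in> J" unfolding e_def using I x cstar_idealD(4) by blast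
  have e: "positive_elem (incl e)" unfolding e_def by (rule positive_incl_square)
  define K where "K r = {y. incl y \<in> pspan (incl e) r}" for r
  have K: "cstar_ideal (K r)" for r
    by (auto simp: cstar_ideal_def additive_subgroup_set_def K_def incl_simps
        intro: pspan.intros pspan_minus pspan_mult_left pspan_mult_right)
  \<comment> \<open>As \<open>r < 2 * (2/3 * r)\<close>, the square of \<open>K (2/3 * r)\<close>
    lies in \<open>K r\<close>, hence in \<open>J\<close>.\<close>
  have step: "K (2/3 * r) \<subseteq> J" if r: "0 < r" and Kr: "K r \<subseteq> J" for r
  proof -
    have "ideal_power (K (2/3 * r)) 2 \<subseteq> K r"
    proof
      fix y assume "y \<in> ideal_power (K (2/3 * r)) 2"
      then show "y \<in> K r"
      proof (rule ideal_power_induct)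
        show "additive_subgroup_set (K r)" using K by (simp add: cstar_ideal_def)
        fix xs assume "length xs = 2" "set xs \<subseteq> K (2/3 * r)"
        then obtain a b where ab: "xs = [a, b]" "a \<in> K (2/3 * r)" "b \<in> K (2/3 * r)"
          by (auto simp: length_Suc_conv numeral_2_eq_2)
        have "incl a * incl b \<in> pspan (incl e) r"
          using ab r by (intro pspan_product[OF e, of "2/3 * r"]) (auto simp: K_def)
        then show "list_product xs \<in> K r" by (simp add: ab K_def incl_simps)
      qed
    qed
    then show ?thesis using J K Kr unfolding semiprime_ideal_def by blast
  qed
  have Kk: "K (2 * (2/3) ^ k) \<subseteq> J" for k
  proof (induction k)
    case 0
    show ?case using pspan_in_ideal[OF I eJ e, of 2] by (auto simp: K_def)
  next
    case (Suc k)
    from step[OF _ Suc] show ?case by (simp add: mult.left_commute)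
  qed
  have "root_pw (1 / real m) e \<in> J" if m: "m \<ge> 1" for m
  proof -
    have m0: "0 < 1 / real m" using m by simp
    obtain k where k: "(2/3::real) ^ k < 1 / real m / 2"
      using real_arch_pow_inv[of "1 / real m / 2" "2/3"] m0 by auto
    have "pw (1 / real m) (incl e) \<in> pspan (incl e) (1 / real m)"
      using pspan.gen[of 1 "1 / real m" "incl e" 1] by simp
    then have "pw (1 / real m) (incl e) \<in> pspan (incl e) (2 * (2/3) ^ k)"
      
      by (rule subsetD[OF pspan_antimono[OF e], rotated 2]) (use k in auto)
    then have "root_pw (1 / real m) e \<in> K (2 * (2/3) ^ k)"
      unfolding K_def by (simp add: incl_root_pw[OF e m0])
    then show ?thesis using Kk by blast
  qed
  then show "x \<in> (\<Inter>n\<in>{1..}. ideal_power J n)"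
    unfolding Inter_ideal_power_eq(1)[OF I] by (simp add: e_def)
qed

lemma semiprime_Inter:
  assumes "\<And>I. I \<in> F \<Longrightarrow> semiprime_ideal I" shows "semiprime_ideal (\<Inter>F)"
  unfolding semiprime_ideal_def
proof (intro conjI allI impI)
  show "cstar_ideal (\<Inter>F)" using assms by (intro cstar_ideal_Inter) (simp add: semiprime_ideal_def)
  show "J \<subseteq> \<Inter>F" if "cstar_ideal J \<and> ideal_power J 2 \<subseteq> \<Inter>F" for J
  proof (rule Inter_greatest)
    fix I assume "I \<in> F"
    then have "ideal_power J 2 \<subseteq> I" using that by blast
    then show "J \<subseteq> I" using assms[OF \<open>I \<in> F\<close>] that unfolding semiprime_ideal_def by blast
  qed
qed

text \<open>Each member lies in the intersection of its own powers, hence in that of the powers of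
  the sum. So the sum equals the intersection of its powers, which is semiprime.\<close>

lemma semiprime_Sum:
  assumes F: "\<And>I. I \<in> F \<Longrightarrow> semiprime_ideal I" shows "semiprime_ideal (ideal_Sum F)"
proof -
  let ?S = "ideal_Sum F"
  have S: "cstar_ideal ?S" using F by (intro cstar_ideal_Sum) (simp add: semiprime_ideal_def)
  have "I \<subseteq> (\<Inter>n\<in>{1..}. ideal_power ?S n)" if "I \<in> F" for I
    using semiprime_subset_Inter_ideal_power[OF F[OF that]] ideal_power_mono[OF ideal_Sum_upper[OF that]] by blast
  then have "?S \<subseteq> (\<Inter>n\<in>{1..}. ideal_power ?S n)"
    by (rule ideal_Sum_least[OF Inter_ideal_power_ideal[OF S]])
  then have "?S = (\<Inter>n\<in>{1..}. ideal_power ?S n)" using Inter_ideal_power_subset[OF S] by (rule equalityI)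
  then show ?thesis using semiprime_Inter_ideal_power[OF S] by simp
qed

text \<open>The intersection of the powers is itself one of the semiprime ideals summed, and it
  contains all the others.\<close>

lemma ideal_infinity_eq:
  assumes I: "cstar_ideal I" shows "ideal_infinity I = (\<Inter>n\<in>{1..}. ideal_power I n)"
proof
  show "ideal_infinity I \<subseteq> (\<Inter>n\<in>{1..}. ideal_power I n)"
    unfolding ideal_infinity_def
  proof (rule ideal_Sum_least[OF Inter_ideal_power_ideal[OF I]])
    fix J assume "J \<in> {J. semiprime_ideal J \<and> J \<subseteq> I}"
    then have "semiprime_ideal J" "J \<subseteq> I" by auto
    then show "J \<subseteq> (\<Inter>n\<in>{1..}. ideal_power I n)"
      using semiprime_subset_Inter_ideal_power[of J] ideal_power_mono[of J I] by blast
  qed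
  show "(\<Inter>n\<in>{1..}. ideal_power I n) \<subseteq> ideal_infinity I"
    unfolding ideal_infinity_def
    by (rule ideal_Sum_upper, intro CollectI conjI semiprime_Inter_ideal_power Inter_ideal_power_subset I)
qed

theorem theorem5p12:
  shows "(\<forall>F :: 'a::cstar_algebra set set.
            (\<forall>I\<in>F. semiprime_ideal I) \<longrightarrow>
              semiprime_ideal (\<Inter> F) \<and> semiprime_ideal (ideal_Sum F))
       \<and> (\<forall>I :: 'a set. cstar_ideal I \<longrightarrow>
            semiprime_ideal (ideal_infinity I)
          \<and> ideal_infinity I \<subseteq> I
          \<and> (\<forall>J. semiprime_ideal J \<and> J \<subseteq> I \<longrightarrow> J \<subseteq> ideal_infinity I)
          \<and> ideal_infinity I = (\<Inter>n\<in>{1..}. ideal_power I n)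
          \<and> ideal_infinity I =
              {x. \<forall>n\<ge>1. cstar_nth_root n (cstar x * x) \<in> ideal_positives I}
          \<and> ideal_infinity I =
              {x. \<forall>n\<ge>1. cstar_nth_root n (x * cstar x) \<in> ideal_positives I})"
proof (rule conjI; intro allI impI)
  fix F :: "'a set set" assume "\<forall>I\<in>F. semiprime_ideal I"
  then show "semiprime_ideal (\<Inter> F) \<and> semiprime_ideal (ideal_Sum F)"
    by (simp add: semiprime_Inter semiprime_Sum)
next
  fix I :: "'a set" assume I: "cstar_ideal I"
  have "J \<subseteq> ideal_infinity I" if "semiprime_ideal J \<and> J \<subseteq> I" for J
    unfolding ideal_infinity_def by (rule ideal_Sum_upper) (simp add: that)
  moreover have "ideal_infinity I = {x. \<forall>n\<ge>1. cstar_nth_root n (cstar x * x) \<in> ideal_positives I}"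
    "ideal_infinity I = {x. \<forall>n\<ge>1. cstar_nth_root n (x * cstar x) \<in> ideal_positives I}"
    using Inter_ideal_power_eq[OF I] by (auto simp: ideal_infinity_eq[OF I] cstar_nth_root_in_positives_iff)
  ultimately show "semiprime_ideal (ideal_infinity I)
      \<and> ideal_infinity I \<subseteq> I
      \<and> (\<forall>J. semiprime_ideal J \<and> J \<subseteq> I \<longrightarrow> J \<subseteq> ideal_infinity I)
      \<and> ideal_infinity I = (\<Inter>n\<in>{1..}. ideal_power I n)
      \<and> ideal_infinity I = {x. \<forall>n\<ge>1. cstar_nth_root n (cstar x * x) \<in> ideal_positives I}
      \<and> ideal_infinity I = {x. \<forall>n\<ge>1. cstar_nth_root n (x * cstar x) \<in> ideal_positives I}"
    using semiprime_Inter_ideal_power[OF I] Inter_ideal_power_subset[OF I] ideal_infinity_eq[OF I] by simp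
qed

end
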